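(* Let $f$ be piecewise constant with respect to the triangulation $\mathcal{T}$ of $\Omega$. Let $u_{\rm ECR}\in V_{\rm ECR}$ be the solution of $$(\nabla_{\rm NC}u_{\rm ECR},\nabla_{\rm NC}v)=(f,v)\quad\text{for all }v\in V_{\rm ECR},$$ and let $(\sigma_{\rm RT},u_{\rm RT})\in {\rm RT}(\mathcal{T})\times U_{\rm RT}$ be the solution of $$(\sigma_{\rm RT},\tau)+(u_{\rm RT},\operatorname{div}\tau)=0\quad\text{for all }\tau\in{\rm RT}(\mathcal{T}),\qquad (\operatorname{div}\sigma_{\rm RT},v)=-(f,v)\quad\text{for all }v\in U_{\rm RT}.$$ Then $$\sigma_{\rm RT}=\nabla_{\rm NC}u_{\rm ECR}\quad\text{and}\quad u_{\rm RT}=\Pi_0u_{\rm ECR}.$$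
   Context: $\Omega\subset\mathbb{R}^n$ is a bounded polytopal domain; $\mathcal{T}$ is a shape-regular (conforming, i.e. face-to-face) triangulation covering $\overline\Omega$ exactly by $n$-simplices. $(\cdot,\cdot)$ is the $L^2(\Omega)$ inner product. $\mathcal{E}(\Omega)$ and $\mathcal{E}(\partial\Omega)$ are the sets of interior and boundary $(n-1)$-dimensional subsimplices (faces) of $\mathcal{T}$. For an interior face $E$ shared by $K^+,K^-\in\mathcal{T}$, $[v]:=v|_{K^+}-v|_{K^-}$ on $E$. $P_m(K)$ is the space of polynomials of degree $\le m$ on $K$. $\nabla_{\rm NC}$ is the gradient taken elementwise with respect to $\mathcal{T}$. "Piecewise constant with respect to $\mathcal{T}$" means constant on each $K\in\mathcal{T}$. $\Pi_0$ is the $L^2$ projection onto piecewise constant functions with respect to $\mathcal{T}$. Enriched Crouzeix--Raviart (ECR) space: ${\rm ECR}(K):=P_1(K)+\operatorname{span}\{\sum_{i=1}^n x_i^2\}$ and $$V_{\rm ECR}:=\Big\{v\in L^2(\Omega,\mathbb{R}): v|_K\in{\rm ECR}(K)\ \forall K\in\mathcal{T},\ \int_E[v]\,dE=0\ \forall E\in\mathcal{E}(\Omega),\ \int_E v\,dE=0\ \forall E\in\mathcal{E}(\partial\Omega)\Big\}.$$ First order Raviart--Thomas (RT) spaces: ${\rm RT}(K):=(P_0(K))^n+xP_0(K)$, $${\rm RT}(\mathcal{T}):=\{\tau\in H(\operatorname{div},\Omega,\mathbb{R}^n):\tau|_K\in{\rm RT}(K)\ \forall K\in\mathcal{T}\},\qquad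 U_{\rm RT}:=\{v\in L^2(\Omega,\mathbb{R}): v|_K\in P_0(K)\ \forall K\in\mathcal{T}\}.$$ *)

theory Defs
  imports "HOL-Analysis.Analysis"
begin

section \<open>Domain and triangulation\<close>

definition polytopal_domain :: "(real^'n) set \<Rightarrow> bool" where
  "polytopal_domain \<Omega> \<longleftrightarrow>
     open \<Omega> \<and> connected \<Omega> \<and> bounded \<Omega> \<and> \<Omega> \<noteq> {} \<and>
     (\<exists>F. finite F \<and> (\<forall>P\<in>F. polytope P \<and> aff_dim P = int CARD('n) - 1) \<and>
          frontier \<Omega> = \<Union>F)"

text \<open>The library predicate \<open>triangulation\<close> contains finiteness and conformity: the intersection
  of two members is a (possibly empty) face of both.\<close>

definition triangulation_of :: "(real^'n) set \<Rightarrow> (real^'n) set set \<Rightarrow> bool" where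
  "triangulation_of \<Omega> \<T> \<longleftrightarrow>
     triangulation \<T> \<and> (\<forall>K\<in>\<T>. (int CARD('n)) simplex K) \<and> \<Union>\<T> = closure \<Omega>"

text \<open>Every element contains a ball whose radius is comparable to the diameter of the element.\<close>

definition shape_regular :: "real \<Rightarrow> (real^'n) set set \<Rightarrow> bool" where
  "shape_regular \<kappa> \<T> \<longleftrightarrow>
     (\<forall>K\<in>\<T>. \<exists>c r. r > 0 \<and> ball c r \<subseteq> K \<and> diameter K \<le> \<kappa> * r)"

definition mesh_faces :: "(real^'n) set set \<Rightarrow> (real^'n) set set" where
  "mesh_faces \<T> = {E. \<exists>K\<in>\<T>. E facet_of K}"

definition boundary_faces :: "(real^'n) set \<Rightarrow> (real^'n) set set \<Rightarrow> (real^'n) set set" where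
  "boundary_faces \<Omega> \<T> = {E \<in> mesh_faces \<T>. E \<subseteq> frontier \<Omega>}"

definition interior_faces :: "(real^'n) set \<Rightarrow> (real^'n) set set \<Rightarrow> (real^'n) set set" where
  "interior_faces \<Omega> \<T> = mesh_faces \<T> - boundary_faces \<Omega> \<T>"


section \<open>Square integrable functions\<close>

text \<open>Elements of Lebesgue spaces are represented by functions on the whole space, of which only the
  values almost everywhere on \<open>\<Omega>\<close> matter.\<close>

definition L2 :: "(real^'n) set \<Rightarrow> (real^'n \<Rightarrow> 'b::euclidean_space) set" where
  "L2 \<Omega> = {v. v \<in> borel_measurable (lebesgue_on \<Omega>) \<and>
               integrable (lebesgue_on \<Omega>) (\<lambda>x. (norm (v x))\<^sup>2)}"

definition l2_inner ::
  "(real^'n) set \<Rightarrow> (real^'n \<Rightarrow> 'b::euclidean_space) \<Rightarrow> (real^'n \<Rightarrow> 'b) \<Rightarrow> real" where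
  "l2_inner \<Omega> v w = (\<integral>x. v x \<bullet> w x \<partial>lebesgue_on \<Omega>)"


section \<open>Weak divergence\<close>

primrec Ck :: "nat \<Rightarrow> (real^'n \<Rightarrow> real) \<Rightarrow> bool" where
  "Ck 0 \<phi> = continuous_on UNIV \<phi>"
| "Ck (Suc k) \<phi> =
     (\<exists>g :: real^'n \<Rightarrow> real^'n. (\<forall>x. GDERIV \<phi> x :> g x) \<and> (\<forall>i. Ck k (\<lambda>x. g x $ i)))"

definition grad :: "(real^'n \<Rightarrow> real) \<Rightarrow> real^'n \<Rightarrow> real^'n" where
  "grad \<phi> x = (THE D. GDERIV \<phi> x :> D)"

definition test_functions :: "(real^'n) set \<Rightarrow> (real^'n \<Rightarrow> real) set" where
  "test_functions \<Omega> =
     {\<phi>. (\<forall>k. Ck k \<phi>) \<and> compact (closure {x. \<phi> x \<noteq> 0}) \<and> closure {x. \<phi> x \<noteq> 0} \<subseteq> \<Omega>}"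

definition has_weak_div ::
  "(real^'n) set \<Rightarrow> (real^'n \<Rightarrow> real^'n) \<Rightarrow> (real^'n \<Rightarrow> real) \<Rightarrow> bool" where
  "has_weak_div \<Omega> \<tau> d \<longleftrightarrow>
     (\<forall>\<phi>\<in>test_functions \<Omega>. l2_inner \<Omega> \<tau> (grad \<phi>) = - l2_inner \<Omega> d \<phi>)"

definition Hdiv :: "(real^'n) set \<Rightarrow> (real^'n \<Rightarrow> real^'n) set" where
  "Hdiv \<Omega> = {\<tau> \<in> L2 \<Omega>. \<exists>d\<in>L2 \<Omega>. has_weak_div \<Omega> \<tau> d}"

text \<open>The weak divergence is unique almost everywhere in \<open>\<Omega>\<close>; one representative is chosen.\<close>

definition weak_div :: "(real^'n) set \<Rightarrow> (real^'n \<Rightarrow> real^'n) \<Rightarrow> real^'n \<Rightarrow> real" where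
  "weak_div \<Omega> \<tau> = (SOME d. d \<in> L2 \<Omega> \<and> has_weak_div \<Omega> \<tau> d)"


section \<open>Restriction to elements, integrals over faces\<close>

text \<open>For square integrable \<open>v\<close>, the statement \<open>v|\<^sub>K \<in> W\<close>. It has to be read almost everywhere on
  the closed simplex \<open>K\<close>: pointwise it would prescribe common values on shared faces.\<close>

definition restricts_to ::
  "(real^'n \<Rightarrow> 'b) \<Rightarrow> (real^'n) set \<Rightarrow> (real^'n \<Rightarrow> 'b) set \<Rightarrow> bool" where
  "restricts_to v K W \<longleftrightarrow> (\<exists>p\<in>W. AE x in lebesgue_on K. v x = p x)"

text \<open>The function \<open>v|\<^sub>K\<close> up to and including the boundary of \<open>K\<close>: the continuous representative
  of \<open>v\<close> on \<open>K\<close>. For a full-dimensional simplex \<open>K\<close> its values on \<open>K\<close> are unique.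
  It is only used for \<open>v\<close> that are polynomial on \<open>K\<close>.\<close>

definition elem_rep :: "(real^'n \<Rightarrow> real) \<Rightarrow> (real^'n) set \<Rightarrow> real^'n \<Rightarrow> real" where
  "elem_rep v K = (SOME g. continuous_on K g \<and> (AE x in lebesgue_on K. v x = g x))"

text \<open>The elementwise gradient; the interiors of the elements are disjoint and the mesh skeleton
  has measure zero.\<close>

definition nabla_NC :: "(real^'n) set set \<Rightarrow> (real^'n \<Rightarrow> real) \<Rightarrow> real^'n \<Rightarrow> real^'n" where
  "nabla_NC \<T> v x = (\<Sum>K\<in>\<T>. if x \<in> interior K then grad (elem_rep v K) x else 0)"

text \<open>The integral over an \<open>(n-1)\<close>-dimensional convex set \<open>E\<close> with respect to the
  \<open>(n-1)\<close>-dimensional Lebesgue measure of the hyperplane \<open>affine hull E\<close>. That measure is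
  obtained as the \<open>n\<close>-dimensional measure of the right prism over \<open>E\<close> of thickness 1, and
  \<open>closest_point (affine hull E)\<close> is the orthogonal projection onto the hyperplane.
  For \<open>n = 1\<close> this is evaluation at the point.\<close>

definition face_integral :: "(real^'n) set \<Rightarrow> (real^'n \<Rightarrow> real) \<Rightarrow> real" where
  "face_integral E g =
     (let \<pi> = closest_point (affine hull E) in
      \<integral>z. g (\<pi> z) \<partial>lebesgue_on {z. \<pi> z \<in> E \<and> dist z (\<pi> z) \<le> 1/2})"


section \<open>Finite element spaces\<close>

definition P0 :: "(real^'n) set \<Rightarrow> (real^'n \<Rightarrow> real) set" where
  "P0 K = {p. \<exists>c. \<forall>x\<in>K. p x = c}"

definition P1 :: "(real^'n) set \<Rightarrow> (real^'n \<Rightarrow> real) set" where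
  "P1 K = {p. \<exists>a b. \<forall>x\<in>K. p x = a + (\<Sum>i\<in>UNIV. b i * x $ i)}"

definition ECR :: "(real^'n) set \<Rightarrow> (real^'n \<Rightarrow> real) set" where
  "ECR K = {\<lambda>x. p x + c * (\<Sum>i\<in>UNIV. (x $ i)\<^sup>2) | p c. p \<in> P1 K}"

definition V_ECR :: "(real^'n) set \<Rightarrow> (real^'n) set set \<Rightarrow> (real^'n \<Rightarrow> real) set" where
  "V_ECR \<Omega> \<T> =
     {v \<in> L2 \<Omega>.
        (\<forall>K\<in>\<T>. restricts_to v K (ECR K)) \<and>
        (\<forall>E\<in>interior_faces \<Omega> \<T>. \<forall>K\<^sub>1\<in>\<T>. \<forall>K\<^sub>2\<in>\<T>. K\<^sub>1 \<noteq> K\<^sub>2 \<and> E facet_of K\<^sub>1 \<and> E facet_of K\<^sub>2 \<longrightarrow>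
           face_integral E (\<lambda>x. elem_rep v K\<^sub>1 x - elem_rep v K\<^sub>2 x) = 0) \<and>
        (\<forall>E\<in>boundary_faces \<Omega> \<T>. \<forall>K\<in>\<T>. E facet_of K \<longrightarrow>
           face_integral E (elem_rep v K) = 0)}"

definition RT_elem :: "(real^'n) set \<Rightarrow> (real^'n \<Rightarrow> real^'n) set" where
  "RT_elem K = {\<lambda>x. (\<chi> i. a i x) + c x *\<^sub>R x | a c. (\<forall>i. a i \<in> P0 K) \<and> c \<in> P0 K}"

definition RT :: "(real^'n) set \<Rightarrow> (real^'n) set set \<Rightarrow> (real^'n \<Rightarrow> real^'n) set" where
  "RT \<Omega> \<T> = {\<tau> \<in> Hdiv \<Omega>. \<forall>K\<in>\<T>. restricts_to \<tau> K (RT_elem K)}"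

definition piecewise_constant :: "(real^'n) set set \<Rightarrow> (real^'n \<Rightarrow> real) \<Rightarrow> bool" where
  "piecewise_constant \<T> v \<longleftrightarrow> (\<forall>K\<in>\<T>. restricts_to v K (P0 K))"

definition U_RT :: "(real^'n) set \<Rightarrow> (real^'n) set set \<Rightarrow> (real^'n \<Rightarrow> real) set" where
  "U_RT \<Omega> \<T> = {v \<in> L2 \<Omega>. piecewise_constant \<T> v}"

text \<open>The orthogonal projection in \<open>L2 \<Omega>\<close> onto the piecewise constant functions, as a
  representative determined almost everywhere in \<open>\<Omega>\<close>.\<close>

definition Pi0 :: "(real^'n) set \<Rightarrow> (real^'n) set set \<Rightarrow> (real^'n \<Rightarrow> real) \<Rightarrow> real^'n \<Rightarrow> real" where
  "Pi0 \<Omega> \<T> v =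
     (SOME w. w \<in> U_RT \<Omega> \<T> \<and> (\<forall>z\<in>U_RT \<Omega> \<T>. l2_inner \<Omega> (\<lambda>x. v x - w x) z = 0))"

end

theory Submission
  imports Defs "HOL-Computational_Algebra.Polynomial"
begin

text \<open>
  On an element \<open>K\<close> the Raviart--Thomas field \<open>\<sigma>_RT\<close> is \<open>a + c x\<close>, which is the gradient of the quadratic
  polynomial \<open>y\<^sub>K(x) = const + a \<bullet> x + (c/2) |x|\<^sup>2\<close> in \<open>ECR K\<close>. The constant is free, and it is chosen such that
  the mean of \<open>y\<^sub>K\<close> over \<open>K\<close> is the value of \<open>u_RT\<close>. The theorem says that the function \<open>y\<close> composed
  of the \<open>y\<^sub>K\<close> is \<open>u_ECR\<close>. Three observations give this.

  First, \<open>y\<close> belongs to \<open>V_ECR\<close>. The divergence of a Raviart--Thomas field \<open>\<tau>\<close> is piecewise constant, so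
  \<open>u_RT\<close> may be replaced by \<open>y\<close> in the first mixed equation. Integration by parts on every element
  turns that equation into \<open>\<Sum>\<^sub>E \<Sum>\<^sub>K (\<tau>\<^sub>K \<bullet> \<nu>\<^sub>K) \<integral>\<^sub>E y\<^sub>K = 0\<close>, the sums running over the faces \<open>E\<close> and the elements \<open>K\<close>
  having \<open>E\<close> as a facet. Fields whose normal component lives on a single face (\<open>single_face_field\<close>)
  isolate the face conditions of \<open>V_ECR\<close>.

  Second, \<open>y\<close> has the gradient of \<open>u_ECR\<close>. The second mixed equation says \<open>div \<sigma>_RT = - f\<close>, and the normal
  components of \<open>\<sigma>_RT\<close> match across interior faces, so \<open>integration_by_parts\<close> shows
  \<open>(\<nabla> y, \<nabla> v) = (f, v)\<close> for all \<open>v\<close> in \<open>V_ECR\<close>. This is the equation of \<open>u_ECR\<close>; testing the difference of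
  the two with \<open>y - u_ECR\<close> makes the piecewise gradients equal.

  Third, \<open>W = y - u_ECR\<close> vanishes. It is piecewise constant, and its face conditions say that it does not jump across
  interior faces and is zero at boundary faces. Hence \<open>\<tau>(x) = W(x) x\<close> has matching normal components, and
  integrating it by parts against \<open>W\<close> leaves \<open>n \<parallel>W\<parallel>\<^sup>2 = 0\<close>.

  The tool behind all three is Green's formula on a simplex (\<open>green_simplex\<close>). Its fields \<open>a + c x\<close> are
  combinations of the fields \<open>x - p\<close> for the vertices \<open>p\<close>, and \<open>x - p\<close> has a normal component only on the
  facet opposite to \<open>p\<close>. So only \<open>\<integral>\<^sub>K ((x - p) \<bullet> \<nabla>\<phi> + n \<phi>) = h \<integral>\<^sub>F \<phi>\<close> is needed for the pyramid \<open>K\<close> of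
  height \<open>h\<close> over \<open>F\<close> with apex \<open>p\<close> (\<open>pyramid_formula\<close>). Both sides are the derivative at \<open>t = 1\<close> of the
  integral of \<open>\<phi>\<close> over \<open>p + t (K - p)\<close>: the left one by rescaling to \<open>K\<close>, the right one because
  that integral loses a thin layer below \<open>F\<close> when \<open>t\<close> decreases.

  The other ingredient is the description of \<open>RT \<Omega> \<T>\<close> and of the weak divergence by
  elementwise data. Piecewise fields \<open>a\<^sub>K + c\<^sub>K x\<close> are in \<open>H(div)\<close> exactly when their normal components
  match across interior faces (\<open>glue_RT\<close>, \<open>RT_normal_continuous\<close>), and the weak divergence then has
  the integral \<open>n c\<^sub>K |K|\<close> over \<open>K\<close> (\<open>integral_weak_div\<close>). Since the weak divergence is only ever paired with
  piecewise constant functions, these integrals determine both mixed equations.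
\<close>

section \<open>Layers of a solid below a hyperplane\<close>

lemma lborel_pair_integrable_compact:
  fixes f :: "'a::euclidean_space \<times> 'b::euclidean_space \<Rightarrow> real"
  assumes "compact S" "continuous_on S f"
  shows "integrable (lborel \<Otimes>\<^sub>M lborel) (\<lambda>z. indicator S z * f z)"
  using borel_integrable_compact[OF assms] by (simp add: lborel_prod)

text \<open>Fubini in a direction \<open>\<nu>\<close> that need not be a coordinate axis, obtained from the product of \<open>\<real>\<close> with the
  whole space. On the right, \<open>s\<close> is replaced by the translation parameter \<open>w\<close> for which \<open>x + w \<nu>\<close> is the point
  where \<open>g\<close> is evaluated. After exchanging the integrals and translating \<open>x\<close> by \<open>- w \<nu>\<close>, the slab condition
  on \<open>x\<close> has become \<open>|l x - w| \<le> 1/2\<close>, which a set of parameters \<open>w\<close> of length 1 satisfies.\<close>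

lemma layer_average:
  fixes \<nu> :: "'a::euclidean_space" and g :: "'a \<Rightarrow> real"
  assumes \<nu>: "norm \<nu> = 1" and d: "d > 0" and K: "compact K" and g: "continuous_on K g"
  shows "(\<integral>x. indicator {x \<in> K. - d \<le> \<nu> \<bullet> x - b \<and> \<nu> \<bullet> x \<le> b} x * g x \<partial>lborel) =
    d * (\<integral>x. (\<integral>s. indicator {0..1} s * (indicator {x. \<bar>\<nu> \<bullet> x - b\<bar> \<le> 1/2} x *
           (indicator K (x - (\<nu> \<bullet> x - b + s * d) *\<^sub>R \<nu>) * g (x - (\<nu> \<bullet> x - b + s * d) *\<^sub>R \<nu>))) \<partial>lborel) \<partial>lborel)"
    (is "?L = d * ?R")
proof -
  have nn: "\<nu> \<bullet> \<nu> = 1" using \<nu> by (simp add: dot_square_norm)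
  define l where "l x = \<nu> \<bullet> x - b" for x
  have l_add: "l (x + w *\<^sub>R \<nu>) = l x + w" for x w by (simp add: l_def inner_add_right nn)
  define J where "J x w = indicator {x. \<bar>l x\<bar> \<le> 1/2} x *
      (indicator {x \<in> K. - d \<le> l x \<and> l x \<le> 0} (x + w *\<^sub>R \<nu>) * g (x + w *\<^sub>R \<nu>))" for x w
  define J' where "J' x w = indicator {(x,w). \<bar>l x - w\<bar> \<le> 1/2} (x, w) *
      (indicator {x \<in> K. - d \<le> l x \<and> l x \<le> 0} x * g x)" for x w
  obtain B where B: "\<And>x. x \<in> K \<Longrightarrow> norm x \<le> B"
    using compact_imp_bounded[OF K] by (auto simp: bounded_iff)
  have contl: "continuous_on S l" for S unfolding l_def by (intro continuous_intros)
  have Kc: "closed K" using K compact_imp_closed by blast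
  have int1: "integrable (lborel \<Otimes>\<^sub>M lborel) (case_prod J)"
  proof -
    define Q where "Q = {(x,w). \<bar>l x\<bar> \<le> 1/2 \<and> x + w *\<^sub>R \<nu> \<in> K \<and> - d \<le> l x + w \<and> l x + w \<le> 0}"
    have "closed {z::'a\<times>real. fst z + snd z *\<^sub>R \<nu> \<in> K}"
      using continuous_closed_vimage[OF Kc, of "\<lambda>z::'a\<times>real. fst z + snd z *\<^sub>R \<nu>"]
      by (auto simp: vimage_def intro!: continuous_intros)
    moreover have "Q = {z. fst z + snd z *\<^sub>R \<nu> \<in> K} \<inter> {z. \<bar>l (fst z)\<bar> \<le> 1/2} \<inter>
       {z. - d \<le> l (fst z) + snd z} \<inter> {z. l (fst z) + snd z \<le> 0}"
      by (auto simp: Q_def)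
    ultimately have "closed Q"
      by (auto intro!: closed_Int closed_Collect_le continuous_intros simp: l_def)
    moreover have "Q \<subseteq> cball 0 (B + (d + 1/2)) \<times> {- (d+1/2) .. 1/2}"
    proof clarify
      fix x w assume "(x,w) \<in> Q"
      then have q: "\<bar>l x\<bar> \<le> 1/2" "x + w *\<^sub>R \<nu> \<in> K" "- d \<le> l x + w" "l x + w \<le> 0" by (auto simp: Q_def)
      then have w: "w \<in> {- (d+1/2) .. 1/2}" by auto
      have "norm x \<le> norm (x + w *\<^sub>R \<nu>) + norm (w *\<^sub>R \<nu>)"
        by (metis add_diff_cancel_right' norm_triangle_ineq4)
      also have "\<dots> \<le> B + (d + 1/2)" using B[OF q(2)] w \<nu> d by auto
      finally show "x \<in> cball 0 (B + (d + 1/2)) \<and> w \<in> {- (d+1/2) .. 1/2}" using w by simp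
    qed
    ultimately have Q: "compact Q"
      by (metis compact_Icc compact_Times compact_cball compact_Int_closed inf.absorb_iff2)
    have "continuous_on Q (\<lambda>z. g (fst z + snd z *\<^sub>R \<nu>))"
      by (rule continuous_on_compose2[OF g]) (auto simp: Q_def intro!: continuous_intros)
    from lborel_pair_integrable_compact[OF Q this] show ?thesis
      by (rule Bochner_Integration.integrable_cong[THEN iffD1, rotated -1])
         (auto simp: J_def Q_def l_add indicator_def)
  qed
  have int2: "integrable (lborel \<Otimes>\<^sub>M lborel) (case_prod J')"
  proof -
    define Q where "Q = {(x,w). \<bar>l x - w\<bar> \<le> 1/2 \<and> x \<in> K \<and> - d \<le> l x \<and> l x \<le> 0}"
    have "closed {z::'a\<times>real. fst z \<in> K}"
      using continuous_closed_vimage[OF Kc, of "\<lambda>z::'a\<times>real. fst z"]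
      by (auto simp: vimage_def intro!: continuous_intros)
    moreover have "Q = {z. fst z \<in> K} \<inter> {z. \<bar>l (fst z) - snd z\<bar> \<le> 1/2} \<inter>
       {z. - d \<le> l (fst z)} \<inter> {z. l (fst z) \<le> 0}"
      by (auto simp: Q_def)
    ultimately have "closed Q"
      by (auto intro!: closed_Int closed_Collect_le continuous_intros simp: l_def)
    moreover have "Q \<subseteq> cball 0 B \<times> {- (d+1/2) .. 1/2}"
    proof clarify
      fix x w assume "(x,w) \<in> Q"
      then have q: "\<bar>l x - w\<bar> \<le> 1/2" "x \<in> K" "- d \<le> l x" "l x \<le> 0" by (auto simp: Q_def)
      then have "w \<in> {- (d+1/2) .. 1/2}" unfolding atLeastAtMost_iff by arith
      with B[OF q(2)] show "x \<in> cball 0 B \<and> w \<in> {- (d+1/2) .. 1/2}" by simp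
    qed
    ultimately have Q: "compact Q"
      by (metis compact_Icc compact_Times compact_cball compact_Int_closed inf.absorb_iff2)
    have "continuous_on Q (\<lambda>z. g (fst z))"
      by (rule continuous_on_compose2[OF g]) (auto simp: Q_def intro!: continuous_intros)
    from lborel_pair_integrable_compact[OF Q this] show ?thesis
      by (rule Bochner_Integration.integrable_cong[THEN iffD1, rotated -1])
         (auto simp: J'_def Q_def indicator_def)
  qed
  have "d * ?R = (\<integral>x. (\<integral>w. J x w \<partial>lborel) \<partial>lborel)"
  proof -
    have "(\<integral>w. J x w \<partial>lborel) = d * (\<integral>s. indicator {0..1} s * (indicator {x. \<bar>\<nu> \<bullet> x - b\<bar> \<le> 1/2} x *
           (indicator K (x - (\<nu> \<bullet> x - b + s * d) *\<^sub>R \<nu>) * g (x - (\<nu> \<bullet> x - b + s * d) *\<^sub>R \<nu>))) \<partial>lborel)" for x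
    proof -
      have "(\<integral>w. J x w \<partial>lborel) = \<bar>- d\<bar> *\<^sub>R (\<integral>s. J x (- l x + (- d) * s) \<partial>lborel)"
        by (rule lborel_integral_real_affine) (use d in auto)
      also have "(\<integral>s. J x (- l x + (- d) * s) \<partial>lborel) = (\<integral>s. indicator {0..1} s * (indicator {x. \<bar>\<nu> \<bullet> x - b\<bar> \<le> 1/2} x *
           (indicator K (x - (\<nu> \<bullet> x - b + s * d) *\<^sub>R \<nu>) * g (x - (\<nu> \<bullet> x - b + s * d) *\<^sub>R \<nu>))) \<partial>lborel)"
      proof (rule Bochner_Integration.integral_cong)
        fix s
        have e: "x + (- l x + (- d) * s) *\<^sub>R \<nu> = x - (\<nu> \<bullet> x - b + s * d) *\<^sub>R \<nu>"
          by (simp add: l_def algebra_simps)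
        have l': "l (x - (\<nu> \<bullet> x - b + s * d) *\<^sub>R \<nu>) = - d * s"
          unfolding e[symmetric] l_add by simp
        show "J x (- l x + (- d) * s) = indicator {0..1} s * (indicator {x. \<bar>\<nu> \<bullet> x - b\<bar> \<le> 1/2} x *
           (indicator K (x - (\<nu> \<bullet> x - b + s * d) *\<^sub>R \<nu>) * g (x - (\<nu> \<bullet> x - b + s * d) *\<^sub>R \<nu>)))"
        proof -
          have s: "- d \<le> - d * s \<longleftrightarrow> s \<le> 1" "- d * s \<le> 0 \<longleftrightarrow> 0 \<le> s"
            using d by (simp_all add: zero_le_mult_iff)
          show ?thesis
            unfolding J_def e indicator_def mem_Collect_eq l' s by (auto simp: l_def)
        qed
      qed simp
      finally show ?thesis using d by simp
    qed
    then show ?thesis by simp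
  qed
  also have "\<dots> = (\<integral>w. (\<integral>x. J x w \<partial>lborel) \<partial>lborel)"
    using lborel_pair.Fubini_integral[OF int1] by simp
  also have "\<dots> = (\<integral>w. (\<integral>x. J' x w \<partial>lborel) \<partial>lborel)"
  proof -
    have "(\<integral>x. J x w \<partial>lborel) = (\<integral>x. J' x w \<partial>lborel)" for w
    proof -
      have bm: "(\<lambda>x. J' x w) \<in> borel_measurable borel"
      proof -
        have "integrable lborel (\<lambda>x. indicator K x *\<^sub>R g x)" using borel_integrable_compact[OF K g] .
        then have [measurable]: "(\<lambda>x. indicator K x *\<^sub>R g x) \<in> borel_measurable borel" by auto
        have "(\<lambda>x. J' x w) = (\<lambda>x. indicator {x. \<bar>l x - w\<bar> \<le> 1/2} x *
             (indicator {x. - d \<le> l x \<and> l x \<le> 0} x * (indicator K x *\<^sub>R g x)))"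
          by (auto simp: J'_def indicator_def)
        moreover have "\<dots> \<in> borel_measurable borel" unfolding l_def by measurable
        ultimately show ?thesis by simp
      qed
      have "(\<integral>x. J' x w \<partial>lborel) = (\<integral>x. J' x w \<partial>distr lborel borel ((+) (w *\<^sub>R \<nu>)))"
        by (simp add: lborel_distr_plus)
      also have "\<dots> = (\<integral>x. J' (w *\<^sub>R \<nu> + x) w \<partial>lborel)"
        by (rule integral_distr) (use bm in auto)
      also have "\<dots> = (\<integral>x. J x w \<partial>lborel)"
        by (rule Bochner_Integration.integral_cong)
           (auto simp: J_def J'_def indicator_def add.commute[of "w *\<^sub>R \<nu>"] l_add)
      finally show ?thesis by simp
    qed
    then show ?thesis by simp
  qed
  also have "\<dots> = (\<integral>x. (\<integral>w. J' x w \<partial>lborel) \<partial>lborel)"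
    using lborel_pair.Fubini_integral[OF int2] by simp
  also have "\<dots> = ?L"
  proof (rule Bochner_Integration.integral_cong)
    fix x
    have "(\<integral>w. J' x w \<partial>lborel) = (\<integral>w. indicator {l x - 1/2..l x + 1/2} w * (indicator {x \<in> K. - d \<le> l x \<and> l x \<le> 0} x * g x) \<partial>lborel)"
    proof (rule Bochner_Integration.integral_cong)
      fix w
      have "\<bar>l x - w\<bar> \<le> 1/2 \<longleftrightarrow> w \<in> {l x - 1/2..l x + 1/2}" unfolding atLeastAtMost_iff by arith
      then show "J' x w = indicator {l x - 1/2..l x + 1/2} w * (indicator {x \<in> K. - d \<le> l x \<and> l x \<le> 0} x * g x)"
        by (simp add: J'_def indicator_def)
    qed simp
    also have "\<dots> = indicator {x \<in> K. - d \<le> l x \<and> l x \<le> 0} x * g x"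
      by simp
    also have "\<dots> = indicator {x \<in> K. - d \<le> \<nu> \<bullet> x - b \<and> \<nu> \<bullet> x \<le> b} x * g x"
      by (simp add: l_def)
    finally show "(\<integral>w. J' x w \<partial>lborel) = \<dots>" .
  qed simp
  finally show ?thesis by simp
qed

lemma integral_scaled_copy:
  fixes p :: "'a::euclidean_space" and \<phi> :: "'a \<Rightarrow> real"
  assumes t: "t > 0" and K: "compact K" and \<phi>: "continuous_on UNIV \<phi>"
  shows "(\<integral>x. indicator ((\<lambda>x. p + t *\<^sub>R (x - p)) ` K) x * \<phi> x \<partial>lborel)
       = t ^ DIM('a) * (\<integral>x. indicator K x * \<phi> (p + t *\<^sub>R (x - p)) \<partial>lborel)"
proof -
  let ?T = "\<lambda>x. (p - t *\<^sub>R p) + t *\<^sub>R x"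
  let ?K = "(\<lambda>x. p + t *\<^sub>R (x - p)) ` K"
  have T: "p + t *\<^sub>R (x - p) = ?T x" for x by (simp add: algebra_simps)
  have "compact ?K" by (intro compact_continuous_image K continuous_intros)
  then have [measurable]: "?K \<in> sets borel" by (simp add: borel_compact)
  have [measurable]: "\<phi> \<in> borel_measurable borel" using \<phi> by (rule borel_measurable_continuous_onI)
  have m: "(\<lambda>x. indicator ?K x * \<phi> x) \<in> borel_measurable borel" by measurable
  have ind: "indicator ?K (?T x) = (indicator K x :: real)" for x
  proof -
    have "?T x \<in> ?K \<longleftrightarrow> x \<in> K" unfolding T using t by (auto simp: image_iff)
    then show ?thesis by (simp add: indicator_def)
  qed
  have "(\<integral>x. indicator ?K x * \<phi> x \<partial>lborel) =
     (\<integral>x. indicator ?K x * \<phi> x \<partial>density (distr lborel borel ?T) (\<lambda>_. \<bar>t\<bar> ^ DIM('a)))"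
    using lborel_affine[of t "p - t *\<^sub>R p"] t by simp
  also have "\<dots> = (\<integral>x. t ^ DIM('a) *\<^sub>R (indicator ?K x * \<phi> x) \<partial>distr lborel borel ?T)"
    by (subst integral_density) (use t m in \<open>auto simp: ennreal_power\<close>)
  also have "\<dots> = t ^ DIM('a) * (\<integral>x. indicator ?K (?T x) * \<phi> (?T x) \<partial>lborel)"
    by (subst integral_distr) (use m in auto)
  also have "\<dots> = t ^ DIM('a) * (\<integral>x. indicator K x * \<phi> (p + t *\<^sub>R (x - p)) \<partial>lborel)"
    unfolding T ind[unfolded T] ..
  finally show ?thesis .
qed

lemma GDERIV_imp_continuous: "(\<And>x. GDERIV \<phi> x :> g x) \<Longrightarrow> continuous_on UNIV \<phi>"
  unfolding gderiv_def
  by (meson continuous_at_imp_continuous_on has_derivative_continuous)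

text \<open>The quotient is the difference quotient at \<open>t = 1\<close> of \<open>t\<^sup>n \<integral>\<^sub>K \<phi>(p + t (x - p)) dx\<close>. Under the integral
  the derivative is \<open>(x - p) \<bullet> g + n \<phi>\<close>, and the mean value theorem bounds the quotients on the compact set \<open>K\<close>.\<close>

lemma scaled_integral_difference_quotient:
  fixes p :: "'a::euclidean_space" and \<phi> :: "'a \<Rightarrow> real"
  assumes K: "compact K" and \<phi>: "\<And>x. GDERIV \<phi> x :> g x" and g: "continuous_on UNIV g"
    and e: "\<And>k. 0 < e k" "\<And>k. e k < 1" "e \<longlonglongrightarrow> 0"
  shows "(\<lambda>k. ((\<integral>x. indicator K x * \<phi> x \<partial>lborel)
              - (1 - e k) ^ DIM('a) * (\<integral>x. indicator K x * \<phi> (p + (1 - e k) *\<^sub>R (x - p)) \<partial>lborel)) / e k)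
       \<longlonglongrightarrow> (\<integral>x. indicator K x * (g x \<bullet> (x - p) + real DIM('a) * \<phi> x) \<partial>lborel)"
proof -
  let ?n = "DIM('a)"
  have cont\<phi>: "continuous_on UNIV \<phi>" using GDERIV_imp_continuous[OF \<phi>] .
  define D where "D t x = real ?n * t ^ (?n - 1) * \<phi> (p + t *\<^sub>R (x - p)) + t ^ ?n * (g (p + t *\<^sub>R (x - p)) \<bullet> (x - p))" for t x
  have der: "((\<lambda>t. t ^ ?n * \<phi> (p + t *\<^sub>R (x - p))) has_real_derivative D t x) (at t)" for t x
  proof -
    have "((\<lambda>t. \<phi> (p + t *\<^sub>R (x - p))) has_derivative (\<lambda>h. (h *\<^sub>R (x - p)) \<bullet> g (p + t *\<^sub>R (x - p)))) (at t)"
      by (rule has_derivative_compose[where f="\<lambda>t. p + t *\<^sub>R (x - p)" and g=\<phi>, unfolded o_def])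
         (use \<phi>[unfolded gderiv_def] in \<open>auto intro!: derivative_eq_intros\<close>)
    then have "((\<lambda>t. \<phi> (p + t *\<^sub>R (x - p))) has_real_derivative (g (p + t *\<^sub>R (x - p)) \<bullet> (x - p))) (at t)"
      by (simp add: has_field_derivative_def inner_commute mult_commute_abs)
    from DERIV_mult[OF DERIV_pow[of ?n t] this] show ?thesis
      by (simp add: D_def algebra_simps)
  qed
  have "continuous_on ({0..1} \<times> K) (\<lambda>z. D (fst z) (snd z))"
    unfolding D_def
    by (intro continuous_intros continuous_on_compose2[OF cont\<phi>] continuous_on_compose2[OF g]) auto
  moreover have "compact ({0..1::real} \<times> K)" using K by (intro compact_Times) auto
  ultimately have "bounded ((\<lambda>z. D (fst z) (snd z)) ` ({0..1} \<times> K))"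
    using compact_continuous_image compact_imp_bounded by blast
  then obtain M where M: "\<And>t x. t \<in> {0..1} \<Longrightarrow> x \<in> K \<Longrightarrow> \<bar>D t x\<bar> \<le> M"
    by (fastforce simp: bounded_iff)
  have intK: "integrable lborel (\<lambda>x. indicator K x * f x)" if "continuous_on UNIV f" for f :: "'a \<Rightarrow> real"
    using borel_integrable_compact[OF K, of f] that continuous_on_subset by auto
  have cont_s: "continuous_on UNIV (\<lambda>x. \<phi> (p + t *\<^sub>R (x - p)))" for t
    by (intro continuous_on_compose2[OF cont\<phi>] continuous_intros) auto
  let ?q = "\<lambda>k x. indicator K x * ((\<phi> x - (1 - e k) ^ ?n * \<phi> (p + (1 - e k) *\<^sub>R (x - p))) / e k)"
  have "(\<lambda>k. \<integral>x. ?q k x \<partial>lborel) \<longlonglongrightarrow> (\<integral>x. indicator K x * (g x \<bullet> (x - p) + real ?n * \<phi> x) \<partial>lborel)"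
  proof (rule integral_dominated_convergence[where w="\<lambda>x. indicator K x * M"])
    have *: "continuous_on UNIV (\<lambda>x. g x \<bullet> (x - p) + real ?n * \<phi> x)"
      by (intro continuous_intros cont\<phi> g)
    show "(\<lambda>x. indicator K x * (g x \<bullet> (x - p) + real ?n * \<phi> x)) \<in> borel_measurable lborel"
      using intK[OF *] by auto
    have **: "continuous_on UNIV (\<lambda>x. (\<phi> x - (1 - e k) ^ ?n * \<phi> (p + (1 - e k) *\<^sub>R (x - p))) / e k)" for k
      using e(1)[of k] by (intro continuous_intros cont\<phi> cont_s) auto
    show "?q k \<in> borel_measurable lborel" for k
      using intK[OF **] by auto
    show "integrable lborel (\<lambda>x. indicator K x * M)" by (rule intK) auto
    show "AE x in lborel. (\<lambda>k. ?q k x) \<longlonglongrightarrow> indicator K x * (g x \<bullet> (x - p) + real ?n * \<phi> x)"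
    proof (intro AE_I2 tendsto_intros)
      fix x
      have "((\<lambda>h. ((1 + h) ^ ?n * \<phi> (p + (1 + h) *\<^sub>R (x - p)) - \<phi> x) / h) \<longlongrightarrow> D 1 x) (at 0)"
        using der[of x 1] by (simp add: DERIV_def)
      moreover have "filterlim (\<lambda>k. - e k) (at 0) sequentially"
        using tendsto_minus[OF e(3)] e(1) by (auto simp: filterlim_at intro!: always_eventually) (metis less_irrefl)
      ultimately have "(\<lambda>k. ((1 + - e k) ^ ?n * \<phi> (p + (1 + - e k) *\<^sub>R (x - p)) - \<phi> x) / (- e k)) \<longlonglongrightarrow> D 1 x"
        by (rule filterlim_compose)
      moreover have "((1 + - e k) ^ ?n * \<phi> (p + (1 + - e k) *\<^sub>R (x - p)) - \<phi> x) / (- e k) =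
          (\<phi> x - (1 - e k) ^ ?n * \<phi> (p + (1 - e k) *\<^sub>R (x - p))) / e k" for k
        using e(1)[of k] by (simp add: field_simps)
      ultimately show "(\<lambda>k. (\<phi> x - (1 - e k) ^ ?n * \<phi> (p + (1 - e k) *\<^sub>R (x - p))) / e k) \<longlonglongrightarrow> g x \<bullet> (x - p) + real ?n * \<phi> x"
        by (simp add: D_def add.commute)
    qed
    show "AE x in lborel. norm (?q k x) \<le> indicator K x * M" for k
    proof (intro AE_I2)
      fix x
      have "\<exists>t. 1 - e k < t \<and> t < 1 \<and>
          1 ^ ?n * \<phi> (p + 1 *\<^sub>R (x - p)) - (1 - e k) ^ ?n * \<phi> (p + (1 - e k) *\<^sub>R (x - p)) = (1 - (1 - e k)) * D t x"
        by (rule MVT2) (use e(1)[of k] der in auto)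
      then obtain t where "1 - e k < t" "t < 1" and
        eq: "\<phi> x - (1 - e k) ^ ?n * \<phi> (p + (1 - e k) *\<^sub>R (x - p)) = e k * D t x" by auto
      then have "t \<in> {0..1}" using e(2)[of k] by auto
      then show "norm (?q k x) \<le> indicator K x * M"
        unfolding eq using M[of t x] e(1)[of k] by (auto simp: indicator_def)
    qed
  qed
  moreover have "(\<integral>x. ?q k x \<partial>lborel) = ((\<integral>x. indicator K x * \<phi> x \<partial>lborel)
     - (1 - e k) ^ ?n * (\<integral>x. indicator K x * \<phi> (p + (1 - e k) *\<^sub>R (x - p)) \<partial>lborel)) / e k" for k
  proof -
    have "(\<integral>x. ?q k x \<partial>lborel) = (\<integral>x. (indicator K x * \<phi> x - (1 - e k) ^ ?n * (indicator K x * \<phi> (p + (1 - e k) *\<^sub>R (x - p)))) / e k \<partial>lborel)"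
      by (rule Bochner_Integration.integral_cong) (auto simp: algebra_simps diff_divide_distrib)
    also have "\<dots> = ((\<integral>x. indicator K x * \<phi> x \<partial>lborel)
     - (1 - e k) ^ ?n * (\<integral>x. indicator K x * \<phi> (p + (1 - e k) *\<^sub>R (x - p)) \<partial>lborel)) / e k"
      using intK[OF cont\<phi>] intK[OF cont_s] by simp
    finally show ?thesis .
  qed
  ultimately show ?thesis by (simp only:)
qed

section \<open>The integral over the base of a pyramid\<close>

lemma closest_point_hyperplane:
  fixes \<nu> :: "'a::euclidean_space"
  assumes \<nu>: "norm \<nu> = 1"
  shows "closest_point {x. \<nu> \<bullet> x = b} z = z - (\<nu> \<bullet> z - b) *\<^sub>R \<nu>"
proof -
  have nn: "\<nu> \<bullet> \<nu> = 1" using \<nu> by (simp add: dot_square_norm)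
  have "dist z (z - (\<nu> \<bullet> z - b) *\<^sub>R \<nu>) \<le> dist z y" if "\<nu> \<bullet> y = b" for y
  proof -
    have "\<bar>\<nu> \<bullet> z - b\<bar> = \<bar>\<nu> \<bullet> (z - y)\<bar>" using that by (simp add: inner_diff_right)
    also have "\<dots> \<le> norm (z - y)" using Cauchy_Schwarz_ineq2[of \<nu> "z - y"] \<nu> by simp
    finally show ?thesis using \<nu> by (simp add: dist_norm)
  qed
  then show ?thesis
    by (intro closest_point_unique[symmetric])
       (auto simp: convex_hyperplane closed_hyperplane inner_diff_right nn)
qed

definition prism :: "(real^'n) set \<Rightarrow> (real^'n) set" where
  "prism E = (let \<pi> = closest_point (affine hull E) in {z. \<pi> z \<in> E \<and> dist z (\<pi> z) \<le> 1/2})"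

lemma prism_eq:
  assumes "norm \<nu> = 1" "affine hull E = {x. \<nu> \<bullet> x = b}"
  shows "prism E = {x. x - (\<nu> \<bullet> x - b) *\<^sub>R \<nu> \<in> E \<and> \<bar>\<nu> \<bullet> x - b\<bar> \<le> 1/2}"
  unfolding prism_def Let_def assms(2) closest_point_hyperplane[OF assms(1)] using assms(1) by (simp add: dist_norm)

lemma compact_prism:
  assumes \<nu>: "norm \<nu> = 1" "affine hull E = {x. \<nu> \<bullet> x = b}" and E: "compact E"
  shows "compact (prism E)"
proof -
  have "closed {x. x - (\<nu> \<bullet> x - b) *\<^sub>R \<nu> \<in> E}"
    using continuous_closed_vimage[OF compact_imp_closed[OF E], of "\<lambda>x. x - (\<nu> \<bullet> x - b) *\<^sub>R \<nu>"]
    by (auto simp: vimage_def intro!: continuous_intros)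
  moreover have "prism E = {x. x - (\<nu> \<bullet> x - b) *\<^sub>R \<nu> \<in> E} \<inter> {x. \<bar>\<nu> \<bullet> x - b\<bar> \<le> 1/2}"
    unfolding prism_eq[OF \<nu>] by auto
  ultimately have "closed (prism E)"
    by (auto intro!: closed_Int closed_Collect_le continuous_intros)
  moreover obtain B where B: "\<And>x. x \<in> E \<Longrightarrow> norm x \<le> B"
    using compact_imp_bounded[OF E] by (auto simp: bounded_iff)
  have "norm x \<le> B + 1/2" if "x \<in> prism E" for x
  proof -
    have x: "x - (\<nu> \<bullet> x - b) *\<^sub>R \<nu> \<in> E" "\<bar>\<nu> \<bullet> x - b\<bar> \<le> 1/2" using that by (auto simp: prism_eq[OF \<nu>])
    have "norm x \<le> norm (x - (\<nu> \<bullet> x - b) *\<^sub>R \<nu>) + norm ((\<nu> \<bullet> x - b) *\<^sub>R \<nu>)"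
      by (metis diff_add_cancel norm_triangle_ineq)
    with B[OF x(1)] x(2) \<nu> show ?thesis by simp
  qed
  then have "bounded (prism E)" by (auto simp: bounded_iff)
  ultimately show ?thesis by (simp add: compact_eq_bounded_closed)
qed

lemma integral_lebesgue_on_compact:
  fixes f :: "'a::euclidean_space \<Rightarrow> real"
  assumes S: "compact S" and f: "continuous_on S f"
  shows "integral\<^sup>L (lebesgue_on S) f = (\<integral>x. indicator S x * f x \<partial>lborel)"
    and "integrable (lebesgue_on S) f"
proof -
  have i: "integrable lborel (\<lambda>x. indicator S x *\<^sub>R f x)" using borel_integrable_compact[OF S f] .
  have "S \<in> sets lebesgue" using S by (simp add: borel_compact)
  then have S': "S \<inter> space lebesgue \<in> sets lebesgue" by simp
  show "integrable (lebesgue_on S) f"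
    unfolding integrable_restrict_space[OF S'] using i by (simp add: integrable_completion)
  show "integral\<^sup>L (lebesgue_on S) f = (\<integral>x. indicator S x * f x \<partial>lborel)"
    unfolding integral_restrict_space[OF S'] using i by (subst integral_completion) auto
qed

text \<open>On the hyperplane of \<open>E\<close> the projection in the definition of \<open>face_integral\<close> is explicit, and the
  integral may be taken with respect to the Borel measure, for which Fubini's theorem is available.\<close>

lemma face_integral_eq:
  fixes g :: "real^'n \<Rightarrow> real"
  assumes \<nu>: "norm \<nu> = 1" "affine hull E = {x. \<nu> \<bullet> x = b}" and E: "compact E" and g: "continuous_on E g"
  shows "face_integral E g = (\<integral>x. indicator (prism E) x * g (x - (\<nu> \<bullet> x - b) *\<^sub>R \<nu>) \<partial>lborel)"
proof -
  have "face_integral E g = integral\<^sup>L (lebesgue_on (prism E)) (\<lambda>x. g (x - (\<nu> \<bullet> x - b) *\<^sub>R \<nu>))"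
    unfolding face_integral_def Let_def prism_def \<nu>(2) closest_point_hyperplane[OF \<nu>(1)] ..
  also have "\<dots> = (\<integral>x. indicator (prism E) x * g (x - (\<nu> \<bullet> x - b) *\<^sub>R \<nu>) \<partial>lborel)"
    by (rule integral_lebesgue_on_compact[OF compact_prism[OF \<nu> E]], rule continuous_on_compose2[OF g])
       (auto simp: prism_eq[OF \<nu>] intro!: continuous_intros)
  finally show ?thesis .
qed

lemma pyramid_points:
  assumes "F \<noteq> {}" "convex F" "x \<in> convex hull (insert p F)"
  obtains t y where "0 \<le> t" "t \<le> 1" "y \<in> F" "x = p + t *\<^sub>R (y - p)"
proof -
  from assms obtain u v y where "0 \<le> u" "0 \<le> v" "u + v = 1" "y \<in> F" "x = u *\<^sub>R p + v *\<^sub>R y"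
    by (auto simp: convex_hull_insert hull_same)
  then have "x = p + v *\<^sub>R (y - p)" "0 \<le> v" "v \<le> 1"
    by (auto simp: algebra_simps simp flip: scaleR_add_left)
  with \<open>y \<in> F\<close> show thesis using that by blast
qed

lemma pyramid_point_mem:
  assumes "convex F" "y \<in> F" "0 \<le> t" "t \<le> 1"
  shows "p + t *\<^sub>R (y - p) \<in> convex hull (insert p F)"
proof -
  have "p \<in> convex hull (insert p F)" "y \<in> convex hull (insert p F)" using assms by (auto simp: hull_inc)
  from convexD_alt[OF convex_convex_hull this assms(3,4)] show ?thesis by (simp add: algebra_simps)
qed

text \<open>A pyramid with base \<open>F\<close>, apex \<open>p\<close> and height \<open>h\<close>; the unit vector \<open>\<nu>\<close> is normal to the base and points
  away from the apex.\<close>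

locale pyramid =
  fixes F :: "(real^'n) set" and p \<nu> :: "real^'n" and b h :: real
  assumes F: "compact F" "convex F" "F \<noteq> {}" and \<nu>: "norm \<nu> = 1"
    and aff: "affine hull F = {x. \<nu> \<bullet> x = b}" and p: "\<nu> \<bullet> p = b - h" and h: "h > 0"
begin

definition "K = convex hull (insert p F)"

definition "foot x = x - (\<nu> \<bullet> x - b) *\<^sub>R \<nu>"

lemma nn: "\<nu> \<bullet> \<nu> = 1" using \<nu> by (simp add: dot_square_norm)

lemma F_hyp: "y \<in> F \<Longrightarrow> \<nu> \<bullet> y = b"
  using aff hull_subset[of F affine] by auto

lemma compact_K: "compact K"
  unfolding K_def using F by (simp add: compact_convex_hull)

lemma level: "y \<in> F \<Longrightarrow> \<nu> \<bullet> (p + t *\<^sub>R (y - p)) = b - (1 - t) * h"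
  by (simp add: inner_add_right inner_diff_right F_hyp p) (simp add: algebra_simps)

lemma K_le: "x \<in> K \<Longrightarrow> \<nu> \<bullet> x \<le> b"
  unfolding K_def using level h by (elim pyramid_points[OF F(3,2)]) auto

lemma lower_part:
  assumes "0 < t" "t \<le> 1"
  shows "{x \<in> K. \<nu> \<bullet> x \<le> b - (1 - t) * h} = (\<lambda>x. p + t *\<^sub>R (x - p)) ` K" (is "?A = ?B")
proof
  show "?A \<subseteq> ?B"
  proof
    fix x assume x: "x \<in> ?A"
    then obtain s y where s: "0 \<le> s" "s \<le> 1" "y \<in> F" "x = p + s *\<^sub>R (y - p)"
      unfolding K_def by (auto elim: pyramid_points[OF F(3,2)])
    then have "s \<le> t" using x level[of y s] h by simp
    then have "p + (s / t) *\<^sub>R (y - p) \<in> K"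
      unfolding K_def using s assms by (intro pyramid_point_mem F) auto
    moreover have "x = p + t *\<^sub>R ((p + (s / t) *\<^sub>R (y - p)) - p)" using s assms by simp
    ultimately show "x \<in> ?B" by blast
  qed
  show "?B \<subseteq> ?A"
  proof clarify
    fix x assume "x \<in> K"
    then obtain s y where s: "0 \<le> s" "s \<le> 1" "y \<in> F" "x = p + s *\<^sub>R (y - p)"
      unfolding K_def by (auto elim: pyramid_points[OF F(3,2)])
    then have e: "p + t *\<^sub>R (x - p) = p + (t * s) *\<^sub>R (y - p)" by simp
    have "t * s \<le> t * 1" by (rule mult_left_mono) (use s assms in auto)
    then have st: "0 \<le> t * s" "t * s \<le> t" using s assms by simp_all
    then have st': "t * s \<le> 1" using assms by linarith
    show "p + t *\<^sub>R (x - p) \<in> K \<and> \<nu> \<bullet> (p + t *\<^sub>R (x - p)) \<le> b - (1 - t) * h"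
      unfolding e level[OF s(3)]
    proof
      show "p + (t * s) *\<^sub>R (y - p) \<in> K"
        unfolding K_def using s st st' by (intro pyramid_point_mem F)
      show "b - (1 - t * s) * h \<le> b - (1 - t) * h" using st h by simp
    qed
  qed
qed

text \<open>The line from the apex through \<open>y - d \<nu>\<close> meets the hyperplane of the base in the point
  \<open>y + (d / (h - d)) (y - p - h \<nu>)\<close>. It tends to \<open>y\<close> for \<open>d \<rightarrow> 0\<close>, so it stays in \<open>F\<close>.\<close>

lemma near_face_in:
  assumes y: "y \<in> rel_interior F"
  shows "\<exists>d0>0. \<forall>d. 0 \<le> d \<and> d < d0 \<longrightarrow> y - d *\<^sub>R \<nu> \<in> K"
proof -
  obtain r where r: "r > 0" "ball y r \<inter> affine hull F \<subseteq> F" and yF: "y \<in> F"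
    using y by (auto simp: mem_rel_interior_ball)
  let ?z = "\<lambda>d. y + (d / (h - d)) *\<^sub>R (y - p - h *\<^sub>R \<nu>)"
  have "isCont ?z 0" using h by (intro continuous_intros) auto
  then have "(?z \<longlongrightarrow> y) (at 0)" by (simp add: isCont_def)
  then have "eventually (\<lambda>d. dist (?z d) y < r) (at 0)" using r(1) by (rule tendstoD)
  then obtain d0 where d0: "d0 > 0" "\<And>d. d \<noteq> 0 \<Longrightarrow> dist d 0 < d0 \<Longrightarrow> dist (?z d) y < r"
    by (auto simp: eventually_at)
  have "y - d *\<^sub>R \<nu> \<in> K" if d: "0 \<le> d" "d < min d0 h" for d
  proof (cases "d = 0")
    case True then show ?thesis using yF by (simp add: K_def hull_inc)
  next
    case False
    have "dist (?z d) y < r" using d0(2)[OF False] d by simp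
    moreover have "\<nu> \<bullet> ?z d = b"
      using F_hyp[OF yF] p by (simp add: inner_add_right inner_diff_right nn)
    ultimately have zF: "?z d \<in> F" using r(2) aff by (auto simp: dist_commute)
    have hd: "h - d > 0" using d by simp
    have "y - d *\<^sub>R \<nu> = p + (1 - d / h) *\<^sub>R (?z d - p)"
    proof -
      have c: "(1 - d / h) * (d / (h - d)) = d / h" using hd h by (simp add: field_simps)
      have "(1 - d / h) *\<^sub>R (?z d - p) = (1 - d / h) *\<^sub>R (y - p) + (d / h) *\<^sub>R (y - p - h *\<^sub>R \<nu>)"
      proof -
        have "?z d - p = (y - p) + (d / (h - d)) *\<^sub>R (y - p - h *\<^sub>R \<nu>)" by simp
        then show ?thesis by (simp only: scaleR_add_right scaleR_scaleR c)
      qed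
      also have "\<dots> = (y - p) - d *\<^sub>R \<nu>" using h by (simp add: algebra_simps)
      finally show ?thesis by simp
    qed
    also have "\<dots> \<in> K" unfolding K_def
      by (rule pyramid_point_mem[OF F(2) zF]) (use d h in \<open>auto simp: field_simps\<close>)
    finally show ?thesis .
  qed
  moreover have "min d0 h > 0" using d0 h by simp
  ultimately show ?thesis by blast
qed

lemma near_face_out:
  assumes y: "y \<notin> F" "\<nu> \<bullet> y = b"
  shows "\<exists>d0>0. \<forall>d. 0 \<le> d \<and> d < d0 \<longrightarrow> y - d *\<^sub>R \<nu> \<notin> K"
proof -
  have "y \<notin> K"
  proof
    assume "y \<in> K"
    then obtain s z where s: "0 \<le> s" "s \<le> 1" "z \<in> F" "y = p + s *\<^sub>R (z - p)"
      unfolding K_def by (auto elim: pyramid_points[OF F(3,2)])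
    then have "(1 - s) * h = 0" using level[of z s] y by simp
    then have "s = 1" using h by simp
    then show False using s y by simp
  qed
  moreover have "open (- K)" using compact_K compact_imp_closed by (blast intro: open_Compl)
  ultimately obtain r where r: "r > 0" "ball y r \<subseteq> - K"
    by (meson ComplI openE)
  then have "y - d *\<^sub>R \<nu> \<notin> K" if "0 \<le> d" "d < r" for d
    using that \<nu> by (auto simp: subset_iff dist_norm)
  with r show ?thesis by blast
qed

lemma foot_hyp: "\<nu> \<bullet> foot x = b" by (simp add: foot_def inner_diff_right nn)

text \<open>The exceptional points lie on the frontier of the cylinder over \<open>F\<close>, which is negligible because
  the cylinder is convex.\<close>

lemma AE_foot: "AE x in lborel. foot x \<in> rel_interior F \<or> foot x \<notin> F"
proof -
  let ?C = "{x. foot x \<in> F}"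
  have lin: "foot (x + y) = foot x + (y - (\<nu> \<bullet> y) *\<^sub>R \<nu>)" for x y
    by (simp add: foot_def algebra_simps)
  have "convex ?C"
  proof (rule convexI)
    fix x y and u v :: real assume *: "x \<in> ?C" "y \<in> ?C" "0 \<le> u" "0 \<le> v" "u + v = 1"
    have "foot (u *\<^sub>R x + v *\<^sub>R y) = u *\<^sub>R x + v *\<^sub>R y - (\<nu> \<bullet> (u *\<^sub>R x + v *\<^sub>R y) - (u + v) *\<^sub>R b) *\<^sub>R \<nu>"
      using * by (simp add: foot_def)
    also have "\<dots> = u *\<^sub>R foot x + v *\<^sub>R foot y"
      by (simp add: foot_def algebra_simps)
    finally show "u *\<^sub>R x + v *\<^sub>R y \<in> ?C" using * F(2) by (auto simp: convex_def)
  qed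
  then have "negligible (frontier ?C)" by (rule negligible_convex_frontier)
  then have "frontier ?C \<in> null_sets lborel"
    by (simp add: negligible_iff_null_sets null_sets_completion_iff)
  then have "AE x in lborel. x \<notin> frontier ?C" by (rule AE_not_in)
  then show ?thesis
  proof (rule AE_mp, intro AE_I2 impI)
    fix x assume x: "x \<notin> frontier ?C"
    show "foot x \<in> rel_interior F \<or> foot x \<notin> F"
    proof (cases "foot x \<in> F")
      case True
      then have "x \<in> interior ?C" using x closure_subset[of ?C] by (auto simp: frontier_def)
      then obtain r where r: "r > 0" "ball x r \<subseteq> ?C" by (auto simp: mem_interior)
      have "ball (foot x) r \<inter> affine hull F \<subseteq> F"
      proof clarify
        fix y assume y: "y \<in> ball (foot x) r" "y \<in> affine hull F"
        have "foot (x + (y - foot x)) = y"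
          unfolding lin using y aff foot_hyp by (simp add: inner_diff_right)
        moreover have "x + (y - foot x) \<in> ball x r" using y by (simp add: dist_norm norm_minus_commute)
        ultimately show "y \<in> F" using r by (metis (no_types, lifting) mem_Collect_eq subset_iff)
      qed
      with r True show ?thesis by (auto simp: mem_rel_interior_ball)
    qed simp
  qed
qed

text \<open>By \<open>layer_average\<close> the quotient is \<open>h\<close> times an average over the prism of the values of \<open>1\<^sub>K \<phi>\<close> at the
  depths \<open>s e h\<close> below the foot of \<open>x\<close>. For almost every \<open>x\<close> these tend to the value of \<open>1\<^sub>F \<phi>\<close> at the foot.\<close>

lemma layer_limit:
  assumes \<phi>: "continuous_on UNIV \<phi>" and e: "\<And>k. 0 < e k" "\<And>k. e k < 1" "e \<longlonglongrightarrow> 0"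
  shows "(\<lambda>k. (\<integral>x. indicator {x \<in> K. b - e k * h \<le> \<nu> \<bullet> x} x * \<phi> x \<partial>lborel) / e k)
    \<longlonglongrightarrow> h * face_integral F \<phi>"
proof -
  define H where "H k x s = indicator {0..1} s * (indicator {x. \<bar>\<nu> \<bullet> x - b\<bar> \<le> 1/2} x *
           (indicator K (x - (\<nu> \<bullet> x - b + s * (e k * h)) *\<^sub>R \<nu>) * \<phi> (x - (\<nu> \<bullet> x - b + s * (e k * h)) *\<^sub>R \<nu>)))" for k x s
  have eh: "e k * h > 0" for k using e h by simp
  have L: "(\<integral>x. indicator {x \<in> K. b - e k * h \<le> \<nu> \<bullet> x} x * \<phi> x \<partial>lborel) / e k
      = h * (\<integral>x. (\<integral>s. H k x s \<partial>lborel) \<partial>lborel)" for k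
  proof -
    have "{x \<in> K. b - e k * h \<le> \<nu> \<bullet> x} = {x \<in> K. - (e k * h) \<le> \<nu> \<bullet> x - b \<and> \<nu> \<bullet> x \<le> b}"
      using K_le by auto
    moreover have "continuous_on K \<phi>" using \<phi> continuous_on_subset by blast
    ultimately show ?thesis
      using layer_average[OF \<nu> eh[of k] compact_K, of \<phi> b] e(1)[of k]
      by (simp add: H_def)
  qed
  obtain M where M: "\<And>x. x \<in> K \<Longrightarrow> \<bar>\<phi> x\<bar> \<le> M"
    using compact_imp_bounded[OF compact_continuous_image[OF continuous_on_subset[OF \<phi>] compact_K]]
    by (auto simp: bounded_iff)
  obtain B where B: "\<And>x. x \<in> K \<Longrightarrow> norm x \<le> B"
    using compact_imp_bounded[OF compact_K] by (auto simp: bounded_iff)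
  have M0: "M \<ge> 0" using M[of p] by (auto simp: K_def hull_inc)
  have Hb: "\<bar>H k x s\<bar> \<le> indicator {0..1} s * M * indicator (cball 0 (B + (1/2 + h))) x" for k x s
  proof (cases "H k x s = 0")
    case False
    then have *: "s \<in> {0..1}" "\<bar>\<nu> \<bullet> x - b\<bar> \<le> 1/2" "x - (\<nu> \<bullet> x - b + s * (e k * h)) *\<^sub>R \<nu> \<in> K"
      by (auto simp: H_def indicator_def split: if_splits)
    have "s * e k \<le> 1" using *(1) e(1,2)[of k] by (simp add: mult_le_one less_imp_le)
    then have "s * (e k * h) \<le> h" using h by (simp add: mult.assoc[symmetric])
    moreover have "0 \<le> s * (e k * h)" using *(1) eh[of k] by (simp add: less_imp_le)
    ultimately have "\<bar>\<nu> \<bullet> x - b + s * (e k * h)\<bar> \<le> 1/2 + h" using *(2) by linarith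
    moreover have "norm x \<le> norm (x - (\<nu> \<bullet> x - b + s * (e k * h)) *\<^sub>R \<nu>) + norm ((\<nu> \<bullet> x - b + s * (e k * h)) *\<^sub>R \<nu>)"
      by (metis diff_add_cancel norm_triangle_ineq)
    ultimately have "norm x \<le> B + (1/2 + h)" using B[OF *(3)] \<nu> by simp
    then show ?thesis using * M[OF *(3)] by (simp add: H_def)
  qed (use M0 in \<open>simp add: indicator_def\<close>)
  have [measurable]: "\<phi> \<in> borel_measurable borel" using \<phi> by (rule borel_measurable_continuous_onI)
  have [measurable]: "K \<in> sets borel" using compact_K by (simp add: borel_compact)
  have [measurable]: "F \<in> sets borel" using F by (simp add: borel_compact)
  have Hm: "case_prod (H k) \<in> borel_measurable (borel \<Otimes>\<^sub>M borel)" for k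
    unfolding H_def by measurable
  have Hm1: "H k x \<in> borel_measurable borel" for k x
    unfolding H_def by measurable
  define P where "P x = indicator {x. \<bar>\<nu> \<bullet> x - b\<bar> \<le> 1/2} x * (indicator F (foot x) * \<phi> (foot x))" for x
  have Pm[measurable]: "P \<in> borel_measurable borel" unfolding P_def foot_def by measurable
  have inner: "(\<lambda>k. (\<integral>s. H k x s \<partial>lborel)) \<longlonglongrightarrow> P x" if x: "foot x \<in> rel_interior F \<or> foot x \<notin> F" for x
  proof -
    have "\<exists>d0>0. \<forall>d. 0 \<le> d \<and> d < d0 \<longrightarrow> (foot x - d *\<^sub>R \<nu> \<in> K \<longleftrightarrow> foot x \<in> F)"
      using x near_face_in near_face_out[OF _ foot_hyp] rel_interior_subset by blast
    then obtain d0 where d0: "d0 > 0" "\<And>d. 0 \<le> d \<Longrightarrow> d < d0 \<Longrightarrow> (foot x - d *\<^sub>R \<nu> \<in> K \<longleftrightarrow> foot x \<in> F)"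
      by blast
    have ft: "x - (\<nu> \<bullet> x - b + s * d) *\<^sub>R \<nu> = foot x - (s * d) *\<^sub>R \<nu>" for s d
      by (simp add: foot_def algebra_simps)
    have "(\<lambda>k. (\<integral>s. H k x s \<partial>lborel)) \<longlonglongrightarrow> (\<integral>s. indicator {0..1::real} s * P x \<partial>lborel)"
    proof (rule integral_dominated_convergence[where w="\<lambda>s::real. indicator {0..1} s * M"])
      show "(\<lambda>s::real. indicator {0..1} s * P x) \<in> borel_measurable lborel" by measurable
      show "H k x \<in> borel_measurable lborel" for k using Hm1 by simp
      show "integrable lborel (\<lambda>s::real. indicator {0..1} s * M)" by auto
      show "AE s in lborel. norm (H k x s) \<le> indicator {0..1} s * M" for k
      proof (intro AE_I2)
        fix s show "norm (H k x s) \<le> indicator {0..1} s * M"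
        proof -
          have "indicator {0..1} s * M * indicator (cball 0 (B + (1/2 + h))) x \<le> indicator {0..1} s * M * 1"
            by (rule mult_left_mono) (use M0 in \<open>auto simp: indicator_def\<close>)
          then show ?thesis using Hb[of k x s] by simp
        qed
      qed
      show "AE s in lborel. (\<lambda>k. H k x s) \<longlonglongrightarrow> indicator {0..1} s * P x"
      proof (intro AE_I2)
        fix s :: real
        show "(\<lambda>k. H k x s) \<longlonglongrightarrow> indicator {0..1} s * P x"
        proof (cases "s \<in> {0..1}")
          case True
          have lim: "(\<lambda>k. s * (e k * h)) \<longlonglongrightarrow> 0" using e(3) by (auto intro!: tendsto_eq_intros)
          have ev: "eventually (\<lambda>k. s * (e k * h) < d0) sequentially"
            using order_tendstoD(2)[OF lim d0(1)] .
          have "(\<lambda>k. foot x - (s * (e k * h)) *\<^sub>R \<nu>) \<longlonglongrightarrow> foot x - 0 *\<^sub>R \<nu>"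
            by (intro tendsto_intros lim)
          then have "(\<lambda>k. \<phi> (foot x - (s * (e k * h)) *\<^sub>R \<nu>)) \<longlonglongrightarrow> \<phi> (foot x)"
            using \<phi> by (auto intro: continuous_on_tendsto_compose)
          then have "(\<lambda>k. indicator {x. \<bar>\<nu> \<bullet> x - b\<bar> \<le> 1/2} x * (indicator F (foot x) * \<phi> (foot x - (s * (e k * h)) *\<^sub>R \<nu>))) \<longlonglongrightarrow> P x"
            unfolding P_def by (intro tendsto_intros)
          moreover have "eventually (\<lambda>k. indicator {x. \<bar>\<nu> \<bullet> x - b\<bar> \<le> 1/2} x * (indicator F (foot x) * \<phi> (foot x - (s * (e k * h)) *\<^sub>R \<nu>)) = H k x s) sequentially"
            using ev
          proof eventually_elim
            case (elim k)
            have "0 \<le> s * (e k * h)" using True eh[of k] by (simp add: less_imp_le)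
            from d0(2)[OF this elim] show ?case using True unfolding H_def ft by (simp add: indicator_def)
          qed
          ultimately have "(\<lambda>k. H k x s) \<longlonglongrightarrow> P x" by (rule Lim_transform_eventually)
          then show ?thesis using True by simp
        qed (simp add: H_def)
      qed
    qed
    then show ?thesis by simp
  qed
  have "(\<lambda>k. (\<integral>x. (\<integral>s. H k x s \<partial>lborel) \<partial>lborel)) \<longlonglongrightarrow> (\<integral>x. P x \<partial>lborel)"
  proof (rule integral_dominated_convergence[where w="\<lambda>x::real^'n. indicator (cball 0 (B + (1/2 + h))) x * M"])
    show "P \<in> borel_measurable lborel" by simp
    show "(\<lambda>x. \<integral>s. H k x s \<partial>lborel) \<in> borel_measurable lborel" for k
    proof (rule lborel.borel_measurable_lebesgue_integral)
      have "sets (lborel \<Otimes>\<^sub>M lborel) = sets (borel \<Otimes>\<^sub>M borel)" by (intro sets_pair_measure_cong) auto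
      then show "case_prod (H k) \<in> borel_measurable (lborel \<Otimes>\<^sub>M lborel)" using Hm measurable_cong_sets by blast
    qed
    show "integrable lborel (\<lambda>x::real^'n. indicator (cball 0 (B + (1/2 + h))) x * M)"
      using borel_integrable_compact[OF compact_cball, of 0 "B + (1/2 + h)" "\<lambda>_. M"] by simp
    show "AE x in lborel. (\<lambda>k. (\<integral>s. H k x s \<partial>lborel)) \<longlonglongrightarrow> P x"
      using AE_foot by (rule AE_mp) (intro AE_I2 impI inner)
    show "AE x in lborel. norm (\<integral>s. H k x s \<partial>lborel) \<le> indicator (cball 0 (B + (1/2 + h))) x * M" for k
    proof (intro AE_I2)
      fix x :: "real^'n"
      have i: "integrable lborel (\<lambda>s::real. indicator {0..1} s * (M * indicator (cball 0 (B + (1/2 + h))) x))"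
        by auto
      have "norm (\<integral>s. H k x s \<partial>lborel) \<le> (\<integral>s. norm (H k x s) \<partial>lborel)"
        by (rule Bochner_Integration.integral_norm_bound)
      also have "\<dots> \<le> (\<integral>s. indicator {0..1::real} s * (M * indicator (cball 0 (B + (1/2 + h))) x) \<partial>lborel)"
        by (rule Bochner_Integration.integral_mono'[OF i])
           (use Hb[of k x] M0 in \<open>auto simp: mult.assoc\<close>)
      finally have "norm (\<integral>s. H k x s \<partial>lborel) \<le> (\<integral>s. indicator {0..1::real} s * (M * indicator (cball 0 (B + (1/2 + h))) x) \<partial>lborel)" .
      then show "norm (\<integral>s. H k x s \<partial>lborel) \<le> indicator (cball 0 (B + (1/2 + h))) x * M"
        by (simp add: mult.commute)
    qed
  qed
  moreover have "(\<integral>x. P x \<partial>lborel) = face_integral F \<phi>"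
    unfolding face_integral_eq[OF \<nu> aff F(1) continuous_on_subset[OF \<phi> subset_UNIV]] P_def foot_def prism_eq[OF \<nu> aff]
    by (rule Bochner_Integration.integral_cong) (auto simp: indicator_def)
  ultimately show ?thesis unfolding L by (intro tendsto_intros) simp
qed

text \<open>The layer below the base is \<open>K\<close> without the copy of \<open>K\<close> scaled by \<open>1 - e\<close> towards the apex, so the limits of
  \<open>layer_limit\<close> and \<open>scaled_integral_difference_quotient\<close> are limits of the same sequence.\<close>

theorem pyramid_formula:
  assumes \<phi>: "\<And>x. GDERIV \<phi> x :> g x" and g: "continuous_on UNIV g"
  shows "integral\<^sup>L (lebesgue_on K) (\<lambda>x. g x \<bullet> (x - p) + real CARD('n) * \<phi> x) = h * face_integral F \<phi>"
proof -
  have cont\<phi>: "continuous_on UNIV \<phi>" using GDERIV_imp_continuous[OF \<phi>] .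
  let ?e = "\<lambda>k. 1 / real (k + 2)"
  have e: "0 < ?e k" "?e k < 1" for k by auto
  have e0: "?e \<longlonglongrightarrow> 0" by (rule LIMSEQ_ignore_initial_segment[OF lim_1_over_n, of 2, unfolded])
  have "{x. \<nu> \<bullet> x = c} \<in> null_sets lborel" for c
  proof -
    have "\<nu> \<noteq> 0" using \<nu> by auto
    then have "negligible {x. \<nu> \<bullet> x = c}" by (simp add: negligible_hyperplane)
    then show ?thesis by (simp add: negligible_iff_null_sets null_sets_completion_iff closed_hyperplane borel_closed)
  qed
  then have AEne: "AE x in lborel. \<nu> \<bullet> x \<noteq> c" for c using AE_not_in[of "{x. \<nu> \<bullet> x = c}"] by auto
  have quotient: "((\<integral>x. indicator K x * \<phi> x \<partial>lborel)
              - (1 - ?e k) ^ DIM(real^'n) * (\<integral>x. indicator K x * \<phi> (p + (1 - ?e k) *\<^sub>R (x - p)) \<partial>lborel)) / ?e k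
      = (\<integral>x. indicator {x \<in> K. b - ?e k * h \<le> \<nu> \<bullet> x} x * \<phi> x \<partial>lborel) / ?e k" for k
  proof -
    have t: "0 < 1 - ?e k" "1 - ?e k \<le> 1" using e[of k] by auto
    have int: "integrable lborel (\<lambda>x. indicator S x * \<phi> x)" if "compact S" for S :: "(real^'n) set"
      using borel_integrable_compact[OF that continuous_on_subset[OF cont\<phi> subset_UNIV]] by simp
    have c1: "compact {x \<in> K. \<nu> \<bullet> x \<le> b - ?e k * h}"
      using compact_Int_closed[OF compact_K closed_halfspace_le[of \<nu> "b - ?e k * h"]] by (simp add: Int_def)
    have c2: "compact {x \<in> K. b - ?e k * h \<le> \<nu> \<bullet> x}"
      using compact_Int_closed[OF compact_K closed_halfspace_ge[of "b - ?e k * h" \<nu>]] by (simp add: Int_def)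
    have "(1 - ?e k) ^ DIM(real^'n) * (\<integral>x. indicator K x * \<phi> (p + (1 - ?e k) *\<^sub>R (x - p)) \<partial>lborel)
       = (\<integral>x. indicator {x \<in> K. \<nu> \<bullet> x \<le> b - ?e k * h} x * \<phi> x \<partial>lborel)"
      using integral_scaled_copy[OF t(1) compact_K cont\<phi>] lower_part[OF t] by simp
    moreover have "(\<integral>x. indicator K x * \<phi> x \<partial>lborel) =
       (\<integral>x. indicator {x \<in> K. \<nu> \<bullet> x \<le> b - ?e k * h} x * \<phi> x + indicator {x \<in> K. b - ?e k * h \<le> \<nu> \<bullet> x} x * \<phi> x \<partial>lborel)"
      by (rule integral_cong_AE)
         (use int[OF compact_K] int[OF c1] int[OF c2] AEne[of "b - ?e k * h"] in \<open>auto simp: indicator_def\<close>)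
    ultimately show ?thesis using int[OF c1] int[OF c2] by simp
  qed
  have "(\<lambda>k. (\<integral>x. indicator {x \<in> K. b - ?e k * h \<le> \<nu> \<bullet> x} x * \<phi> x \<partial>lborel) / ?e k)
     \<longlonglongrightarrow> (\<integral>x. indicator K x * (g x \<bullet> (x - p) + real DIM(real^'n) * \<phi> x) \<partial>lborel)"
    using scaled_integral_difference_quotient[OF compact_K \<phi> g e e0, of p] unfolding quotient .
  from LIMSEQ_unique[OF this layer_limit[OF cont\<phi> e e0]]
  have "(\<integral>x. indicator K x * (g x \<bullet> (x - p) + real CARD('n) * \<phi> x) \<partial>lborel) = h * face_integral F \<phi>" by simp
  moreover have "continuous_on K (\<lambda>x. g x \<bullet> (x - p) + real CARD('n) * \<phi> x)"
    by (intro continuous_intros continuous_on_subset[OF g] continuous_on_subset[OF cont\<phi>]) auto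
  ultimately show ?thesis using integral_lebesgue_on_compact(1)[OF compact_K] by simp
qed

end

lemma face_integral_cong:
  assumes "\<And>x. x \<in> E \<Longrightarrow> f x = g x"
  shows "face_integral E f = face_integral E g"
  unfolding face_integral_def Let_def
  by (rule Bochner_Integration.integral_cong) (auto simp: assms)

lemma face_integral_cmult: "face_integral E (\<lambda>x. c * f x) = c * face_integral E f"
  unfolding face_integral_def Let_def by simp

context pyramid
begin

lemma face_integral_integrable:
  fixes g :: "real^'n \<Rightarrow> real"
  assumes "continuous_on F g"
  shows "integrable lborel (\<lambda>x. indicator (prism F) x * g (foot x))"
proof -
  have "continuous_on (prism F) (\<lambda>x. g (foot x))"
    unfolding foot_def
    by (rule continuous_on_compose2[OF assms]) (auto simp: prism_eq[OF \<nu> aff] intro!: continuous_intros)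
  from borel_integrable_compact[OF compact_prism[OF \<nu> aff F(1)] this] show ?thesis by simp
qed

lemma face_integral_foot:
  "continuous_on F g \<Longrightarrow> face_integral F g = (\<integral>x. indicator (prism F) x * g (foot x) \<partial>lborel)"
  unfolding foot_def by (rule face_integral_eq[OF \<nu> aff F(1)])

lemma face_integral_diff:
  assumes f: "continuous_on F f" and g: "continuous_on F g"
  shows "face_integral F (\<lambda>x. f x - g x) = face_integral F f - face_integral F g"
  using face_integral_integrable[OF f] face_integral_integrable[OF g]
  by (simp add: face_integral_foot f g continuous_on_diff right_diff_distrib)

text \<open>The foot of a point near \<open>y\<close> is no farther from \<open>y\<close> than the point itself, so a whole ball around \<open>y\<close>
  lies in the prism over \<open>F\<close> and contributes positive values.\<close>

lemma face_integral_pos: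
  assumes g: "continuous_on F g" and nonneg: "\<And>x. x \<in> F \<Longrightarrow> 0 \<le> g x"
    and y: "y \<in> rel_interior F" "0 < g y"
  shows "0 < face_integral F g"
proof -
  obtain r where r: "r > 0" "ball y r \<inter> affine hull F \<subseteq> F" and yF: "y \<in> F"
    using y by (auto simp: mem_rel_interior_ball)
  obtain d where d: "d > 0" "\<And>z. z \<in> F \<Longrightarrow> dist z y < d \<Longrightarrow> dist (g z) (g y) < g y"
    using g yF y(2) unfolding continuous_on_iff by metis
  define \<rho> where "\<rho> = min (min r d) (1/2)"
  have \<rho>: "\<rho> > 0" "\<rho> \<le> r" "\<rho> \<le> d" "\<rho> \<le> 1/2" using r d by (auto simp: \<rho>_def)
  have ball: "x \<in> prism F \<and> 0 < g (foot x)" if x: "x \<in> ball y \<rho>" for x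
  proof -
    have "foot x - y = (x - y) - (\<nu> \<bullet> (x - y)) *\<^sub>R \<nu>"
      using F_hyp[OF yF] by (simp add: foot_def inner_diff_right)
    then have "(norm (foot x - y))\<^sup>2 = (norm (x - y))\<^sup>2 - (\<nu> \<bullet> (x - y))\<^sup>2"
      unfolding power2_norm_eq_inner
      by (simp only:) (simp add: inner_diff_left inner_diff_right nn inner_commute algebra_simps power2_eq_square)
    then have "(norm (foot x - y))\<^sup>2 \<le> (norm (x - y))\<^sup>2" by simp
    then have "norm (foot x - y) \<le> norm (x - y)" by (rule power2_le_imp_le) simp
    then have dy: "dist (foot x) y < \<rho>" using x by (simp add: dist_norm norm_minus_commute)
    then have fF: "foot x \<in> F" using r(2) \<rho>(2) aff foot_hyp[of x] by (auto simp: dist_commute)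
    have "\<bar>\<nu> \<bullet> x - b\<bar> = \<bar>\<nu> \<bullet> (x - y)\<bar>" using F_hyp[OF yF] by (simp add: inner_diff_right)
    also have "\<dots> \<le> norm (x - y)" using Cauchy_Schwarz_ineq2[of \<nu> "x - y"] \<nu> by simp
    also have "\<dots> \<le> 1/2" using x \<rho>(4) by (simp add: dist_norm norm_minus_commute)
    finally have "x \<in> prism F" using fF by (simp add: prism_eq[OF \<nu> aff] foot_def)
    moreover have "dist (g (foot x)) (g y) < g y" using d(2)[OF fF] dy \<rho>(3) by simp
    then have "0 < g (foot x)" by (simp add: dist_real_def)
    ultimately show ?thesis by blast
  qed
  have nn: "0 \<le> indicator (prism F) x * g (foot x)" for x
    using nonneg by (auto simp: indicator_def prism_eq[OF \<nu> aff] foot_def)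
  have "face_integral F g \<noteq> 0"
  proof
    assume "face_integral F g = 0"
    then have "AE x in lborel. indicator (prism F) x * g (foot x) = 0"
      using integral_nonneg_eq_0_iff_AE[OF face_integral_integrable[OF g]] nn
      by (simp add: face_integral_foot[OF g])
    then have "AE x in lborel. x \<notin> ball y \<rho>"
      by (rule AE_mp) (use ball in \<open>force intro!: AE_I2\<close>)
    then have "ball y \<rho> \<in> null_sets lborel" by (subst AE_iff_null_sets) auto
    then have "negligible (ball y \<rho>)"
      by (simp add: negligible_iff_null_sets null_sets_completion_iff)
    then show False using open_not_negligible[of "ball y \<rho>"] \<rho>(1) by simp
  qed
  moreover have "0 \<le> face_integral F g"
    unfolding face_integral_foot[OF g] by (rule Bochner_Integration.integral_nonneg[OF nn])
  ultimately show ?thesis by simp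
qed

lemma face_area_pos: "0 < face_integral F (\<lambda>x. 1)"
proof -
  obtain y where "y \<in> rel_interior F" using F(2,3) rel_interior_eq_empty by blast
  then show ?thesis by (intro face_integral_pos[where y=y]) auto
qed

end

section \<open>Green's formula on a simplex\<close>

text \<open>The vertex opposite to the facet \<open>E\<close> of a simplex \<open>K\<close>. Extreme points make this independent of a chosen list of
  vertices.\<close>

definition apex :: "(real^'n) set \<Rightarrow> (real^'n) set \<Rightarrow> real^'n" where
  "apex K E = (SOME p. p extreme_point_of K \<and> p \<notin> E)"

definition outward_normal :: "(real^'n) set \<Rightarrow> (real^'n) set \<Rightarrow> real^'n" where
  "outward_normal K E =
     (SOME \<nu>. norm \<nu> = 1 \<and> (\<exists>b. affine hull E = {x. \<nu> \<bullet> x = b} \<and> K \<subseteq> {x. \<nu> \<bullet> x \<le> b}))"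

text \<open>Any point \<open>y\<close> of \<open>E\<close> gives the same value, the distance of the apex from the hyperplane of \<open>E\<close>.\<close>

definition height :: "(real^'n) set \<Rightarrow> (real^'n) set \<Rightarrow> real" where
  "height K E = outward_normal K E \<bullet> ((SOME y. y \<in> E) - apex K E)"

definition facets :: "'a::euclidean_space set \<Rightarrow> 'a set set" where
  "facets K = {E. E facet_of K}"

lemma simplex_facets:
  fixes C :: "(real^'n) set"
  assumes C: "\<not> affine_dependent C" "card C = CARD('n) + 1"
  shows "facets (convex hull C) = (\<lambda>u. convex hull (C - {u})) ` C"
    and "\<And>u. u \<in> C \<Longrightarrow> apex (convex hull C) (convex hull (C - {u})) = u"
    and "inj_on (\<lambda>u. convex hull (C - {u})) C"
    and "\<And>u. u \<in> C \<Longrightarrow> u \<notin> affine hull (convex hull (C - {u}))"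
proof -
  have fin: "finite C" using C(2) by (simp add: card_ge_0_finite)
  have ne: "C - {u} \<noteq> {}" if "u \<in> C" for u
  proof
    assume "C - {u} = {}"
    then have "C = {u}" using that by blast
    then show False using C(2) by simp
  qed
  show "facets (convex hull C) = (\<lambda>u. convex hull (C - {u})) ` C"
    unfolding facets_def facet_of_convex_hull_affine_independent[OF C(1)] using ne by auto
  show out: "u \<notin> affine hull (convex hull (C - {u}))" if "u \<in> C" for u
    using C(1) that unfolding affine_hull_convex_hull by (auto simp: affine_dependent_def)
  show ap: "apex (convex hull C) (convex hull (C - {u})) = u" if u: "u \<in> C" for u
  proof -
    have "p extreme_point_of (convex hull C) \<and> p \<notin> convex hull (C - {u}) \<longleftrightarrow> p = u" for p
    proof -
      have "p extreme_point_of (convex hull C) \<longleftrightarrow> p \<in> C"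
        using extreme_point_of_convex_hull_affine_independent[OF C(1)] .
      moreover have "u \<notin> convex hull (C - {u})" using out[OF u] hull_subset[of "convex hull (C - {u})" affine] by blast
      moreover have "p \<in> convex hull (C - {u})" if "p \<in> C" "p \<noteq> u" using that by (simp add: hull_inc)
      ultimately show ?thesis using u by blast
    qed
    then show ?thesis by (simp add: apex_def)
  qed
  show "inj_on (\<lambda>u. convex hull (C - {u})) C"
    by (rule inj_on_inverseI[of _ "apex (convex hull C)"]) (rule ap)
qed

lemma simplex_vertices:
  fixes K :: "(real^'n) set"
  assumes "(int CARD('n)) simplex K"
  obtains C where "\<not> affine_dependent C" "card C = CARD('n) + 1" "K = convex hull C"
  using assms unfolding simplex_def by (metis of_nat_1 of_nat_add of_nat_eq_iff)

lemma compact_simplex: "n simplex K \<Longrightarrow> compact (K::'a::euclidean_space set)"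
  by (auto simp: simplex intro: finite_imp_compact_convex_hull)

lemma finite_facets: "(int CARD('n)) simplex K \<Longrightarrow> finite (facets (K::(real^'n) set))"
  by (metis finite_imageI simplex_vertices simplex_facets(1) aff_independent_finite)

lemma facet_pyramid:
  fixes K E :: "(real^'n) set"
  assumes K: "(int CARD('n)) simplex K" and E: "E \<in> facets K"
  obtains b where "pyramid E (apex K E) (outward_normal K E) b (height K E)"
    and "pyramid.K E (apex K E) = K" and "K \<subseteq> {x. outward_normal K E \<bullet> x \<le> b}"
proof -
  obtain C where C: "\<not> affine_dependent C" "card C = CARD('n) + 1" "K = convex hull C"
    using K by (rule simplex_vertices)
  note sf = simplex_facets[OF C(1,2), folded C(3)]
  obtain u where u: "u \<in> C" "E = convex hull (C - {u})" using E sf(1) by auto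
  have fin: "finite C" using C(1) aff_independent_finite by blast
  have ap: "apex K E = u" using sf(2) u by simp
  have out: "u \<notin> affine hull E" using sf(4) u by simp
  have Ef: "E facet_of K" using E by (simp add: facets_def)
  have "E \<noteq> {}" using Ef by (auto simp: facet_of_def)
  have EK: "E \<subseteq> K" using Ef by (simp add: facet_of_imp_subset)
  have hullK: "K = convex hull (insert u E)"
  proof -
    have "convex hull (insert u E) = convex hull (insert u (C - {u}))"
      unfolding u(2) by (rule hull_insert[symmetric])
    then show ?thesis using u(1) C(3) by (simp add: insert_absorb)
  qed
  have "aff_dim K = int CARD('n)"
    using aff_dim_affine_independent[OF C(1)] C by (simp add: aff_dim_convex_hull)
  then have "aff_dim E = DIM(real^'n) - 1" using Ef by (simp add: facet_of_def)
  then obtain a b where ab: "a \<noteq> 0" "affine hull E = {x. a \<bullet> x = b}"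
    using aff_dim_eq_hyperplane by blast
  have ub: "a \<bullet> u \<noteq> b" using out ab by auto
  define s where "s = (if a \<bullet> u < b then 1 else -1) / norm a"
  have s: "s \<noteq> 0" "\<bar>s\<bar> * norm a = 1" "s * (a \<bullet> u) < s * b" using ab(1) ub
    by (auto simp: s_def divide_strict_right_mono)
  have 1: "norm (s *\<^sub>R a) = 1" using s by simp
  have 2: "affine hull E = {x. (s *\<^sub>R a) \<bullet> x = s * b}" using ab(2) s(1) by auto
  have "insert u E \<subseteq> {x. (s *\<^sub>R a) \<bullet> x \<le> s * b}"
    using 2 s(3) hull_subset[of E affine] by auto
  then have "K \<subseteq> {x. (s *\<^sub>R a) \<bullet> x \<le> s * b}"
    unfolding hullK by (intro hull_minimal convex_halfspace_le)
  with 1 2 have "\<exists>\<nu>. norm \<nu> = 1 \<and> (\<exists>b. affine hull E = {x. \<nu> \<bullet> x = b} \<and> K \<subseteq> {x. \<nu> \<bullet> x \<le> b})" by blast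
  from someI_ex[OF this, folded outward_normal_def]
  obtain b' where n: "norm (outward_normal K E) = 1" "affine hull E = {x. outward_normal K E \<bullet> x = b'}"
    "K \<subseteq> {x. outward_normal K E \<bullet> x \<le> b'}" by blast
  have "(SOME y. y \<in> E) \<in> E" using \<open>E \<noteq> {}\<close> by (simp add: some_in_eq)
  then have y: "outward_normal K E \<bullet> (SOME y. y \<in> E) = b'" using n(2) hull_subset[of E affine] by auto
  have "outward_normal K E \<bullet> u \<le> b'" using n(3) hullK by (auto simp: hull_inc)
  moreover have "outward_normal K E \<bullet> u \<noteq> b'" using n(2) out by auto
  ultimately have less: "outward_normal K E \<bullet> u < b'" by simp
  have "compact E" "convex E" unfolding u(2) using fin by (auto simp: finite_imp_compact_convex_hull)
  then have c: "pyramid E (apex K E) (outward_normal K E) b' (height K E)"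
    using \<open>E \<noteq> {}\<close> n y less by (unfold_locales) (auto simp: ap height_def inner_diff_right)
  then have "pyramid.K E (apex K E) = K" using pyramid.K_def[OF c] ap hullK by metis
  with c n(3) show thesis using that by blast
qed

lemma apex_in_other_facets:
  fixes K :: "(real^'n) set"
  assumes K: "(int CARD('n)) simplex K" and E: "E \<in> facets K" "E' \<in> facets K" "E' \<noteq> E"
  shows "apex K E \<in> E'"
proof -
  obtain C where C: "\<not> affine_dependent C" "card C = CARD('n) + 1" "K = convex hull C"
    using K by (rule simplex_vertices)
  note sf = simplex_facets[OF C(1,2), folded C(3)]
  obtain u u' where "u \<in> C" "E = convex hull (C - {u})" "u' \<in> C" "E' = convex hull (C - {u'})"
    using E sf(1) by auto
  moreover from this have "u \<in> C - {u'}" using E(3) by auto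
  ultimately show ?thesis using sf(2) by (simp add: hull_inc)
qed

text \<open>For \<open>E' \<noteq> E\<close> the apex opposite to \<open>E'\<close> is a vertex of \<open>E\<close>, so \<open>x - apex K E'\<close> is tangential to \<open>E\<close>.\<close>

lemma simplex_flux:
  fixes K :: "(real^'n) set"
  assumes K: "(int CARD('n)) simplex K" and E: "E \<in> facets K" "E' \<in> facets K" and x: "x \<in> E"
  shows "(x - apex K E') \<bullet> outward_normal K E = (if E' = E then height K E else 0)"
proof -
  obtain b where "pyramid E (apex K E) (outward_normal K E) b (height K E)"
    by (rule facet_pyramid[OF K E(1)])
  then interpret pyramid E "apex K E" "outward_normal K E" b "height K E" .
  show ?thesis
    using F_hyp[OF x] F_hyp[OF apex_in_other_facets[OF K E(2) E(1)]] p
    by (auto simp: inner_commute[of _ "outward_normal K E"] inner_diff_right)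
qed

text \<open>The weights have to satisfy \<open>\<Sum> \<alpha> = c\<close> and \<open>\<Sum> \<alpha> p = - a\<close>, where \<open>p\<close> runs over the vertices. The barycentric
  coordinates of \<open>- a\<close> have the second property and the sum 1; adding \<open>c - 1\<close> times
  the barycentric coordinates of the origin corrects the sum.\<close>

lemma RT_decomposition:
  fixes K :: "(real^'n) set"
  assumes K: "(int CARD('n)) simplex K"
  obtains \<alpha> where "c = (\<Sum>E\<in>facets K. \<alpha> E)" "\<And>x. a + c *\<^sub>R x = (\<Sum>E\<in>facets K. \<alpha> E *\<^sub>R (x - apex K E))"
proof -
  obtain C where C: "\<not> affine_dependent C" "card C = CARD('n) + 1" "K = convex hull C"
    using K by (rule simplex_vertices)
  note sf = simplex_facets[OF C(1,2), folded C(3)]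
  have fin: "finite C" using C(1) aff_independent_finite by blast
  have "affine hull C = UNIV" using affine_independent_span_eq[OF C(1)] C(2) by simp
  then have *: "y \<in> {y. \<exists>u. sum u C = 1 \<and> (\<Sum>v\<in>C. u v *\<^sub>R v) = y}" for y
    using affine_hull_finite[OF fin] by auto
  obtain \<beta> where \<beta>: "sum \<beta> C = 1" "(\<Sum>v\<in>C. \<beta> v *\<^sub>R v) = 0" using *[of 0] by auto
  obtain \<gamma> where \<gamma>: "sum \<gamma> C = 1" "(\<Sum>v\<in>C. \<gamma> v *\<^sub>R v) = - a" using *[of "- a"] by auto
  define \<delta> where "\<delta> v = \<gamma> v + (c - 1) * \<beta> v" for v
  have \<delta>: "sum \<delta> C = c" "(\<Sum>v\<in>C. \<delta> v *\<^sub>R v) = - a"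
  proof -
    show "sum \<delta> C = c" using \<beta>(1) \<gamma>(1) by (simp add: \<delta>_def sum.distrib flip: sum_distrib_left)
    have "(\<Sum>v\<in>C. \<delta> v *\<^sub>R v) = (\<Sum>v\<in>C. \<gamma> v *\<^sub>R v) + (c - 1) *\<^sub>R (\<Sum>v\<in>C. \<beta> v *\<^sub>R v)"
      by (simp add: \<delta>_def scaleR_add_left sum.distrib scaleR_sum_right)
    then show "(\<Sum>v\<in>C. \<delta> v *\<^sub>R v) = - a" using \<beta> \<gamma> by simp
  qed
  define \<alpha> where "\<alpha> E = \<delta> (apex K E)" for E
  have re: "(\<Sum>E\<in>facets K. f (apex K E)) = sum f C" for f :: "real^'n \<Rightarrow> 'b::comm_monoid_add"
    unfolding sf(1) by (subst sum.reindex[OF sf(3)]) (simp add: sf(2))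
  show thesis
  proof
    show "c = (\<Sum>E\<in>facets K. \<alpha> E)" unfolding \<alpha>_def re using \<delta> by simp
    fix x
    have "(\<Sum>E\<in>facets K. \<alpha> E *\<^sub>R (x - apex K E)) = (\<Sum>v\<in>C. \<delta> v *\<^sub>R (x - v))"
      unfolding \<alpha>_def using re[of "\<lambda>v. \<delta> v *\<^sub>R (x - v)"] .
    also have "\<dots> = a + c *\<^sub>R x"
      using \<delta> by (simp add: scaleR_diff_right sum_subtractf flip: scaleR_sum_left)
    finally show "a + c *\<^sub>R x = (\<Sum>E\<in>facets K. \<alpha> E *\<^sub>R (x - apex K E))" ..
  qed
qed

text \<open>By \<open>RT_decomposition\<close> it suffices to treat the fields \<open>x - apex K E\<close>. The simplex is the pyramid over \<open>E\<close> with
  that apex, and by \<open>simplex_flux\<close> the field has normal component \<open>height K E\<close> on \<open>E\<close> and 0 on the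
  other facets: the claim is \<open>pyramid_formula\<close>.\<close>

theorem green_simplex:
  fixes K :: "(real^'n) set"
  assumes K: "(int CARD('n)) simplex K"
    and \<phi>: "\<And>x. GDERIV \<phi> x :> g x" and g: "continuous_on UNIV g"
  shows "integral\<^sup>L (lebesgue_on K) (\<lambda>x. (a + c *\<^sub>R x) \<bullet> g x + real CARD('n) * c * \<phi> x)
       = (\<Sum>E\<in>facets K. face_integral E (\<lambda>x. ((a + c *\<^sub>R x) \<bullet> outward_normal K E) * \<phi> x))"
proof -
  obtain \<alpha> where \<alpha>: "c = (\<Sum>E\<in>facets K. \<alpha> E)" "\<And>x. a + c *\<^sub>R x = (\<Sum>E\<in>facets K. \<alpha> E *\<^sub>R (x - apex K E))"
    using RT_decomposition[OF K] by blast
  have cont\<phi>: "continuous_on UNIV \<phi>" using GDERIV_imp_continuous[OF \<phi>] .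
  have cK: "compact K" by (rule compact_simplex[OF K])
  let ?f = "\<lambda>E x. g x \<bullet> (x - apex K E) + real CARD('n) * \<phi> x"
  have int: "integrable (lebesgue_on K) (?f E)" for E
    by (rule integral_lebesgue_on_compact(2)[OF cK])
       (intro continuous_intros continuous_on_subset[OF g] continuous_on_subset[OF cont\<phi>]; simp)
  have eq: "(a + c *\<^sub>R x) \<bullet> g x + real CARD('n) * c * \<phi> x = (\<Sum>E\<in>facets K. \<alpha> E * ?f E x)" for x
  proof -
    have "(\<Sum>E\<in>facets K. \<alpha> E * ?f E x) = g x \<bullet> (\<Sum>E\<in>facets K. \<alpha> E *\<^sub>R (x - apex K E)) + real CARD('n) * (\<Sum>E\<in>facets K. \<alpha> E) * \<phi> x"
      by (simp add: inner_sum_right distrib_left sum.distrib sum_distrib_left sum_distrib_right mult.assoc mult.left_commute)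
    then show ?thesis using \<alpha> by (simp add: inner_commute)
  qed
  have "integral\<^sup>L (lebesgue_on K) (\<lambda>x. (a + c *\<^sub>R x) \<bullet> g x + real CARD('n) * c * \<phi> x)
      = (\<Sum>E\<in>facets K. \<alpha> E * integral\<^sup>L (lebesgue_on K) (?f E))"
    unfolding eq using int by (subst Bochner_Integration.integral_sum) auto
  also have "\<dots> = (\<Sum>E\<in>facets K. face_integral E (\<lambda>x. ((a + c *\<^sub>R x) \<bullet> outward_normal K E) * \<phi> x))"
  proof (rule sum.cong)
    fix E assume E: "E \<in> facets K"
    obtain b where b: "pyramid E (apex K E) (outward_normal K E) b (height K E)" "pyramid.K E (apex K E) = K"
      by (rule facet_pyramid[OF K E])
    have "((a + c *\<^sub>R x) \<bullet> outward_normal K E) = \<alpha> E * height K E" if "x \<in> E" for x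
    proof -
      have "((a + c *\<^sub>R x) \<bullet> outward_normal K E) = (\<Sum>E'\<in>facets K. if E' = E then \<alpha> E * height K E else 0)"
        unfolding \<alpha>(2) inner_sum_left
        by (rule sum.cong) (use simplex_flux[OF K E _ that] in auto)
      then show ?thesis using E finite_facets[OF K] by simp
    qed
    then have "face_integral E (\<lambda>x. ((a + c *\<^sub>R x) \<bullet> outward_normal K E) * \<phi> x) = face_integral E (\<lambda>x. (\<alpha> E * height K E) * \<phi> x)"
      by (intro face_integral_cong) simp
    also have "\<dots> = \<alpha> E * integral\<^sup>L (lebesgue_on K) (?f E)"
      unfolding face_integral_cmult using pyramid.pyramid_formula[OF b(1) \<phi> g] b(2) by simp
    finally show "\<alpha> E * integral\<^sup>L (lebesgue_on K) (?f E) = face_integral E (\<lambda>x. ((a + c *\<^sub>R x) \<bullet> outward_normal K E) * \<phi> x)" ..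
  qed simp
  finally show ?thesis .
qed

section \<open>Test functions\<close>

lemma Ck_const: "Ck k (\<lambda>x. c)"
proof (induction k arbitrary: c)
  case (Suc k)
  show ?case unfolding Ck.simps by (rule exI[of _ "\<lambda>x. 0"]) (simp add: Suc GDERIV_const)
qed simp

lemma Ck_SucD: "Ck (Suc k) \<phi> \<Longrightarrow> Ck k \<phi>"
proof (induction k arbitrary: \<phi>)
  case 0
  then show ?case
    by (auto intro: GDERIV_imp_continuous)
next
  case (Suc k)
  then show ?case by (metis Ck.simps(2))
qed

lemma Ck_add: "Ck k \<phi> \<Longrightarrow> Ck k \<psi> \<Longrightarrow> Ck k (\<lambda>x. \<phi> x + \<psi> x)"
proof (induction k arbitrary: \<phi> \<psi>)
  case (Suc k)
  from Suc.prems obtain f g where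
    "\<And>x. GDERIV \<phi> x :> f x" "\<And>i. Ck k (\<lambda>x. f x $ i)"
    "\<And>x. GDERIV \<psi> x :> g x" "\<And>i. Ck k (\<lambda>x. g x $ i)" by auto
  then show ?case unfolding Ck.simps
    by (intro exI[of _ "\<lambda>x. f x + g x"]) (simp add: GDERIV_add Suc.IH)
qed (simp add: continuous_on_add)

lemma Ck_mult: "Ck k \<phi> \<Longrightarrow> Ck k \<psi> \<Longrightarrow> Ck k (\<lambda>x. \<phi> x * \<psi> x)"
proof (induction k arbitrary: \<phi> \<psi>)
  case (Suc k)
  from Suc.prems obtain f g where
    "\<And>x. GDERIV \<phi> x :> f x" "\<And>i. Ck k (\<lambda>x. f x $ i)"
    "\<And>x. GDERIV \<psi> x :> g x" "\<And>i. Ck k (\<lambda>x. g x $ i)" by auto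
  moreover have "Ck k \<phi>" "Ck k \<psi>" using Suc.prems by (blast dest: Ck_SucD)+
  ultimately show ?case unfolding Ck.simps
    by (intro exI[of _ "\<lambda>x. \<phi> x *\<^sub>R g x + \<psi> x *\<^sub>R f x"]) (simp add: GDERIV_mult Suc.IH Ck_add)
qed (simp add: continuous_on_mult)

lemma Ck_component: "Ck k (\<lambda>x::real^'n. x $ i)"
proof (cases k)
  case (Suc k')
  have "GDERIV (\<lambda>x::real^'n. x $ i) x :> axis i 1" for x :: "real^'n"
    unfolding gderiv_def inner_axis by (simp, rule bounded_linear_imp_has_derivative, rule bounded_linear_vec_nth)
  moreover have "Ck k' (\<lambda>x. axis i 1 $ j)" for j by (rule Ck_const)
  ultimately show ?thesis unfolding Suc Ck.simps by (intro exI[of _ "\<lambda>x. axis i 1"]) auto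
qed (simp add: continuous_on_component)

lemma Ck_sum: "finite I \<Longrightarrow> (\<And>i. i \<in> I \<Longrightarrow> Ck k (\<phi> i)) \<Longrightarrow> Ck k (\<lambda>x. \<Sum>i\<in>I. \<phi> i x)"
  by (induction I rule: finite_induct) (auto intro: Ck_const Ck_add)

lemma Ck_prod: "finite I \<Longrightarrow> (\<And>i. i \<in> I \<Longrightarrow> Ck k (\<phi> i)) \<Longrightarrow> Ck k (\<lambda>x. \<Prod>i\<in>I. \<phi> i x)"
  by (induction I rule: finite_induct) (auto intro: Ck_const Ck_mult)

lemma Ck_diff: "Ck k \<phi> \<Longrightarrow> Ck k \<psi> \<Longrightarrow> Ck k (\<lambda>x. \<phi> x - \<psi> x)"
  using Ck_add[of k \<phi> "\<lambda>x. (- 1) * \<psi> x"] Ck_mult[OF Ck_const[of k "- 1"], of \<psi>] by simp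

lemma Ck_inner: "Ck k (\<lambda>x. \<nu> \<bullet> x)"
  unfolding inner_vec_def by (intro Ck_sum) (auto intro: Ck_mult Ck_const Ck_component)

lemma Ck_norm_sq: "Ck k (\<lambda>x. (norm (x - y))\<^sup>2)"
  unfolding power2_norm_eq_inner unfolding inner_vec_def
  by (intro Ck_sum) (auto simp: intro!: Ck_mult Ck_diff Ck_const Ck_component)

text \<open>The family \<open>p(1/t) exp(-1/t)\<close>, continued by 0 to \<open>t \<le> 0\<close>, is closed under differentiation, which is
  what an inductive proof of smoothness requires.\<close>

definition flat :: "real poly \<Rightarrow> real \<Rightarrow> real" where
  "flat p t = (if t > 0 then poly p (1/t) * exp (- (1/t)) else 0)"

lemma flat_tendsto_0: "(flat p \<longlongrightarrow> 0) (at_right 0)"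
proof -
  have "((\<lambda>s. poly p s * exp (- s)) \<longlongrightarrow> 0) at_top"
  proof -
    have "((\<lambda>s. \<Sum>i\<le>degree p. coeff p i * (s ^ i / exp s)) \<longlongrightarrow> (\<Sum>i\<le>degree p. coeff p i * 0)) at_top"
      by (intro tendsto_intros tendsto_power_div_exp_0)
    moreover have "poly p s * exp (- s) = (\<Sum>i\<le>degree p. coeff p i * (s ^ i / exp s))" for s
      by (simp add: poly_altdef sum_distrib_right exp_minus divide_inverse mult.assoc)
    ultimately show ?thesis by simp
  qed
  then have "((\<lambda>t. poly p (inverse t) * exp (- inverse t)) \<longlongrightarrow> 0) (at_right 0)"
    by (rule filterlim_compose[OF _ filterlim_inverse_at_top_right])
  then show ?thesis
    by (rule Lim_transform_eventually)
       (auto simp: eventually_at_filter flat_def inverse_eq_divide)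
qed

text \<open>At 0 the difference quotient of the function for \<open>p\<close> is again in the family, for the polynomial \<open>X p\<close>, hence tends
  to 0.\<close>

lemma flat_deriv: "(flat p has_real_derivative flat ([:0, 0, 1:] * (p - pderiv p)) t) (at t)"
proof -
  consider "t > 0" | "t < 0" | "t = 0" by linarith
  then show ?thesis
  proof cases
    case 1
    have "((\<lambda>t. poly p (1/t) * exp (- (1/t))) has_real_derivative flat ([:0, 0, 1:] * (p - pderiv p)) t) (at t)"
      using 1 by (auto intro!: derivative_eq_intros simp: flat_def field_simps power2_eq_square)
    then show ?thesis
      by (rule DERIV_cong_ev[THEN iffD1, rotated 3])
         (use 1 in \<open>auto simp: flat_def eventually_nhds intro!: exI[of _ "{0<..}"]\<close>)
  next
    case 2
    have "((\<lambda>t. 0) has_real_derivative 0) (at t)" by simp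
    then show ?thesis
      by (rule DERIV_cong_ev[THEN iffD1, rotated 3])
         (use 2 in \<open>auto simp: flat_def eventually_nhds intro!: exI[of _ "{..<0}"]\<close>)
  next
    case 3
    have "((\<lambda>h. flat p h / h) \<longlongrightarrow> 0) (at_right 0)"
    proof (rule Lim_transform_eventually[OF flat_tendsto_0[of "[:0, 1:] * p"]])
      show "eventually (\<lambda>h. flat ([:0, 1:] * p) h = flat p h / h) (at_right 0)"
        by (auto simp: eventually_at_filter flat_def)
    qed
    moreover have "((\<lambda>h. flat p h / h) \<longlongrightarrow> 0) (at_left 0)"
      by (rule Lim_transform_eventually[OF tendsto_const]) (auto simp: eventually_at_filter flat_def)
    ultimately have "((\<lambda>h. flat p h / h) \<longlongrightarrow> 0) (at 0)" by (simp add: filterlim_split_at)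
    then show ?thesis unfolding 3 DERIV_def by (simp add: flat_def)
  qed
qed

lemma Ck_flat:
  assumes "\<And>k. Ck k h"
  shows "Ck k (\<lambda>x. flat p (h x))"
proof (induction k arbitrary: p)
  case 0
  have "continuous_on UNIV (flat p)"
    by (meson DERIV_isCont continuous_at_imp_continuous_on flat_deriv)
  moreover have "continuous_on UNIV h" using assms[of 0] by simp
  ultimately show ?case by (auto intro: continuous_on_compose2)
next
  case (Suc k)
  obtain g where g: "\<And>x. GDERIV h x :> g x" "\<And>i. Ck k (\<lambda>x. g x $ i)" using assms[of "Suc k"] by auto
  let ?q = "[:0, 0, 1:] * (p - pderiv p)"
  have "GDERIV (\<lambda>x. flat p (h x)) x :> flat ?q (h x) *\<^sub>R g x" for x
    by (rule GDERIV_DERIV_compose[OF g(1) flat_deriv])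
  moreover have "Ck k (\<lambda>x. (flat ?q (h x) *\<^sub>R g x) $ i)" for i
    unfolding vector_scaleR_component real_scaleR_def by (intro Ck_mult Suc.IH g(2))
  ultimately show ?case unfolding Ck.simps by (intro exI[of _ "\<lambda>x. flat ?q (h x) *\<^sub>R g x"]) blast
qed

definition bump :: "real \<Rightarrow> real" where "bump = flat 1"

lemma bump_eq: "bump t = (if t > 0 then exp (- (1/t)) else 0)"
  by (simp add: bump_def flat_def)

lemma bump_bounds: "0 \<le> bump t" "bump t \<le> 1" "bump t = 0 \<longleftrightarrow> t \<le> 0"
  by (auto simp: bump_eq)

lemma GDERIV_unique:
  assumes "GDERIV \<phi> x :> a" "GDERIV \<phi> x :> b"
  shows "a = b"
proof -
  have "(\<lambda>h. h \<bullet> a) = (\<lambda>h. h \<bullet> b)"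
    using assms unfolding gderiv_def by (rule has_derivative_unique)
  then have "(a - b) \<bullet> a = (a - b) \<bullet> b" by (rule fun_cong)
  then have "(a - b) \<bullet> (a - b) = 0" by (simp add: inner_diff_right)
  then show ?thesis by simp
qed

lemma grad_eqI:
  assumes "GDERIV \<phi> x :> g"
  shows "grad \<phi> x = g"
  unfolding grad_def
proof (rule the_equality)
  show "GDERIV \<phi> x :> g" by (rule assms)
  fix D assume "GDERIV \<phi> x :> D"
  then show "D = g" using assms by (rule GDERIV_unique)
qed

lemma test_functions_C1:
  assumes "\<phi> \<in> test_functions \<Omega>"
  shows "GDERIV \<phi> x :> grad \<phi> x" "continuous_on UNIV (grad \<phi>)"
proof -
  have "Ck (Suc 0) \<phi>" using assms unfolding test_functions_def by blast
  then obtain g where g: "\<And>x. GDERIV \<phi> x :> g x" "\<And>i. continuous_on UNIV (\<lambda>x. g x $ i)" by auto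
  have "grad \<phi> x = g x" for x
    by (rule grad_eqI[OF g(1)])
  then have gr: "grad \<phi> = g" by auto
  show "GDERIV \<phi> x :> grad \<phi> x" using g(1) gr by simp
  have "continuous_on UNIV (\<lambda>x. \<chi> i. g x $ i)" by (rule continuous_on_vec_lambda[OF g(2)])
  then show "continuous_on UNIV (grad \<phi>)" using gr by (simp add: vec_lambda_eta)
qed

lemma test_functions_compact_supportI:
  assumes "\<And>k. Ck k \<phi>" "compact S" "S \<subseteq> \<Omega>" "\<And>x. x \<notin> S \<Longrightarrow> \<phi> x = 0"
  shows "\<phi> \<in> test_functions \<Omega>"
proof -
  have "closure {x. \<phi> x \<noteq> 0} \<subseteq> S"
    using assms(2,4) by (intro closure_minimal compact_imp_closed) auto
  moreover from this have "compact (closure {x. \<phi> x \<noteq> 0})"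
    using assms(2) by (metis closed_closure compact_Int_closed inf.absorb_iff2)
  ultimately show ?thesis using assms by (auto simp: test_functions_def)
qed

text \<open>Let \<open>U\<close> be the union of countably many balls \<open>B\<^sub>i\<close> whose closures lie in \<open>U\<close>, and let \<open>h\<^sub>i\<close> be positive exactly
  on \<open>B\<^sub>i\<close>. Then \<open>bump (k h\<^sub>i)\<close> tends to 1 on \<open>B\<^sub>i\<close>, and \<open>1 - \<Prod>\<^sub>i\<^sub><\<^sub>k (1 - bump (k h\<^sub>i))\<close> tends to 1 at every
  point of \<open>U\<close> as soon as one of its factors tends to 0.\<close>

lemma indicator_limit_of_test_functions:
  fixes U :: "(real^'n) set"
  assumes "open U"
  obtains \<phi> where "\<And>k::nat. \<phi> k \<in> test_functions U" "\<And>k x. \<bar>\<phi> k x\<bar> \<le> 1"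
    "\<And>x. (\<lambda>k. \<phi> k x) \<longlonglongrightarrow> indicator U x"
proof -
  let ?B = "{(y, r). 0 < r \<and> cball y r \<subseteq> U}"
  have U: "U = (\<Union>(y, r)\<in>?B. ball y r)"
  proof
    show "U \<subseteq> (\<Union>(y, r)\<in>?B. ball y r)"
      using assms by (fastforce simp: open_contains_cball)
    show "(\<Union>(y, r)\<in>?B. ball y r) \<subseteq> U" using ball_subset_cball by blast
  qed
  obtain D where D: "D \<subseteq> (\<lambda>(y, r). ball y r) ` ?B" "countable D" "\<Union>D = \<Union>((\<lambda>(y, r). ball y r) ` ?B)"
    by (rule Lindelof[of "(\<lambda>(y, r). ball y r) ` ?B"]) auto
  have "\<exists>y r. (\<forall>i::nat. 0 < r i \<longrightarrow> cball (y i) (r i) \<subseteq> U) \<and> U = (\<Union>i. ball (y i) (r i))"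
  proof (cases "D = {}")
    case True
    then have "U = {}" using D(3) U by simp
    then show ?thesis by (intro exI[of _ "\<lambda>_. 0"]) auto
  next
    case False
    then obtain d where d: "D = range (d :: nat \<Rightarrow> (real^'n) set)" using D(2) uncountable_def[of D] by metis
    have "\<forall>i. \<exists>y r. 0 < r \<and> cball y r \<subseteq> U \<and> d i = ball y r"
    proof
      fix i
      have "d i \<in> (\<lambda>(y, r). ball y r) ` ?B" using D(1) d by blast
      then show "\<exists>y r. 0 < r \<and> cball y r \<subseteq> U \<and> d i = ball y r" by (elim imageE) auto
    qed
    from choice[OF this] obtain y where "\<forall>i. \<exists>r. 0 < r \<and> cball (y i) r \<subseteq> U \<and> d i = ball (y i) r" ..
    from choice[OF this] obtain r
      where yr: "\<And>i. 0 < r i" "\<And>i. cball (y i) (r i) \<subseteq> U" "\<And>i. d i = ball (y i) (r i)" by auto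
    have "U = \<Union>D" using D(3) U by simp
    then have "U = (\<Union>i. ball (y i) (r i))" using d yr(3) by auto
    with yr(2) show ?thesis by (intro exI[of _ y] exI[of _ r]) simp
  qed
  then obtain y r where yr: "\<And>i::nat. 0 < r i \<Longrightarrow> cball (y i) (r i) \<subseteq> U" "U = (\<Union>i. ball (y i) (r i))" by blast
  \<comment> \<open>The sign of the radius is kept because an empty \<open>U\<close> is covered by balls of radius 0.\<close>
  define h where "h i x = r i * \<bar>r i\<bar> - (norm (x - y i))\<^sup>2" for i x
  have h_pos: "h i x > 0 \<longleftrightarrow> x \<in> ball (y i) (r i)" for i x
  proof (cases "r i > 0")
    case True
    then have "h i x > 0 \<longleftrightarrow> (norm (x - y i))\<^sup>2 < (r i)\<^sup>2" by (simp add: h_def power2_eq_square)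
    also have "\<dots> \<longleftrightarrow> norm (x - y i) < r i" using True
      by (meson less_imp_le norm_ge_zero power2_less_imp_less power_strict_mono zero_less_numeral)
    finally show ?thesis by (simp add: dist_norm norm_minus_commute)
  next
    case False
    then have "r i * \<bar>r i\<bar> \<le> 0" by (simp add: mult_nonpos_nonneg)
    then have "h i x \<le> 0" unfolding h_def by (smt (verit) zero_le_power2)
    moreover have "ball (y i) (r i) = {}" using False by simp
    ultimately show ?thesis by (simp only: empty_iff not_less[symmetric])
  qed
  define \<phi> where "\<phi> k x = 1 - (\<Prod>i<k. 1 - bump (real k * h i x))" for k x
  have fac: "0 \<le> 1 - bump t" "1 - bump t \<le> 1" for t using bump_bounds by auto
  have pr: "0 \<le> (\<Prod>i<k. 1 - bump (real k * h i x))" "(\<Prod>i<k. 1 - bump (real k * h i x)) \<le> 1" for k x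
    using fac by (auto intro: prod_nonneg prod_le_1)
  have outside: "\<phi> k x = 0" if "\<And>i. i < k \<Longrightarrow> x \<notin> ball (y i) (r i)" for k x
  proof -
    have "bump (real k * h i x) = 0" if "i < k" for i
    proof -
      have "h i x \<le> 0"
        using h_pos[of i x] \<open>i < k\<close> \<open>\<And>i. i < k \<Longrightarrow> x \<notin> ball (y i) (r i)\<close> by (meson not_less)
      then show ?thesis by (simp add: bump_bounds(3) mult_nonneg_nonpos)
    qed
    then show ?thesis by (simp add: \<phi>_def)
  qed
  show thesis
  proof
    fix k :: nat
    show "\<phi> k \<in> test_functions U"
    proof (rule test_functions_compact_supportI[where S="\<Union>i\<in>{i. i < k \<and> 0 < r i}. cball (y i) (r i)"])
      show "Ck l (\<phi> k)" for l
        unfolding \<phi>_def h_def bump_def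
        by (intro Ck_diff Ck_const Ck_prod Ck_flat Ck_mult Ck_norm_sq) auto
      show "compact (\<Union>i\<in>{i. i < k \<and> 0 < r i}. cball (y i) (r i))" by (intro compact_UN) auto
      show "(\<Union>i\<in>{i. i < k \<and> 0 < r i}. cball (y i) (r i)) \<subseteq> U" using yr(1) by blast
      show "\<phi> k x = 0" if x: "x \<notin> (\<Union>i\<in>{i. i < k \<and> 0 < r i}. cball (y i) (r i))" for x
      proof (rule outside)
        fix i assume "i < k"
        show "x \<notin> ball (y i) (r i)"
        proof
          assume b: "x \<in> ball (y i) (r i)"
          then have "0 < r i" using zero_le_dist[of "y i" x] unfolding mem_ball by linarith
          then show False using x \<open>i < k\<close> b by auto
        qed
      qed
    qed
    show "\<bar>\<phi> k x\<bar> \<le> 1" for x using pr[of k x] by (simp add: \<phi>_def)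
  next
    fix x
    show "(\<lambda>k. \<phi> k x) \<longlonglongrightarrow> indicator U x"
    proof (cases "x \<in> U")
      case False
      then have "\<phi> k x = 0" for k by (intro outside) (use yr(2) in auto)
      then show ?thesis using False by simp
    next
      case True
      then obtain j where "x \<in> ball (y j) (r j)" using yr(2) by auto
      then have hj: "h j x > 0" using h_pos by simp
      have b: "\<bar>\<phi> k x - 1\<bar> \<le> 1 - exp (- (1 / (real k * h j x)))" if "k > j" for k
      proof -
        have "(\<Prod>i<k. 1 - bump (real k * h i x)) = (1 - bump (real k * h j x)) * (\<Prod>i\<in>{..<k} - {j}. 1 - bump (real k * h i x))"
          using that by (subst prod.remove[of _ j]) auto
        also have "\<dots> \<le> (1 - bump (real k * h j x)) * 1"
          using fac by (intro mult_left_mono prod_le_1) auto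
        also have "\<dots> = 1 - exp (- (1 / (real k * h j x)))" using hj that by (simp add: bump_eq)
        finally show ?thesis using pr(1)[of k x] by (simp add: \<phi>_def)
      qed
      have "(\<lambda>k. 1 / real k * (1 / h j x)) \<longlonglongrightarrow> 0 * (1 / h j x)"
        by (intro tendsto_intros lim_1_over_n)
      then have "(\<lambda>k. 1 - exp (- (1 / (real k * h j x)))) \<longlonglongrightarrow> 1 - exp (- (0 * (1 / h j x)))"
        by (intro tendsto_intros) simp
      then have "(\<lambda>k. 1 - exp (- (1 / (real k * h j x)))) \<longlonglongrightarrow> 0" by simp
      then have "(\<lambda>k. \<phi> k x - 1) \<longlonglongrightarrow> 0"
        by (rule Lim_null_comparison[rotated])
           (use b in \<open>auto simp: eventually_sequentially intro!: exI[of _ "Suc j"]\<close>)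
      then show ?thesis using True LIM_zero_iff by fastforce
    qed
  qed
qed

section \<open>The faces of a triangulation\<close>

lemma unit_normals_of_hyperplane:
  fixes \<nu>1 \<nu>2 :: "'a::real_inner"
  assumes "norm \<nu>1 = 1" "norm \<nu>2 = 1" "{x. \<nu>1 \<bullet> x = b1} = {x. \<nu>2 \<bullet> x = b2}"
  shows "\<nu>2 = \<nu>1 \<or> \<nu>2 = - \<nu>1"
proof -
  have n: "\<nu>1 \<bullet> \<nu>1 = 1" "\<nu>2 \<bullet> \<nu>2 = 1" using assms by (auto simp: dot_square_norm)
  define v where "v = \<nu>2 - (\<nu>1 \<bullet> \<nu>2) *\<^sub>R \<nu>1"
  have v: "\<nu>1 \<bullet> v = 0" by (simp add: v_def inner_diff_right n)
  have "\<nu>1 \<bullet> (b1 *\<^sub>R \<nu>1) = b1" "\<nu>1 \<bullet> (b1 *\<^sub>R \<nu>1 + v) = b1" by (auto simp: n v inner_add_right)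
  then have "\<nu>2 \<bullet> (b1 *\<^sub>R \<nu>1) = b2" "\<nu>2 \<bullet> (b1 *\<^sub>R \<nu>1 + v) = b2" using assms(3) by blast+
  then have "\<nu>2 \<bullet> v = 0" by (simp add: inner_add_right)
  then have "v \<bullet> v = 0" using v by (simp add: v_def inner_diff_left)
  then have "v = 0" by simp
  then have eq: "\<nu>2 = (\<nu>1 \<bullet> \<nu>2) *\<^sub>R \<nu>1" by (simp add: v_def)
  then have "norm \<nu>2 = \<bar>\<nu>1 \<bullet> \<nu>2\<bar> * norm \<nu>1" by (metis norm_scaleR)
  then have "\<bar>\<nu>1 \<bullet> \<nu>2\<bar> = 1" using assms by simp
  then have "\<nu>1 \<bullet> \<nu>2 = 1 \<or> \<nu>1 \<bullet> \<nu>2 = -1" by linarith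
  then show ?thesis using eq by (metis scaleR_one scaleR_minus1_left)
qed

lemma AE_lebesgue_on_iff:
  "S \<in> sets lebesgue \<Longrightarrow> (AE x in lebesgue_on S. P x) \<longleftrightarrow> (AE x in lebesgue. x \<in> S \<longrightarrow> P x)"
  by (subst AE_restrict_space_iff) auto

lemma negligible_AE: "negligible N \<Longrightarrow> AE x in lebesgue. x \<notin> N"
  by (simp add: negligible_iff_null_sets AE_not_in)

locale mesh =
  fixes \<Omega> :: "(real^'n) set" and \<T> :: "(real^'n) set set"
  assumes dom: "polytopal_domain \<Omega>" and tri: "triangulation_of \<Omega> \<T>"
begin

lemma finite_T: "finite \<T>"
  using tri by (simp add: triangulation_of_def triangulation_def)

lemma simplex_T: "K \<in> \<T> \<Longrightarrow> (int CARD('n)) simplex K"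
  using tri by (simp add: triangulation_of_def)

lemma Union_T: "\<Union>\<T> = closure \<Omega>"
  using tri by (simp add: triangulation_of_def)

lemma conforming: "K \<in> \<T> \<Longrightarrow> K' \<in> \<T> \<Longrightarrow> (K \<inter> K') face_of K"
  using tri by (simp add: triangulation_of_def triangulation_def)

lemma compact_T: "K \<in> \<T> \<Longrightarrow> compact K"
  using compact_simplex simplex_T by blast

lemma convex_T: "K \<in> \<T> \<Longrightarrow> convex K"
  using simplex_T by (auto simp: simplex)

lemma sets_T: "K \<in> \<T> \<Longrightarrow> K \<in> sets lebesgue"
  using compact_T by (simp add: borel_compact)

lemma open_dom: "open \<Omega>"
  using dom by (simp add: polytopal_domain_def)

lemma sets_dom: "\<Omega> \<in> sets lebesgue"
  using open_dom by simp

lemma aff_dim_T: "K \<in> \<T> \<Longrightarrow> aff_dim K = int CARD('n)"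
  by (rule aff_dim_simplex[OF simplex_T])

lemma affine_hull_T: "K \<in> \<T> \<Longrightarrow> affine hull K = UNIV"
  using aff_dim_T[of K] aff_dim_eq_full[of K] by simp

lemma rel_interior_T: "K \<in> \<T> \<Longrightarrow> rel_interior K = interior K"
  using affine_hull_T rel_interior_interior by blast

lemma interior_T: "K \<in> \<T> \<Longrightarrow> interior K \<noteq> {}"
proof -
  assume K: "K \<in> \<T>"
  have "K \<noteq> {}" using aff_dim_T[OF K] by auto
  then show ?thesis using rel_interior_eq_empty[OF convex_T[OF K]] rel_interior_T[OF K] by simp
qed

lemma closure_interior_T: "K \<in> \<T> \<Longrightarrow> closure (interior K) = K"
  using convex_closure_interior[OF convex_T interior_T] compact_T compact_imp_closed closure_closed by metis

lemma elements_disjoint: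
  assumes K: "K \<in> \<T>" "K' \<in> \<T>" and x: "x \<in> interior K" "x \<in> K'"
  shows "K = K'"
proof (rule ccontr)
  assume ne: "K \<noteq> K'"
  have "x \<in> K" using x interior_subset by blast
  then have "K \<subseteq> K \<inter> K'"
    using subset_of_face_of[OF conforming[OF K] subset_refl] x rel_interior_T[OF K(1)] by blast
  then have "K \<inter> K' = K" by blast
  then have "K face_of K'" using conforming[OF K(2,1)] by (simp add: Int_commute)
  then show False using face_of_aff_dim_lt[OF convex_T[OF K(2)], of K] ne aff_dim_T[OF K(1)] aff_dim_T[OF K(2)] by linarith
qed

lemma negligible_frontier_T: "K \<in> \<T> \<Longrightarrow> negligible (frontier K)"
  by (rule negligible_convex_frontier[OF convex_T])

lemma negligible_frontier_dom: "negligible (frontier \<Omega>)"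
proof -
  obtain F where F: "finite F" "\<And>P. P \<in> F \<Longrightarrow> polytope P \<and> aff_dim P = int CARD('n) - 1" "frontier \<Omega> = \<Union>F"
    using dom by (auto simp: polytopal_domain_def)
  have "negligible P" if "P \<in> F" for P
  proof -
    have "affine hull P \<noteq> UNIV" using F(2)[OF that] aff_dim_eq_full[of P] by auto
    then have "interior P = {}" using affine_hull_nonempty_interior by blast
    then show ?thesis using negligible_convex_interior[of P] F(2)[OF that] polytope_imp_convex by blast
  qed
  then show ?thesis using F by (simp add: negligible_Union)
qed

lemma AE_generic:
  "AE x in lebesgue. (\<forall>K\<in>\<T>. x \<in> K \<longrightarrow> x \<in> interior K) \<and> x \<notin> frontier \<Omega>"
proof -
  have "AE x in lebesgue. \<forall>K\<in>\<T>. x \<notin> frontier K"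
    by (rule AE_finite_allI[OF finite_T]) (intro negligible_AE negligible_frontier_T)
  moreover have "AE x in lebesgue. x \<notin> frontier \<Omega>" by (rule negligible_AE[OF negligible_frontier_dom])
  ultimately show ?thesis
    by eventually_elim (use closure_subset in \<open>fastforce simp: frontier_def\<close>)
qed

lemma AE_interior: "K \<in> \<T> \<Longrightarrow> AE x in lebesgue_on K. x \<in> interior K"
  unfolding AE_lebesgue_on_iff[OF sets_T] using AE_generic by eventually_elim auto

lemma sum_indicator:
  assumes "\<forall>K\<in>\<T>. x \<in> K \<longrightarrow> x \<in> interior K" "x \<notin> frontier \<Omega>"
  shows "(\<Sum>K\<in>\<T>. indicator K x) = (indicator \<Omega> x :: real)"
proof (cases "x \<in> \<Omega>")
  case True
  then obtain K where K: "K \<in> \<T>" "x \<in> K" using Union_T closure_subset by blast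
  have "x \<in> K' \<longleftrightarrow> K' = K" if "K' \<in> \<T>" for K' using elements_disjoint assms(1) K that by metis
  then have "(\<Sum>K\<in>\<T>. indicator K x) = (\<Sum>K'\<in>\<T>. if K' = K then 1 else 0 :: real)"
    by (intro sum.cong) (auto simp: indicator_def)
  then show ?thesis using True K finite_T by simp
next
  case False
  then have "x \<notin> closure \<Omega>" using assms(2) open_dom by (simp add: frontier_def interior_open)
  then have "x \<notin> K" if "K \<in> \<T>" for K using Union_T that by blast
  then show ?thesis using False by simp
qed

lemma AE_dom_iff: "(AE x in lebesgue_on \<Omega>. P x) \<longleftrightarrow> (\<forall>K\<in>\<T>. AE x in lebesgue_on K. P x)"
proof
  assume "AE x in lebesgue_on \<Omega>. P x"
  then have "AE x in lebesgue. x \<in> \<Omega> \<longrightarrow> P x" by (simp add: AE_lebesgue_on_iff sets_dom)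
  with AE_generic have *: "AE x in lebesgue. \<forall>K\<in>\<T>. x \<in> K \<longrightarrow> P x"
  proof eventually_elim
    case (elim x)
    show ?case
    proof (intro ballI impI)
      fix K assume "K \<in> \<T>" "x \<in> K"
      then have "x \<in> closure \<Omega>" using Union_T by blast
      then show "P x" using elim open_dom by (simp add: frontier_def interior_open)
    qed
  qed
  show "\<forall>K\<in>\<T>. AE x in lebesgue_on K. P x"
  proof
    fix K assume K: "K \<in> \<T>"
    show "AE x in lebesgue_on K. P x"
      unfolding AE_lebesgue_on_iff[OF sets_T[OF K]] using *
      by eventually_elim (use K in blast)
  qed
next
  assume "\<forall>K\<in>\<T>. AE x in lebesgue_on K. P x"
  then have "AE x in lebesgue. \<forall>K\<in>\<T>. x \<in> K \<longrightarrow> P x"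
    by (intro AE_finite_allI[OF finite_T]) (simp add: AE_lebesgue_on_iff sets_T)
  then show "AE x in lebesgue_on \<Omega>. P x"
    unfolding AE_lebesgue_on_iff[OF sets_dom]
    by eventually_elim (use Union_T closure_subset in blast)
qed

lemma integral_dom:
  fixes f :: "real^'n \<Rightarrow> real"
  assumes f: "\<And>K. K \<in> \<T> \<Longrightarrow> integrable (lebesgue_on K) f"
  shows "integrable (lebesgue_on \<Omega>) f" "integral\<^sup>L (lebesgue_on \<Omega>) f = (\<Sum>K\<in>\<T>. integral\<^sup>L (lebesgue_on K) f)"
proof -
  have i: "integrable lebesgue (\<lambda>x. indicator K x * f x)" if "K \<in> \<T>" for K
    using f[OF that] sets_T[OF that] by (simp add: integrable_restrict_space)
  then have s: "integrable lebesgue (\<lambda>x. \<Sum>K\<in>\<T>. indicator K x * f x)" by (rule Bochner_Integration.integrable_sum)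
  have ae: "AE x in lebesgue. (\<Sum>K\<in>\<T>. indicator K x * f x) = indicator \<Omega> x * f x"
    using AE_generic by eventually_elim (simp add: sum_indicator flip: sum_distrib_right)
  have m: "(\<lambda>x. indicator \<Omega> x * f x) \<in> borel_measurable lebesgue"
    by (rule borel_measurable_AE[OF _ ae]) (use s in auto)
  have "integrable lebesgue (\<lambda>x. indicator \<Omega> x * f x)"
    by (rule integrable_cong_AE_imp[OF s m]) (use ae in auto)
  then show "integrable (lebesgue_on \<Omega>) f" using sets_dom by (simp add: integrable_restrict_space)
  have "integral\<^sup>L (lebesgue_on \<Omega>) f = (\<integral>x. indicator \<Omega> x * f x \<partial>lebesgue)"
    using sets_dom by (simp add: integral_restrict_space)
  also have "\<dots> = (\<integral>x. (\<Sum>K\<in>\<T>. indicator K x * f x) \<partial>lebesgue)"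
    by (rule integral_cong_AE) (use m s ae in auto)
  also have "\<dots> = (\<Sum>K\<in>\<T>. \<integral>x. indicator K x * f x \<partial>lebesgue)"
    using i by (rule Bochner_Integration.integral_sum)
  also have "\<dots> = (\<Sum>K\<in>\<T>. integral\<^sup>L (lebesgue_on K) f)"
    using sets_T by (intro sum.cong) (auto simp: integral_restrict_space)
  finally show "integral\<^sup>L (lebesgue_on \<Omega>) f = (\<Sum>K\<in>\<T>. integral\<^sup>L (lebesgue_on K) f)" .
qed

lemma integrable_on_T:
  fixes f :: "real^'n \<Rightarrow> real"
  assumes f: "integrable (lebesgue_on \<Omega>) f" and K: "K \<in> \<T>"
  shows "integrable (lebesgue_on K) f"
proof -
  have "integrable lebesgue (\<lambda>x. indicator \<Omega> x * f x)"
    using f sets_dom by (simp add: integrable_restrict_space)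
  from integrable_mult_indicator[OF sets_T[OF K] this]
  have i: "integrable lebesgue (\<lambda>x. indicator K x * (indicator \<Omega> x * f x))" by simp
  have ae: "AE x in lebesgue. indicator K x * (indicator \<Omega> x * f x) = indicator K x * f x"
    using AE_generic
  proof eventually_elim
    case (elim x)
    have "x \<in> K \<Longrightarrow> x \<in> \<Omega>" using elim K Union_T open_dom by (auto simp: frontier_def interior_open)
    then show ?case by (auto simp: indicator_def)
  qed
  have m: "(\<lambda>x. indicator K x * f x) \<in> borel_measurable lebesgue"
    by (rule borel_measurable_AE[OF _ ae]) (use i in auto)
  have "integrable lebesgue (\<lambda>x. indicator K x * f x)"
    by (rule integrable_cong_AE_imp[OF i m]) (use ae in auto)
  then show ?thesis using sets_T[OF K] by (simp add: integrable_restrict_space)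
qed

lemma mesh_faces_eq: "mesh_faces \<T> = (\<Union>K\<in>\<T>. facets K)"
  by (auto simp: mesh_faces_def facets_def)

lemma finite_mesh_faces: "finite (mesh_faces \<T>)"
  unfolding mesh_faces_eq using finite_T by (rule finite_UN_I) (rule finite_facets[OF simplex_T])

lemma facet_subset: "E \<in> facets K \<Longrightarrow> E \<subseteq> K"
  by (simp add: facets_def facet_of_imp_subset)

lemma aff_dim_facet: "K \<in> \<T> \<Longrightarrow> E \<in> facets K \<Longrightarrow> aff_dim E = int CARD('n) - 1"
  using aff_dim_T[of K] by (simp add: facets_def facet_of_def)

text \<open>The common face \<open>K \<inter> K'\<close> is a proper face of \<open>K\<close> and contains a facet, so there is no dimension left between
  the two.\<close>

lemma intersection_eq_facet:
  assumes K: "K \<in> \<T>" "K' \<in> \<T>" "K \<noteq> K'" and E: "E \<in> facets K" "E \<subseteq> K'"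
  shows "K \<inter> K' = E" "E \<in> facets K'"
proof -
  have Ef: "E face_of K" using E by (simp add: facets_def facet_of_imp_face_of)
  have ne: "K \<inter> K' \<noteq> K"
  proof
    assume "K \<inter> K' = K"
    obtain x where "x \<in> interior K" using interior_T[OF K(1)] by blast
    then have "x \<in> K'" using \<open>K \<inter> K' = K\<close> interior_subset by blast
    then show False using elements_disjoint[OF K(1,2) \<open>x \<in> interior K\<close>] K(3) by blast
  qed
  have lt: "aff_dim (K \<inter> K') < int CARD('n)"
    using face_of_aff_dim_lt[OF convex_T[OF K(1)] conforming[OF K(1,2)] ne] aff_dim_T[OF K(1)] by simp
  have "E face_of (K \<inter> K')"
    by (rule face_of_subset[OF Ef]) (use E facet_subset[OF E(1)] in auto)
  then have "E = K \<inter> K'"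
    using face_of_aff_dim_lt[OF convex_Int[OF convex_T[OF K(1)] convex_T[OF K(2)]], of E] lt aff_dim_facet[OF K(1) E(1)]
    by linarith
  then show eq: "K \<inter> K' = E" by simp
  have "E face_of K'" using conforming[OF K(2,1)] eq by (simp add: Int_commute)
  moreover have "E \<noteq> {}" using E by (auto simp: facets_def facet_of_def)
  ultimately show "E \<in> facets K'"
    using aff_dim_facet[OF K(1) E(1)] aff_dim_T[OF K(2)] by (simp add: facets_def facet_of_def)
qed

text \<open>With equal normals the points slightly below the relative interior of \<open>E\<close> would belong to both elements,
  but \<open>K \<inter> K' = E\<close>.\<close>

lemma opposite_normals:
  assumes K: "K \<in> \<T>" "K' \<in> \<T>" "K \<noteq> K'" and E: "E \<in> facets K" "E \<in> facets K'"
  shows "outward_normal K' E = - outward_normal K E"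
proof -
  obtain b where b: "pyramid E (apex K E) (outward_normal K E) b (height K E)" "pyramid.K E (apex K E) = K"
    by (rule facet_pyramid[OF simplex_T[OF K(1)] E(1)])
  obtain b' where b': "pyramid E (apex K' E) (outward_normal K' E) b' (height K' E)" "pyramid.K E (apex K' E) = K'"
    by (rule facet_pyramid[OF simplex_T[OF K(2)] E(2)])
  interpret c: pyramid E "apex K E" "outward_normal K E" b "height K E" by (rule b(1))
  interpret c': pyramid E "apex K' E" "outward_normal K' E" b' "height K' E" by (rule b'(1))
  have "outward_normal K' E \<noteq> outward_normal K E"
  proof
    assume eq: "outward_normal K' E = outward_normal K E"
    obtain y where y: "y \<in> rel_interior E" using c.F(2,3) rel_interior_eq_empty by blast
    obtain d1 where d1: "d1 > 0" "\<And>d. 0 \<le> d \<Longrightarrow> d < d1 \<Longrightarrow> y - d *\<^sub>R outward_normal K E \<in> K"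
      using c.near_face_in[OF y] b(2) by auto
    obtain d2 where d2: "d2 > 0" "\<And>d. 0 \<le> d \<Longrightarrow> d < d2 \<Longrightarrow> y - d *\<^sub>R outward_normal K E \<in> K'"
      using c'.near_face_in[OF y] b'(2) eq by auto
    define d where "d = min d1 d2 / 2"
    have d: "d > 0" "d < d1" "d < d2" using d1 d2 by (auto simp: d_def)
    have "y - d *\<^sub>R outward_normal K E \<in> E"
      using intersection_eq_facet(1)[OF K E(1) facet_subset[OF E(2)]] d1(2)[of d] d2(2)[of d] d by auto
    moreover have "y \<in> E" using y rel_interior_subset by blast
    ultimately show False using c.F_hyp[of y] c.F_hyp[of "y - d *\<^sub>R outward_normal K E"] d c.nn
      by (simp add: inner_diff_right)
  qed
  then show ?thesis
    using unit_normals_of_hyperplane[OF c.\<nu> c'.\<nu>] c.aff c'.aff by metis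
qed

lemma convex_facet: "K \<in> \<T> \<Longrightarrow> E \<in> facets K \<Longrightarrow> convex E \<and> closed E \<and> E \<noteq> {}"
  by (metis pyramid.F compact_imp_closed facet_pyramid simplex_T)

lemma interior_face_point:
  assumes E: "E \<in> interior_faces \<Omega> \<T>"
  obtains y where "y \<in> rel_interior E" "y \<in> \<Omega>"
proof -
  have E': "E \<in> mesh_faces \<T>" "\<not> E \<subseteq> frontier \<Omega>"
    using E by (auto simp: interior_faces_def boundary_faces_def)
  then obtain K where K: "K \<in> \<T>" "E \<in> facets K" by (auto simp: mesh_faces_eq)
  obtain z where z: "z \<in> E" "z \<notin> frontier \<Omega>" using E' by blast
  have "z \<in> closure \<Omega>" using z K facet_subset Union_T by blast
  then have "z \<in> \<Omega>" using z open_dom by (simp add: frontier_def interior_open)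
  moreover have "z \<in> closure (rel_interior E)"
    using convex_closure_rel_interior[of E] convex_facet[OF K] z by simp
  ultimately have "\<Omega> \<inter> rel_interior E \<noteq> {}"
    using open_Int_closure_eq_empty[OF open_dom] by blast
  then show thesis using that by blast
qed

text \<open>Near a relative interior point \<open>y\<close> of \<open>E\<close> in \<open>\<Omega>\<close> only elements containing \<open>y\<close> occur. A point slightly beyond \<open>E\<close>,
  on the side away from \<open>K\<close>, lies in such an element \<open>K'\<close>; conformity then makes \<open>E\<close> a facet of \<open>K'\<close>.\<close>

lemma facet_neighbour:
  assumes E: "E \<in> interior_faces \<Omega> \<T>" and K: "K \<in> \<T>" "E \<in> facets K"
  obtains K' where "K' \<in> \<T>" "K' \<noteq> K" "E \<in> facets K'"
proof -
  obtain y where y: "y \<in> rel_interior E" "y \<in> \<Omega>" by (rule interior_face_point[OF E])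
  obtain b where "pyramid E (apex K E) (outward_normal K E) b (height K E)" and Kb: "K \<subseteq> {x. outward_normal K E \<bullet> x \<le> b}"
    by (rule facet_pyramid[OF simplex_T[OF K(1)] K(2)])
  then interpret pyramid E "apex K E" "outward_normal K E" b "height K E" by simp
  have yE: "y \<in> E" using y rel_interior_subset by blast
  have "closed (\<Union>{K'\<in>\<T>. y \<notin> K'})"
    using finite_T compact_T compact_imp_closed by (intro closed_Union) auto
  then have "open (\<Omega> - \<Union>{K'\<in>\<T>. y \<notin> K'})" using open_dom by (rule open_Diff[rotated])
  moreover have "y \<in> \<Omega> - \<Union>{K'\<in>\<T>. y \<notin> K'}" using y by auto
  ultimately obtain r where r: "r > 0" "ball y r \<subseteq> \<Omega> - \<Union>{K'\<in>\<T>. y \<notin> K'}"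
    by (meson openE)
  let ?z = "y + (r/2) *\<^sub>R outward_normal K E"
  have "?z \<in> ball y r" using r(1) \<nu> by (simp add: dist_norm)
  then have z: "?z \<in> \<Omega>" "?z \<notin> \<Union>{K'\<in>\<T>. y \<notin> K'}" using r(2) by blast+
  then obtain K' where K': "K' \<in> \<T>" "?z \<in> K'" using Union_T closure_subset by blast
  then have yK': "y \<in> K'" using z(2) by blast
  have "outward_normal K E \<bullet> ?z > b" using F_hyp[OF yE] nn r(1) by (simp add: inner_add_right)
  then have ne: "K' \<noteq> K" using Kb K'(2) by force
  have "E \<subseteq> K \<inter> K'"
    using subset_of_face_of[OF conforming[OF K(1) K'(1)] facet_subset[OF K(2)]] y yE yK' facet_subset[OF K(2)] by blast
  then have "E \<in> facets K'" using intersection_eq_facet(2)[OF K(1) K'(1) _ K(2)] ne by blast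
  with K'(1) ne show thesis by (rule that)
qed

text \<open>There is no third element: its normal would be opposite to two vectors that are opposite to each other.\<close>

lemma interior_face_elements:
  assumes E: "E \<in> interior_faces \<Omega> \<T>"
  obtains K K' where "K \<in> \<T>" "K' \<in> \<T>" "K \<noteq> K'" "E \<in> facets K" "E \<in> facets K'"
    "{K \<in> \<T>. E \<in> facets K} = {K, K'}"
proof -
  have "E \<in> mesh_faces \<T>" using E by (simp add: interior_faces_def)
  then obtain K where K: "K \<in> \<T>" "E \<in> facets K" by (auto simp: mesh_faces_eq)
  obtain K' where K': "K' \<in> \<T>" "K' \<noteq> K" "E \<in> facets K'" by (rule facet_neighbour[OF E K])
  have "L = K \<or> L = K'" if L: "L \<in> \<T>" "E \<in> facets L" for L
  proof (rule ccontr)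
    assume *: "\<not> (L = K \<or> L = K')"
    have "outward_normal K' E = - outward_normal K E" "outward_normal L E = - outward_normal K E"
      "outward_normal L E = - outward_normal K' E"
      using K K' L * by (auto intro!: opposite_normals)
    then have "outward_normal K E + outward_normal K E = 0" by simp
    then have "outward_normal K E = 0" by (simp flip: scaleR_2)
    moreover obtain b where "pyramid E (apex K E) (outward_normal K E) b (height K E)"
      by (rule facet_pyramid[OF simplex_T[OF K(1)] K(2)])
    then have "norm (outward_normal K E) = 1" by (rule pyramid.\<nu>)
    ultimately show False by simp
  qed
  then have "{K \<in> \<T>. E \<in> facets K} = {K, K'}" using K K' by blast
  with K K' show thesis using that by metis
qed

lemma face_through_rel_interior:
  assumes E: "E \<in> mesh_faces \<T>" "E' \<in> mesh_faces \<T>" and y: "y \<in> rel_interior E" "y \<in> E'"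
  shows "E' = E"
proof -
  obtain K where K: "K \<in> \<T>" "E \<in> facets K" using E by (auto simp: mesh_faces_eq)
  obtain K' where K': "K' \<in> \<T>" "E' \<in> facets K'" using E by (auto simp: mesh_faces_eq)
  have yE: "y \<in> E" using y rel_interior_subset by blast
  have EK': "E \<in> facets K'"
  proof (cases "K = K'")
    case False
    have "E \<subseteq> K \<inter> K'"
      using subset_of_face_of[OF conforming[OF K(1) K'(1)] facet_subset[OF K(2)]] y yE
        facet_subset[OF K(2)] facet_subset[OF K'(2)] by blast
    then show ?thesis using intersection_eq_facet(2)[OF K(1) K'(1) False K(2)] by blast
  qed (use K in simp)
  have f: "E face_of K'" "E' face_of K'" using EK' K' by (auto simp: facets_def facet_of_imp_face_of)
  have "E \<subseteq> E'" using subset_of_face_of[OF f(2) facet_subset[OF EK']] y by blast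
  then have "E face_of E'" by (rule face_of_subset[OF f(1)]) (rule facet_subset[OF K'(2)])
  then show ?thesis
    using face_of_aff_dim_lt[of E' E] convex_facet[OF K'] aff_dim_facet[OF K'] aff_dim_facet[OF K] by auto
qed

text \<open>The outward normal component on \<open>E\<close> of the field \<open>a K + c K x\<close>. It is constant on \<open>E\<close> (\<open>flux_eq\<close>), so
  one point of \<open>E\<close> represents it.\<close>

definition flux :: "((real^'n) set \<Rightarrow> real^'n) \<Rightarrow> ((real^'n) set \<Rightarrow> real) \<Rightarrow> (real^'n) set \<Rightarrow> (real^'n) set \<Rightarrow> real" where
  "flux a c E K = (a K + c K *\<^sub>R (SOME y. y \<in> E)) \<bullet> outward_normal K E"

lemma flux_eq:
  assumes K: "K \<in> \<T>" "E \<in> facets K" and x: "x \<in> E"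
  shows "(a K + c K *\<^sub>R x) \<bullet> outward_normal K E = flux a c E K"
proof -
  obtain b where "pyramid E (apex K E) (outward_normal K E) b (height K E)"
    by (rule facet_pyramid[OF simplex_T[OF K(1)] K(2)])
  then interpret pyramid E "apex K E" "outward_normal K E" b "height K E" .
  have "(SOME y. y \<in> E) \<in> E" using x by (rule someI)
  then show ?thesis using F_hyp[OF x] F_hyp
    by (simp add: flux_def inner_add_right inner_commute[of _ "outward_normal K E"])
qed

text \<open>Continuity of the normal component is a vanishing sum because the outward normals of the two
  neighbours are opposite.\<close>

definition normal_continuous :: "((real^'n) set \<Rightarrow> real^'n) \<Rightarrow> ((real^'n) set \<Rightarrow> real) \<Rightarrow> bool" where
  "normal_continuous a c \<longleftrightarrow>
     (\<forall>E\<in>interior_faces \<Omega> \<T>. (\<Sum>K\<in>{K\<in>\<T>. E \<in> facets K}. flux a c E K) = 0)"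

lemma sum_over_faces:
  "(\<Sum>K\<in>\<T>. \<Sum>E\<in>facets K. X E K) = (\<Sum>E\<in>mesh_faces \<T>. \<Sum>K\<in>{K\<in>\<T>. E \<in> facets K}. (X E K :: real))"
proof -
  have "(\<Sum>K\<in>\<T>. \<Sum>E\<in>facets K. X E K) = (\<Sum>K\<in>\<T>. \<Sum>E\<in>{E \<in> mesh_faces \<T>. E \<in> facets K}. X E K)"
    by (intro sum.cong) (auto simp: mesh_faces_eq)
  then show ?thesis using sum.swap_restrict[OF finite_T finite_mesh_faces] by simp
qed

theorem green_mesh:
  assumes \<phi>: "\<And>K x. K \<in> \<T> \<Longrightarrow> GDERIV (\<phi> K) x :> g K x" and g: "\<And>K. K \<in> \<T> \<Longrightarrow> continuous_on UNIV (g K)"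
  shows "(\<Sum>K\<in>\<T>. integral\<^sup>L (lebesgue_on K) (\<lambda>x. (a K + c K *\<^sub>R x) \<bullet> g K x + real CARD('n) * c K * \<phi> K x))
    = (\<Sum>E\<in>mesh_faces \<T>. \<Sum>K\<in>{K\<in>\<T>. E \<in> facets K}. flux a c E K * face_integral E (\<phi> K))"
proof -
  have "integral\<^sup>L (lebesgue_on K) (\<lambda>x. (a K + c K *\<^sub>R x) \<bullet> g K x + real CARD('n) * c K * \<phi> K x)
     = (\<Sum>E\<in>facets K. flux a c E K * face_integral E (\<phi> K))" if K: "K \<in> \<T>" for K
    unfolding green_simplex[OF simplex_T[OF K] \<phi>[OF K] g[OF K]] face_integral_cmult[symmetric]
    by (intro sum.cong refl face_integral_cong) (simp add: flux_eq[OF K])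
  then show ?thesis by (simp add: sum_over_faces)
qed

text \<open>On an interior face the two fluxes cancel because the functions have the same integral there; on a boundary face
  every integral is zero on its own.\<close>

theorem integration_by_parts:
  assumes \<phi>: "\<And>K x. K \<in> \<T> \<Longrightarrow> GDERIV (\<phi> K) x :> g K x" and g: "\<And>K. K \<in> \<T> \<Longrightarrow> continuous_on UNIV (g K)"
    and nc: "normal_continuous a c"
    and int: "\<And>E K K'. E \<in> interior_faces \<Omega> \<T> \<Longrightarrow> K \<in> \<T> \<Longrightarrow> K' \<in> \<T> \<Longrightarrow> K \<noteq> K' \<Longrightarrow> E \<in> facets K \<Longrightarrow> E \<in> facets K'
       \<Longrightarrow> face_integral E (\<phi> K) = face_integral E (\<phi> K')"
    and bd: "\<And>E K. E \<in> boundary_faces \<Omega> \<T> \<Longrightarrow> K \<in> \<T> \<Longrightarrow> E \<in> facets K \<Longrightarrow> face_integral E (\<phi> K) = 0"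
  shows "(\<Sum>K\<in>\<T>. integral\<^sup>L (lebesgue_on K) (\<lambda>x. (a K + c K *\<^sub>R x) \<bullet> g K x + real CARD('n) * c K * \<phi> K x)) = 0"
proof -
  have "(\<Sum>K\<in>{K\<in>\<T>. E \<in> facets K}. flux a c E K * face_integral E (\<phi> K)) = 0" if E: "E \<in> mesh_faces \<T>" for E
  proof (cases "E \<in> boundary_faces \<Omega> \<T>")
    case True
    then show ?thesis by (intro sum.neutral) (auto simp: bd)
  next
    case False
    then have E': "E \<in> interior_faces \<Omega> \<T>" using E by (simp add: interior_faces_def)
    obtain K K' where K: "K \<in> \<T>" "K' \<in> \<T>" "K \<noteq> K'" "E \<in> facets K" "E \<in> facets K'"
      "{K \<in> \<T>. E \<in> facets K} = {K, K'}"
      by (rule interior_face_elements[OF E'])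
    have "(\<Sum>K\<in>{K\<in>\<T>. E \<in> facets K}. flux a c E K) = 0"
      using nc E' unfolding normal_continuous_def by blast
    then have "flux a c E K + flux a c E K' = 0"
      unfolding K(6) using K(3) by simp
    then show ?thesis unfolding K(6) using K int[OF E' K(1-5)]
      by (simp flip: distrib_right)
  qed
  then have "(\<Sum>E\<in>mesh_faces \<T>. \<Sum>K\<in>{K\<in>\<T>. E \<in> facets K}. flux a c E K * face_integral E (\<phi> K)) = 0"
    by (intro sum.neutral) auto
  moreover note green_mesh[of \<phi> g a c, OF \<phi> g]
  ultimately show ?thesis by (simp only:)
qed

end

section \<open>Piecewise functions and their elementwise data\<close>

definition quad :: "real \<Rightarrow> real^'n \<Rightarrow> real \<Rightarrow> real^'n \<Rightarrow> real" where
  "quad \<alpha> \<beta> \<gamma> x = \<alpha> + \<beta> \<bullet> x + \<gamma> * (x \<bullet> x)"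

lemma GDERIV_quad: "GDERIV (quad \<alpha> \<beta> \<gamma>) x :> \<beta> + (2 * \<gamma>) *\<^sub>R x"
  unfolding gderiv_def quad_def
  by (auto intro!: derivative_eq_intros simp: inner_add_right inner_commute algebra_simps)

lemma continuous_on_quad: "continuous_on S (quad \<alpha> \<beta> \<gamma>)"
  unfolding quad_def by (intro continuous_intros)

lemma AE_lebesgue_on_mem: "AE x in lebesgue_on K. x \<in> K"
  using AE_space[of "lebesgue_on K"] by eventually_elim (simp add: space_restrict_space)

lemma restricts_to_ECR_iff:
  "restricts_to v K (ECR K) \<longleftrightarrow> (\<exists>\<alpha> \<beta> \<gamma>. AE x in lebesgue_on K. v x = quad \<alpha> \<beta> \<gamma> x)"
proof
  assume "restricts_to v K (ECR K)"
  then obtain p \<gamma> where p: "p \<in> P1 K" "AE x in lebesgue_on K. v x = p x + \<gamma> * (\<Sum>i\<in>UNIV. (x $ i)\<^sup>2)"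
    unfolding restricts_to_def ECR_def by auto
  then obtain \<alpha> \<beta> where ab: "\<And>x. x \<in> K \<Longrightarrow> p x = \<alpha> + (\<Sum>i\<in>UNIV. \<beta> i * x $ i)" by (auto simp: P1_def)
  have "AE x in lebesgue_on K. v x = quad \<alpha> (\<chi> i. \<beta> i) \<gamma> x"
    using p(2) AE_lebesgue_on_mem
    by eventually_elim (simp add: quad_def ab inner_vec_def power2_eq_square)
  then show "\<exists>\<alpha> \<beta> \<gamma>. AE x in lebesgue_on K. v x = quad \<alpha> \<beta> \<gamma> x" by blast
next
  assume "\<exists>\<alpha> \<beta> \<gamma>. AE x in lebesgue_on K. v x = quad \<alpha> \<beta> \<gamma> x"
  then obtain \<alpha> \<beta> \<gamma> where q: "AE x in lebesgue_on K. v x = quad \<alpha> \<beta> \<gamma> x" by blast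
  have "quad \<alpha> \<beta> \<gamma> = (\<lambda>x. (\<alpha> + (\<Sum>i\<in>UNIV. \<beta> $ i * x $ i)) + \<gamma> * (\<Sum>i\<in>UNIV. (x $ i)\<^sup>2))"
    by (auto simp: quad_def inner_vec_def power2_eq_square)
  moreover have "(\<lambda>x. \<alpha> + (\<Sum>i\<in>UNIV. \<beta> $ i * x $ i)) \<in> P1 K" by (auto simp: P1_def)
  ultimately have "quad \<alpha> \<beta> \<gamma> \<in> ECR K" unfolding ECR_def mem_Collect_eq
    by (intro exI[of _ "\<lambda>x. \<alpha> + (\<Sum>i\<in>UNIV. \<beta> $ i * x $ i)"] exI[of _ \<gamma>] conjI)
  then show "restricts_to v K (ECR K)" unfolding restricts_to_def
    by (rule bexI[where x="quad \<alpha> \<beta> \<gamma>", rotated]) (rule q)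
qed

lemma restricts_to_RT_iff:
  "restricts_to \<tau> K (RT_elem K) \<longleftrightarrow> (\<exists>a c. AE x in lebesgue_on K. \<tau> x = a + c *\<^sub>R x)"
proof
  assume "restricts_to \<tau> K (RT_elem K)"
  then obtain a c where ac: "\<And>i. a i \<in> P0 K" "c \<in> P0 K" "AE x in lebesgue_on K. \<tau> x = (\<chi> i. a i x) + c x *\<^sub>R x"
    unfolding restricts_to_def RT_elem_def by auto
  have "\<forall>i. \<exists>b. \<forall>x\<in>K. a i x = b" using ac(1) by (simp add: P0_def)
  then obtain b where b: "\<And>i x. x \<in> K \<Longrightarrow> a i x = b i" by metis
  obtain d where d: "\<And>x. x \<in> K \<Longrightarrow> c x = d" using ac(2) by (auto simp: P0_def)
  have "AE x in lebesgue_on K. \<tau> x = (\<chi> i. b i) + d *\<^sub>R x"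
    using ac(3) AE_lebesgue_on_mem by eventually_elim (simp add: b d)
  then show "\<exists>a c. AE x in lebesgue_on K. \<tau> x = a + c *\<^sub>R x" by blast
next
  assume "\<exists>a c. AE x in lebesgue_on K. \<tau> x = a + c *\<^sub>R x"
  then obtain a c where ac: "AE x in lebesgue_on K. \<tau> x = a + c *\<^sub>R x" by blast
  have "(\<lambda>x. a + c *\<^sub>R x) \<in> RT_elem K" unfolding RT_elem_def mem_Collect_eq
    by (intro exI[of _ "\<lambda>i x. a $ i"] exI[of _ "\<lambda>x. c"] conjI) (auto simp: P0_def vec_lambda_eta)
  then show "restricts_to \<tau> K (RT_elem K)" unfolding restricts_to_def
    by (rule bexI[where x="\<lambda>x. a + c *\<^sub>R x", rotated]) (rule ac)
qed

lemma restricts_to_P0_iff: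
  "restricts_to v K (P0 K) \<longleftrightarrow> (\<exists>c. AE x in lebesgue_on K. v x = c)"
proof
  assume "restricts_to v K (P0 K)"
  then obtain p c where "AE x in lebesgue_on K. v x = p x" "\<And>x. x \<in> K \<Longrightarrow> p x = c"
    unfolding restricts_to_def P0_def by auto
  then have "AE x in lebesgue_on K. v x = c" using AE_lebesgue_on_mem[of K] by (auto elim: AE_mp)
  then show "\<exists>c. AE x in lebesgue_on K. v x = c" by blast
next
  assume "\<exists>c. AE x in lebesgue_on K. v x = c"
  then show "restricts_to v K (P0 K)" unfolding restricts_to_def P0_def by auto
qed

lemma integrable_cong_AE_lebesgue_on:
  fixes f g :: "'a::euclidean_space \<Rightarrow> real"
  assumes S: "S \<in> sets lebesgue" and f: "integrable (lebesgue_on S) f"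
    and fg: "AE x in lebesgue_on S. f x = g x"
  shows "integrable (lebesgue_on S) g" "integral\<^sup>L (lebesgue_on S) f = integral\<^sup>L (lebesgue_on S) g"
proof -
  have i: "integrable lebesgue (\<lambda>x. indicator S x * f x)"
    using f S by (simp add: integrable_restrict_space)
  have ae: "AE x in lebesgue. indicator S x * f x = indicator S x * g x"
    using fg[unfolded AE_lebesgue_on_iff[OF S]] by eventually_elim (auto simp: indicator_def)
  have m: "(\<lambda>x. indicator S x * g x) \<in> borel_measurable lebesgue"
    by (rule borel_measurable_AE[OF _ ae]) (use i in auto)
  have "integrable lebesgue (\<lambda>x. indicator S x * g x)"
    by (rule integrable_cong_AE_imp[OF i m]) (use ae in auto)
  then show g: "integrable (lebesgue_on S) g" using S by (simp add: integrable_restrict_space)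
  show "integral\<^sup>L (lebesgue_on S) f = integral\<^sup>L (lebesgue_on S) g"
    by (rule integral_cong_AE) (use f g fg in auto)
qed

context mesh
begin

text \<open>Elementwise data are used in the interiors only, where the elements do not overlap.\<close>

definition glue :: "((real^'n) set \<Rightarrow> real^'n \<Rightarrow> 'b::real_vector) \<Rightarrow> real^'n \<Rightarrow> 'b" where
  "glue q x = (\<Sum>K\<in>\<T>. if x \<in> interior K then q K x else 0)"

lemma glue_interior:
  assumes "K \<in> \<T>" "x \<in> interior K"
  shows "glue q x = q K x"
proof -
  have "glue q x = (\<Sum>L\<in>\<T>. if L = K then q K x else 0)"
    unfolding glue_def
  proof (rule sum.cong)
    fix L assume "L \<in> \<T>"
    then have "x \<in> interior L \<longleftrightarrow> L = K"
      using elements_disjoint[OF assms(1) _ assms(2)] assms(2) subsetD[OF interior_subset] by metis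
    then show "(if x \<in> interior L then q L x else 0) = (if L = K then q K x else 0)" by simp
  qed simp
  then show ?thesis using finite_T assms by simp
qed

lemma AE_glue: "K \<in> \<T> \<Longrightarrow> AE x in lebesgue_on K. glue q x = q K x"
  using AE_interior by (rule eventually_mono) (auto intro: glue_interior)

lemma continuous_AE_unique:
  fixes g h :: "real^'n \<Rightarrow> real"
  assumes K: "K \<in> \<T>" and g: "continuous_on K g" and h: "continuous_on K h"
    and eq: "AE x in lebesgue_on K. g x = h x" and x: "x \<in> K"
  shows "g x = h x"
proof -
  let ?C = "K \<inter> (\<lambda>x. g x - h x) -` {0}"
  have C: "closed ?C"
    by (rule continuous_closed_preimage)
       (use g h compact_T[OF K] compact_imp_closed in \<open>auto intro: continuous_intros\<close>)
  have "AE x\<in>interior K in lebesgue. x \<in> ?C"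
    using eq[unfolded AE_lebesgue_on_iff[OF sets_T[OF K]]]
    by eventually_elim (use interior_subset in auto)
  then have "interior K \<subseteq> ?C" using mem_closed_if_AE_lebesgue_open[OF open_interior C] by blast
  then have "closure (interior K) \<subseteq> ?C" using C by (rule closure_minimal)
  then show ?thesis using x closure_interior_T[OF K] by auto
qed

lemma elem_rep_eq:
  assumes K: "K \<in> \<T>" and g: "continuous_on K g" and v: "AE x in lebesgue_on K. v x = g x" and x: "x \<in> K"
  shows "elem_rep v K x = g x"
proof -
  have "continuous_on K (elem_rep v K) \<and> (AE x in lebesgue_on K. v x = elem_rep v K x)"
    unfolding elem_rep_def by (rule someI[of _ g]) (use g v in simp)
  then have e: "continuous_on K (elem_rep v K)" "AE x in lebesgue_on K. v x = elem_rep v K x" by auto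
  have "AE x in lebesgue_on K. elem_rep v K x = g x"
    using e(2) v by eventually_elim simp
  from continuous_AE_unique[OF K e(1) g this x] show ?thesis .
qed

lemma nabla_NC_eq:
  assumes K: "K \<in> \<T>" and v: "AE x in lebesgue_on K. v x = quad \<alpha> \<beta> \<gamma> x" and x: "x \<in> interior K"
  shows "nabla_NC \<T> v x = \<beta> + (2 * \<gamma>) *\<^sub>R x"
proof -
  have "nabla_NC \<T> v x = grad (elem_rep v K) x"
    using glue_interior[OF K x, of "\<lambda>K. grad (elem_rep v K)"] by (simp add: glue_def nabla_NC_def)
  also have "\<dots> = \<beta> + (2 * \<gamma>) *\<^sub>R x"
  proof (rule grad_eqI)
    show "GDERIV (elem_rep v K) x :> \<beta> + (2 * \<gamma>) *\<^sub>R x"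
      unfolding gderiv_def
    proof (rule has_derivative_transform_within_open[OF _ open_interior x])
      show "(quad \<alpha> \<beta> \<gamma> has_derivative (\<lambda>h. h \<bullet> (\<beta> + (2 * \<gamma>) *\<^sub>R x))) (at x)"
        using GDERIV_quad[of \<alpha> \<beta> \<gamma> x] by (simp add: gderiv_def)
      show "quad \<alpha> \<beta> \<gamma> y = elem_rep v K y" if "y \<in> interior K" for y
        using elem_rep_eq[OF K continuous_on_quad v subsetD[OF interior_subset that]] by simp
    qed
  qed
  finally show ?thesis .
qed

lemma l2_inner_pieces:
  fixes v w :: "real^'n \<Rightarrow> 'b::euclidean_space"
  assumes v: "\<And>K. K \<in> \<T> \<Longrightarrow> AE x in lebesgue_on K. v x = v' K x" "\<And>K. K \<in> \<T> \<Longrightarrow> continuous_on K (v' K)"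
    and w: "\<And>K. K \<in> \<T> \<Longrightarrow> AE x in lebesgue_on K. w x = w' K x" "\<And>K. K \<in> \<T> \<Longrightarrow> continuous_on K (w' K)"
  shows "integrable (lebesgue_on \<Omega>) (\<lambda>x. v x \<bullet> w x)"
    "l2_inner \<Omega> v w = (\<Sum>K\<in>\<T>. integral\<^sup>L (lebesgue_on K) (\<lambda>x. v' K x \<bullet> w' K x))"
proof -
  have *: "integrable (lebesgue_on K) (\<lambda>x. v x \<bullet> w x) \<and>
      integral\<^sup>L (lebesgue_on K) (\<lambda>x. v' K x \<bullet> w' K x) = integral\<^sup>L (lebesgue_on K) (\<lambda>x. v x \<bullet> w x)"
    if K: "K \<in> \<T>" for K
  proof -
    have i: "integrable (lebesgue_on K) (\<lambda>x. v' K x \<bullet> w' K x)"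
      by (rule integral_lebesgue_on_compact(2)[OF compact_T[OF K]]) (intro continuous_intros v w K)
    have "AE x in lebesgue_on K. v' K x \<bullet> w' K x = v x \<bullet> w x"
      using v(1)[OF K] w(1)[OF K] by eventually_elim simp
    from integrable_cong_AE_lebesgue_on[OF sets_T[OF K] i this] show ?thesis by simp
  qed
  then show "integrable (lebesgue_on \<Omega>) (\<lambda>x. v x \<bullet> w x)" by (intro integral_dom) simp
  show "l2_inner \<Omega> v w = (\<Sum>K\<in>\<T>. integral\<^sup>L (lebesgue_on K) (\<lambda>x. v' K x \<bullet> w' K x))"
    unfolding l2_inner_def using * by (subst integral_dom) auto
qed

lemma L2_pieces:
  fixes v :: "real^'n \<Rightarrow> 'b::euclidean_space"
  assumes v: "\<And>K. K \<in> \<T> \<Longrightarrow> AE x in lebesgue_on K. v x = v' K x" "\<And>K. K \<in> \<T> \<Longrightarrow> continuous_on K (v' K)"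
  shows "v \<in> L2 \<Omega>"
proof -
  have m: "(\<lambda>x. \<Sum>K\<in>\<T>. indicator K x *\<^sub>R v' K x) \<in> borel_measurable lebesgue"
  proof (rule borel_measurable_sum)
    fix K assume K: "K \<in> \<T>"
    have "integrable lborel (\<lambda>x. indicator K x *\<^sub>R v' K x)"
      by (rule borel_integrable_compact[OF compact_T[OF K] v(2)[OF K]])
    then have "(\<lambda>x. indicator K x *\<^sub>R v' K x) \<in> borel_measurable lborel" by auto
    then show "(\<lambda>x. indicator K x *\<^sub>R v' K x) \<in> borel_measurable lebesgue" by (rule measurable_completion)
  qed
  have "AE x in lebesgue. \<forall>K\<in>\<T>. x \<in> K \<longrightarrow> v x = v' K x"
    using v(1) by (intro AE_finite_allI[OF finite_T]) (simp add: AE_lebesgue_on_iff sets_T)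
  with AE_generic have ae: "AE x in lebesgue. (\<Sum>K\<in>\<T>. indicator K x *\<^sub>R v' K x) = indicator \<Omega> x *\<^sub>R v x"
  proof eventually_elim
    case (elim x)
    have "(\<Sum>K\<in>\<T>. indicator K x *\<^sub>R v' K x) = (\<Sum>K\<in>\<T>. indicator K x *\<^sub>R v x)"
      by (rule sum.cong) (use elim in \<open>auto simp: indicator_def\<close>)
    then show ?case using elim sum_indicator[of x] by (simp flip: scaleR_sum_left)
  qed
  have "(\<lambda>x. indicator \<Omega> x *\<^sub>R v x) \<in> borel_measurable lebesgue"
    by (rule borel_measurable_AE[OF m ae])
  then have "v \<in> borel_measurable (lebesgue_on \<Omega>)"
    using sets_dom by (subst borel_measurable_restrict_space_iff) auto
  moreover have "integrable (lebesgue_on \<Omega>) (\<lambda>x. v x \<bullet> v x)"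
    by (rule l2_inner_pieces(1)[OF v v])
  ultimately show ?thesis by (simp add: L2_def power2_norm_eq_inner)
qed

lemma continuous_integrable_dom: "continuous_on UNIV \<phi> \<Longrightarrow> integrable (lebesgue_on \<Omega>) (\<phi> :: real^'n \<Rightarrow> real)"
  by (intro integral_dom integral_lebesgue_on_compact(2) compact_T) (auto intro: continuous_on_subset)

lemma L2_integrable:
  assumes "d \<in> L2 \<Omega>"
  shows "integrable (lebesgue_on \<Omega>) (d :: real^'n \<Rightarrow> real)"
proof -
  have d: "d \<in> borel_measurable (lebesgue_on \<Omega>)" "integrable (lebesgue_on \<Omega>) (\<lambda>x. (norm (d x))\<^sup>2)"
    using assms by (auto simp: L2_def)
  have "integrable (lebesgue_on \<Omega>) (\<lambda>x. 1 + (norm (d x))\<^sup>2)"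
    using d(2) continuous_integrable_dom[of "\<lambda>x. 1"] by simp
  then show ?thesis
  proof (rule Bochner_Integration.integrable_bound[OF _ d(1)], intro AE_I2)
    fix x
    have "0 \<le> (\<bar>d x\<bar> - 1)\<^sup>2" "0 \<le> (d x)\<^sup>2" by simp_all
    then have "2 * \<bar>d x\<bar> \<le> 1 + (d x)\<^sup>2 + (1 + (d x)\<^sup>2)" by (simp add: power2_diff)
    then show "norm (d x) \<le> norm (1 + (norm (d x))\<^sup>2)" by simp
  qed
qed

lemma dominated_limit_dom:
  fixes e :: "real^'n \<Rightarrow> real"
  assumes e: "integrable (lebesgue_on \<Omega>) e"
    and \<phi>: "\<And>k::nat. continuous_on UNIV (\<phi> k)" "\<And>k x. \<bar>\<phi> k x\<bar> \<le> 1"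
    and \<psi>: "\<psi> \<in> borel_measurable borel"
    and lim: "AE x in lebesgue_on \<Omega>. (\<lambda>k. \<phi> k x) \<longlonglongrightarrow> \<psi> x"
  shows "(\<lambda>k. integral\<^sup>L (lebesgue_on \<Omega>) (\<lambda>x. e x * \<phi> k x)) \<longlonglongrightarrow> integral\<^sup>L (lebesgue_on \<Omega>) (\<lambda>x. e x * \<psi> x)"
proof (rule integral_dominated_convergence[where w="\<lambda>x. \<bar>e x\<bar>"])
  have em: "e \<in> borel_measurable (lebesgue_on \<Omega>)" using e by auto
  have bm: "g \<in> borel_measurable (lebesgue_on \<Omega>)" if "g \<in> borel_measurable borel" for g :: "real^'n \<Rightarrow> real"
    using that by (intro measurable_restrict_space1 measurable_completion) simp
  show "(\<lambda>x. e x * \<psi> x) \<in> borel_measurable (lebesgue_on \<Omega>)"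
    using em bm[OF \<psi>] by (rule borel_measurable_times)
  show "(\<lambda>x. e x * \<phi> k x) \<in> borel_measurable (lebesgue_on \<Omega>)" for k
    using em bm[OF borel_measurable_continuous_onI[OF \<phi>(1)]] by (rule borel_measurable_times)
  show "integrable (lebesgue_on \<Omega>) (\<lambda>x. \<bar>e x\<bar>)" using e by simp
  show "AE x in lebesgue_on \<Omega>. (\<lambda>k. e x * \<phi> k x) \<longlonglongrightarrow> e x * \<psi> x"
    using lim by eventually_elim (intro tendsto_intros)
  show "AE x in lebesgue_on \<Omega>. norm (e x * \<phi> k x) \<le> \<bar>e x\<bar>" for k
    using \<phi>(2)[of k] by (intro AE_I2) (simp add: abs_mult mult_left_le)
qed

section \<open>Weak divergence of piecewise Raviart--Thomas fields\<close>

lemma elementwise_green: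
  assumes \<tau>: "\<And>K. K \<in> \<T> \<Longrightarrow> AE x in lebesgue_on K. \<tau> x = a K + c K *\<^sub>R x"
    and \<phi>: "\<phi> \<in> test_functions \<Omega>"
  shows "integrable (lebesgue_on \<Omega>) (\<lambda>x. glue (\<lambda>K x. real CARD('n) * c K) x * \<phi> x)"
    and "l2_inner \<Omega> \<tau> (grad \<phi>) + l2_inner \<Omega> (glue (\<lambda>K x. real CARD('n) * c K)) \<phi>
      = (\<Sum>E\<in>mesh_faces \<T>. (\<Sum>K\<in>{K\<in>\<T>. E \<in> facets K}. flux a c E K) * face_integral E \<phi>)"
proof -
  note C1 = test_functions_C1[OF \<phi>]
  have cont: "continuous_on UNIV \<phi>" using GDERIV_imp_continuous[OF C1(1)] .
  have cs: "continuous_on S \<phi>" "continuous_on S (grad \<phi>)" for S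
    using cont C1(2) continuous_on_subset by blast+
  let ?d0 = "glue (\<lambda>K x. real CARD('n) * c K)"
  let ?I = "\<lambda>K f. integral\<^sup>L (lebesgue_on K) f"
  show "integrable (lebesgue_on \<Omega>) (\<lambda>x. ?d0 x * \<phi> x)"
    using l2_inner_pieces(1)[OF AE_glue, of "\<lambda>K x. real CARD('n) * c K" \<phi> "\<lambda>K. \<phi>"] cs by (simp add: AE_glue)
  have i1: "integrable (lebesgue_on K) (\<lambda>x. (a K + c K *\<^sub>R x) \<bullet> grad \<phi> x)" if "K \<in> \<T>" for K
    by (rule integral_lebesgue_on_compact(2)[OF compact_T[OF that]]) (intro continuous_intros cs)
  have i2: "integrable (lebesgue_on K) (\<lambda>x. real CARD('n) * c K * \<phi> x)" if "K \<in> \<T>" for K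
    by (rule integral_lebesgue_on_compact(2)[OF compact_T[OF that]]) (intro continuous_intros cs)
  have l1: "l2_inner \<Omega> \<tau> (grad \<phi>) = (\<Sum>K\<in>\<T>. ?I K (\<lambda>x. (a K + c K *\<^sub>R x) \<bullet> grad \<phi> x))"
    by (rule l2_inner_pieces(2)[OF \<tau>]) (auto intro!: continuous_intros cs)
  have l2: "l2_inner \<Omega> ?d0 \<phi> = (\<Sum>K\<in>\<T>. ?I K (\<lambda>x. (real CARD('n) * c K) \<bullet> \<phi> x))"
    by (rule l2_inner_pieces(2)[OF AE_glue]) (auto intro!: continuous_intros cs)
  have "l2_inner \<Omega> \<tau> (grad \<phi>) + l2_inner \<Omega> ?d0 \<phi> =
      (\<Sum>K\<in>\<T>. ?I K (\<lambda>x. (a K + c K *\<^sub>R x) \<bullet> grad \<phi> x + real CARD('n) * c K * \<phi> x))"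
    unfolding l1 l2 sum.distrib[symmetric] using i1 i2 by (intro sum.cong) auto
  also have "\<dots> = (\<Sum>E\<in>mesh_faces \<T>. \<Sum>K\<in>{K\<in>\<T>. E \<in> facets K}. flux a c E K * face_integral E \<phi>)"
    by (rule green_mesh) (use C1 in auto)
  finally show "l2_inner \<Omega> \<tau> (grad \<phi>) + l2_inner \<Omega> ?d0 \<phi>
      = (\<Sum>E\<in>mesh_faces \<T>. (\<Sum>K\<in>{K\<in>\<T>. E \<in> facets K}. flux a c E K) * face_integral E \<phi>)"
    by (simp add: sum_distrib_right)
qed

lemma face_integral_test_function:
  assumes \<phi>: "\<phi> \<in> test_functions \<Omega>" and E: "E \<subseteq> frontier \<Omega>"
  shows "face_integral E \<phi> = 0"
proof -
  have "\<phi> x = 0" if "x \<in> E" for x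
  proof (rule ccontr)
    assume "\<phi> x \<noteq> 0"
    then have "x \<in> \<Omega>" using \<phi> closure_subset[of "{x. \<phi> x \<noteq> 0}"] by (auto simp: test_functions_def)
    then show False using that E open_dom by (auto simp: frontier_def interior_open)
  qed
  then have "face_integral E \<phi> = face_integral E (\<lambda>x. 0)" by (rule face_integral_cong)
  then show ?thesis by (simp add: face_integral_def)
qed

lemma face_terms_vanish:
  assumes nc: "normal_continuous a c" and \<phi>: "\<phi> \<in> test_functions \<Omega>"
  shows "(\<Sum>E\<in>mesh_faces \<T>. (\<Sum>K\<in>{K\<in>\<T>. E \<in> facets K}. flux a c E K) * face_integral E \<phi>) = 0"
proof (rule sum.neutral, rule ballI)
  fix E assume E: "E \<in> mesh_faces \<T>"
  show "(\<Sum>K\<in>{K\<in>\<T>. E \<in> facets K}. flux a c E K) * face_integral E \<phi> = 0"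
  proof (cases "E \<in> interior_faces \<Omega> \<T>")
    case True
    then show ?thesis using nc by (simp add: normal_continuous_def)
  next
    case False
    then have "E \<subseteq> frontier \<Omega>" using E by (simp add: interior_faces_def boundary_faces_def)
    then show ?thesis by (simp add: face_integral_test_function[OF \<phi>])
  qed
qed

text \<open>By Green's formula on the elements, the difference between the elementwise and the weak divergence acts on test
  functions through the jumps of the normal components.\<close>

lemma weak_div_defect:
  assumes \<tau>: "\<And>K. K \<in> \<T> \<Longrightarrow> AE x in lebesgue_on K. \<tau> x = a K + c K *\<^sub>R x"
    and d: "d \<in> L2 \<Omega>" "has_weak_div \<Omega> \<tau> d" and \<phi>: "\<phi> \<in> test_functions \<Omega>"
  shows "integral\<^sup>L (lebesgue_on \<Omega>) (\<lambda>x. (glue (\<lambda>K x. real CARD('n) * c K) x - d x) * \<phi> x)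
    = (\<Sum>E\<in>mesh_faces \<T>. (\<Sum>K\<in>{K\<in>\<T>. E \<in> facets K}. flux a c E K) * face_integral E \<phi>)"
proof -
  note C1 = test_functions_C1[OF \<phi>]
  have cont: "continuous_on UNIV \<phi>" using GDERIV_imp_continuous[OF C1(1)] .
  then have cs: "continuous_on S \<phi>" for S using continuous_on_subset by blast
  let ?d0 = "glue (\<lambda>K x. real CARD('n) * c K)"
  obtain B where B: "\<And>x. \<bar>\<phi> x\<bar> \<le> B" "B \<ge> 0"
  proof -
    let ?S = "closure {x. \<phi> x \<noteq> 0}"
    have "bounded (\<phi> ` ?S)"
      by (rule compact_imp_bounded[OF compact_continuous_image[OF cs]])
         (use \<phi> in \<open>simp add: test_functions_def\<close>)
    then obtain B where "\<And>x. x \<in> ?S \<Longrightarrow> \<bar>\<phi> x\<bar> \<le> B" by (auto simp: bounded_iff)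
    then have "\<bar>\<phi> x\<bar> \<le> max B 0" for x
      using closure_subset[of "{x. \<phi> x \<noteq> 0}"] by (cases "\<phi> x = 0") (auto simp: le_max_iff_disj)
    then show thesis by (intro that[of "max B 0"]) auto
  qed
  have id: "integrable (lebesgue_on \<Omega>) (\<lambda>x. d x * \<phi> x)"
  proof (rule Bochner_Integration.integrable_bound[where f="\<lambda>x. B * d x"])
    show "integrable (lebesgue_on \<Omega>) (\<lambda>x. B * d x)" using L2_integrable[OF d(1)] by simp
    have "\<phi> \<in> borel_measurable (lebesgue_on \<Omega>)"
      using continuous_integrable_dom[OF cont] by auto
    then show "(\<lambda>x. d x * \<phi> x) \<in> borel_measurable (lebesgue_on \<Omega>)"
      using d(1) by (intro borel_measurable_times) (auto simp: L2_def)
    show "AE x in lebesgue_on \<Omega>. norm (d x * \<phi> x) \<le> norm (B * d x)"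
      using B(2) mult_right_mono[OF B(1) abs_ge_zero]
      by (intro AE_I2) (simp add: abs_mult mult.commute[of "\<bar>d _\<bar>"])
  qed
  have wd: "l2_inner \<Omega> \<tau> (grad \<phi>) = - integral\<^sup>L (lebesgue_on \<Omega>) (\<lambda>x. d x * \<phi> x)"
    using d(2) \<phi> by (auto simp: has_weak_div_def l2_inner_def)
  have "integral\<^sup>L (lebesgue_on \<Omega>) (\<lambda>x. (?d0 x - d x) * \<phi> x) = l2_inner \<Omega> ?d0 \<phi> + l2_inner \<Omega> \<tau> (grad \<phi>)"
    using elementwise_green(1)[OF \<tau> \<phi>] id wd by (simp add: left_diff_distrib l2_inner_def)
  then show ?thesis using elementwise_green(2)[OF \<tau> \<phi>] by simp
qed

lemma glue_RT:
  assumes nc: "normal_continuous a c"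
  shows "glue (\<lambda>K x. a K + c K *\<^sub>R x) \<in> RT \<Omega> \<T>"
proof -
  let ?\<tau> = "glue (\<lambda>K x. a K + c K *\<^sub>R x)" and ?d = "glue (\<lambda>K x. real CARD('n) * c K)"
  have "has_weak_div \<Omega> ?\<tau> ?d"
    unfolding has_weak_div_def
  proof
    fix \<phi> :: "real^'n \<Rightarrow> real" assume \<phi>: "\<phi> \<in> test_functions \<Omega>"
    have "l2_inner \<Omega> ?\<tau> (grad \<phi>) + l2_inner \<Omega> ?d \<phi> = 0"
      using elementwise_green(2)[OF AE_glue \<phi>] face_terms_vanish[OF nc \<phi>] by simp
    then show "l2_inner \<Omega> ?\<tau> (grad \<phi>) = - l2_inner \<Omega> ?d \<phi>" by simp
  qed
  moreover have "?d \<in> L2 \<Omega>" by (rule L2_pieces[OF AE_glue]) auto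
  moreover have "?\<tau> \<in> L2 \<Omega>" by (rule L2_pieces[OF AE_glue]) (auto intro!: continuous_intros)
  ultimately have "?\<tau> \<in> Hdiv \<Omega>" unfolding Hdiv_def by blast
  moreover have "restricts_to ?\<tau> K (RT_elem K)" if "K \<in> \<T>" for K
    unfolding restricts_to_RT_iff using AE_glue[OF that, of "\<lambda>K x. a K + c K *\<^sub>R x"] by blast
  ultimately show ?thesis by (simp add: RT_def)
qed

lemma isolating_ball:
  assumes E: "E \<in> interior_faces \<Omega> \<T>" and y: "y \<in> rel_interior E" "y \<in> \<Omega>"
  obtains r where "r > 0" "cball y r \<subseteq> \<Omega>" "\<forall>E'\<in>mesh_faces \<T> - {E}. E' \<inter> cball y r = {}"
proof -
  have "closed (\<Union>(mesh_faces \<T> - {E}))"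
  proof (intro closed_Union ballI)
    show "finite (mesh_faces \<T> - {E})" using finite_mesh_faces by simp
    show "closed E'" if "E' \<in> mesh_faces \<T> - {E}" for E'
      using that convex_facet by (auto simp: mesh_faces_eq)
  qed
  then have "open (\<Omega> - \<Union>(mesh_faces \<T> - {E}))" using open_dom by (rule open_Diff[rotated])
  moreover have "y \<in> \<Omega> - \<Union>(mesh_faces \<T> - {E})"
    using face_through_rel_interior[of E _ y] E y by (auto simp: interior_faces_def)
  ultimately obtain r where r: "r > 0" "cball y r \<subseteq> \<Omega> - \<Union>(mesh_faces \<T> - {E})"
    by (meson open_contains_cball)
  show thesis
  proof (rule that[OF r(1)])
    show "cball y r \<subseteq> \<Omega>" using r(2) by blast
    show "\<forall>E'\<in>mesh_faces \<T> - {E}. E' \<inter> cball y r = {}" using r(2) by blast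
  qed
qed

text \<open>The test functions \<open>\<phi> m\<close> are supported near a point of \<open>E\<close> away from all other faces. They agree with each other on
  \<open>E\<close> but shrink to \<open>E\<close> as \<open>m\<close> grows: in \<open>weak_div_defect\<close> the face term stays the same while the volume term tends to 0.\<close>

lemma RT_normal_continuous:
  assumes \<tau>: "\<And>K. K \<in> \<T> \<Longrightarrow> AE x in lebesgue_on K. \<tau> x = a K + c K *\<^sub>R x"
    and d: "d \<in> L2 \<Omega>" "has_weak_div \<Omega> \<tau> d"
  shows "normal_continuous a c"
  unfolding normal_continuous_def
proof
  fix E assume E: "E \<in> interior_faces \<Omega> \<T>"
  let ?s = "\<Sum>K\<in>{K\<in>\<T>. E \<in> facets K}. flux a c E K"
  have Em: "E \<in> mesh_faces \<T>" using E by (simp add: interior_faces_def)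
  then obtain K where K: "K \<in> \<T>" "E \<in> facets K" by (auto simp: mesh_faces_eq)
  obtain b where "pyramid E (apex K E) (outward_normal K E) b (height K E)"
    by (rule facet_pyramid[OF simplex_T[OF K(1)] K(2)])
  then interpret pyramid E "apex K E" "outward_normal K E" b "height K E" .
  obtain y where y: "y \<in> rel_interior E" "y \<in> \<Omega>" by (rule interior_face_point[OF E])
  obtain r where r: "r > 0" "cball y r \<subseteq> \<Omega>" "\<forall>E'\<in>mesh_faces \<T> - {E}. E' \<inter> cball y r = {}"
    by (rule isolating_ball[OF E y])
  let ?l = "\<lambda>x. outward_normal K E \<bullet> x - b"
  define \<phi> where "\<phi> m x = bump ((r\<^sup>2 - (norm (x - y))\<^sup>2) - real m * (?l x * ?l x))" for m :: nat and x
  have Ck: "Ck k (\<phi> m)" for k m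
    unfolding \<phi>_def bump_def by (intro Ck_flat Ck_diff Ck_mult Ck_const Ck_norm_sq Ck_inner)
  have out: "\<phi> m x = 0" if "x \<notin> cball y r" for m x
  proof -
    have "r < norm (x - y)" using that by (simp add: dist_norm norm_minus_commute)
    then have "r\<^sup>2 < (norm (x - y))\<^sup>2" using r(1) by (intro power_strict_mono) auto
    moreover have "0 \<le> real m * (?l x * ?l x)" by simp
    ultimately show ?thesis unfolding \<phi>_def bump_bounds(3) by linarith
  qed
  have test: "\<phi> m \<in> test_functions \<Omega>" for m
    by (rule test_functions_compact_supportI[OF Ck compact_cball r(2) out])
  have cont: "continuous_on S (\<phi> m)" for S m using Ck[of 0 m] continuous_on_subset by auto
  define A where "A = face_integral E (\<phi> 0)"
  have A: "A > 0" unfolding A_def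
    by (rule face_integral_pos[OF cont _ y(1)]) (use r(1) in \<open>auto simp: \<phi>_def bump_eq\<close>)
  let ?e = "\<lambda>x. glue (\<lambda>K x. real CARD('n) * c K) x - d x"
  have val: "integral\<^sup>L (lebesgue_on \<Omega>) (\<lambda>x. ?e x * \<phi> m x) = ?s * A" for m
  proof -
    have "face_integral E' (\<phi> m) = (if E' = E then A else 0)" if E': "E' \<in> mesh_faces \<T>" for E'
    proof (cases "E' = E")
      case True
      have "face_integral E (\<phi> m) = face_integral E (\<phi> 0)"
        by (rule face_integral_cong) (simp add: \<phi>_def F_hyp)
      then show ?thesis using True by (simp add: A_def)
    next
      case False
      have "face_integral E' (\<phi> m) = face_integral E' (\<lambda>x. 0)"
        by (rule face_integral_cong, rule out) (use r(3) E' False in blast)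
      then show ?thesis using False by (simp add: face_integral_def)
    qed
    then have "(\<Sum>E'\<in>mesh_faces \<T>. (\<Sum>K\<in>{K\<in>\<T>. E' \<in> facets K}. flux a c E' K) * face_integral E' (\<phi> m))
      = (\<Sum>E'\<in>mesh_faces \<T>. if E' = E then ?s * A else 0)"
      by (intro sum.cong) auto
    moreover note weak_div_defect[of \<tau> a c d "\<phi> m", OF \<tau> d test]
    ultimately show ?thesis using Em finite_mesh_faces by simp
  qed
  have e: "integrable (lebesgue_on \<Omega>) ?e"
    by (intro Bochner_Integration.integrable_diff L2_integrable d(1) L2_pieces[OF AE_glue]) auto
  have "(\<lambda>m. integral\<^sup>L (lebesgue_on \<Omega>) (\<lambda>x. ?e x * \<phi> m x)) \<longlonglongrightarrow> integral\<^sup>L (lebesgue_on \<Omega>) (\<lambda>x. ?e x * 0)"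
  proof (rule dominated_limit_dom[OF e cont])
    show "\<bar>\<phi> k x\<bar> \<le> 1" for k x using bump_bounds by (simp add: \<phi>_def)
    have "outward_normal K E \<noteq> 0" using \<nu> by auto
    then have "negligible {x. outward_normal K E \<bullet> x = b}" by (simp add: negligible_hyperplane)
    then have "AE x in lebesgue. x \<notin> {x. outward_normal K E \<bullet> x = b}" by (rule negligible_AE)
    then show "AE x in lebesgue_on \<Omega>. (\<lambda>k. \<phi> k x) \<longlonglongrightarrow> 0"
      unfolding AE_lebesgue_on_iff[OF sets_dom]
    proof (rule eventually_mono, intro impI)
      fix x assume "x \<notin> {x. outward_normal K E \<bullet> x = b}"
      then have "?l x \<noteq> 0" by simp
      then have s: "0 < ?l x * ?l x"
        by (metis not_real_square_gt_zero)
      obtain N :: nat where N: "r\<^sup>2 < real N * (?l x * ?l x)"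
        using reals_Archimedean3[OF s] by blast
      have "\<phi> m x = 0" if "m \<ge> N" for m
      proof -
        have "real N * (?l x * ?l x)
          \<le> real m * (?l x * ?l x)"
          using s that by (intro mult_right_mono) auto
        moreover have "0 \<le> (norm (x - y))\<^sup>2" by simp
        ultimately show ?thesis unfolding \<phi>_def bump_bounds(3) using N by linarith
      qed
      then show "(\<lambda>k. \<phi> k x) \<longlonglongrightarrow> 0"
        by (intro tendsto_eventually) (auto simp: eventually_sequentially)
    qed
  qed simp
  then have "(\<lambda>m::nat. ?s * A) \<longlonglongrightarrow> 0" unfolding val by simp
  then have "?s * A = 0" by (simp add: LIMSEQ_const_iff)
  then show "?s = 0" using A by simp
qed

text \<open>Both divergences have the same integral against test functions. Test functions that tend to the indicator of the
  part of \<open>K\<close> in \<open>\<Omega>\<close> carry this over to the integral over \<open>K\<close>.\<close>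

lemma integral_weak_div:
  assumes \<tau>: "\<And>K. K \<in> \<T> \<Longrightarrow> AE x in lebesgue_on K. \<tau> x = a K + c K *\<^sub>R x"
    and d: "d \<in> L2 \<Omega>" "has_weak_div \<Omega> \<tau> d" and K: "K \<in> \<T>"
  shows "integral\<^sup>L (lebesgue_on K) d = integral\<^sup>L (lebesgue_on K) (\<lambda>x. real CARD('n) * c K)"
proof -
  let ?e = "\<lambda>x. glue (\<lambda>K x. real CARD('n) * c K) x - d x"
  have nc: "normal_continuous a c" by (rule RT_normal_continuous[OF \<tau> d])
  have g: "integrable (lebesgue_on \<Omega>) (glue (\<lambda>K x. real CARD('n) * c K))"
    by (intro L2_integrable L2_pieces[OF AE_glue]) auto
  have e: "integrable (lebesgue_on \<Omega>) ?e"
    by (intro Bochner_Integration.integrable_diff L2_integrable[OF d(1)] g)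
  have zero: "integral\<^sup>L (lebesgue_on \<Omega>) (\<lambda>x. ?e x * \<phi> x) = 0" if \<phi>: "\<phi> \<in> test_functions \<Omega>" for \<phi>
    using weak_div_defect[OF \<tau> d \<phi>] face_terms_vanish[OF nc \<phi>] by simp
  let ?U = "interior K \<inter> \<Omega>"
  have "open ?U" using open_dom by (intro open_Int) auto
  then obtain \<phi> where \<phi>: "\<And>k::nat. \<phi> k \<in> test_functions ?U" "\<And>k x. \<bar>\<phi> k x\<bar> \<le> 1"
    "\<And>x. (\<lambda>k. \<phi> k x) \<longlonglongrightarrow> indicator ?U x"
    by (rule indicator_limit_of_test_functions) blast
  have t: "\<phi> k \<in> test_functions \<Omega>" for k using \<phi>(1)[of k] by (auto simp: test_functions_def)
  have "(\<lambda>k. integral\<^sup>L (lebesgue_on \<Omega>) (\<lambda>x. ?e x * \<phi> k x)) \<longlonglongrightarrow> integral\<^sup>L (lebesgue_on \<Omega>) (\<lambda>x. ?e x * indicator ?U x)"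
  proof (rule dominated_limit_dom[OF e])
    show "continuous_on UNIV (\<phi> k)" for k
      by (rule GDERIV_imp_continuous[OF test_functions_C1(1)[OF t]])
    show "indicator ?U \<in> borel_measurable borel"
      by (rule borel_measurable_indicator[OF borel_open[OF \<open>open ?U\<close>]])
  qed (use \<phi> in auto)
  then have "(\<lambda>k::nat. 0) \<longlonglongrightarrow> integral\<^sup>L (lebesgue_on \<Omega>) (\<lambda>x. ?e x * indicator ?U x)"
    unfolding zero[OF t] .
  then have I0: "integral\<^sup>L (lebesgue_on \<Omega>) (\<lambda>x. ?e x * indicator ?U x) = 0"
    by (simp add: LIMSEQ_const_iff)
  have eK: "integrable (lebesgue_on L) ?e" if "L \<in> \<T>" for L by (rule integrable_on_T[OF e that])
  have piece: "AE x in lebesgue_on L. (if L = K then ?e x else 0) = ?e x * indicator ?U x" if L: "L \<in> \<T>" for L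
    unfolding AE_lebesgue_on_iff[OF sets_T[OF L]] using AE_generic
  proof eventually_elim
    case (elim x)
    show ?case
    proof
      assume x: "x \<in> L"
      then have "x \<in> interior L" using elim L by blast
      then have "x \<in> interior K \<longleftrightarrow> L = K" using elements_disjoint[OF K L _ x] by auto
      moreover have "x \<in> \<Omega>" using elim x L Union_T open_dom by (auto simp: frontier_def interior_open)
      ultimately show "(if L = K then ?e x else 0) = ?e x * indicator ?U x" by (auto simp: indicator_def)
    qed
  qed
  have pi: "integrable (lebesgue_on L) (\<lambda>x. if L = K then ?e x else 0)" if "L \<in> \<T>" for L
    using eK[OF that] by (cases "L = K") auto
  note pc = integrable_cong_AE_lebesgue_on[OF sets_T pi piece]
  have "0 = (\<Sum>L\<in>\<T>. integral\<^sup>L (lebesgue_on L) (\<lambda>x. ?e x * indicator ?U x))"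
    using integral_dom[of "\<lambda>x. ?e x * indicator ?U x"] pc(1) I0 by simp
  also have "\<dots> = (\<Sum>L\<in>\<T>. if L = K then integral\<^sup>L (lebesgue_on K) ?e else 0)"
    by (rule sum.cong) (auto simp flip: pc(2))
  also have "\<dots> = integral\<^sup>L (lebesgue_on K) ?e" using finite_T K by simp
  also have "\<dots> = integral\<^sup>L (lebesgue_on K) (glue (\<lambda>K x. real CARD('n) * c K)) - integral\<^sup>L (lebesgue_on K) d"
    using integrable_on_T[OF g K] integrable_on_T[OF L2_integrable[OF d(1)] K] by simp
  also have "integral\<^sup>L (lebesgue_on K) (glue (\<lambda>K x. real CARD('n) * c K)) = integral\<^sup>L (lebesgue_on K) (\<lambda>x. real CARD('n) * c K)"
    by (rule integrable_cong_AE_lebesgue_on(2)[OF sets_T[OF K] integrable_on_T[OF g K] AE_glue[OF K]])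
  finally show ?thesis by simp
qed

lemma weak_div_RT:
  assumes "\<tau> \<in> RT \<Omega> \<T>"
  shows "weak_div \<Omega> \<tau> \<in> L2 \<Omega>" "has_weak_div \<Omega> \<tau> (weak_div \<Omega> \<tau>)"
proof -
  have "\<exists>d. d \<in> L2 \<Omega> \<and> has_weak_div \<Omega> \<tau> d" using assms by (auto simp: RT_def Hdiv_def)
  from someI_ex[OF this] show "weak_div \<Omega> \<tau> \<in> L2 \<Omega>" "has_weak_div \<Omega> \<tau> (weak_div \<Omega> \<tau>)"
    by (auto simp: weak_div_def)
qed

lemma l2_inner_weak_div:
  assumes \<tau>: "\<tau> \<in> RT \<Omega> \<T>" "\<And>K. K \<in> \<T> \<Longrightarrow> AE x in lebesgue_on K. \<tau> x = a K + c K *\<^sub>R x"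
    and w: "\<And>K. K \<in> \<T> \<Longrightarrow> AE x in lebesgue_on K. w x = w' K"
  shows "l2_inner \<Omega> w (weak_div \<Omega> \<tau>) = (\<Sum>K\<in>\<T>. w' K * integral\<^sup>L (lebesgue_on K) (\<lambda>x. real CARD('n) * c K))"
proof -
  note d = weak_div_RT[OF \<tau>(1)]
  have i: "integrable (lebesgue_on K) (\<lambda>x. w' K * weak_div \<Omega> \<tau> x)" if "K \<in> \<T>" for K
    using integrable_on_T[OF L2_integrable[OF d(1)] that] by simp
  have ae: "AE x in lebesgue_on K. w' K * weak_div \<Omega> \<tau> x = w x \<bullet> weak_div \<Omega> \<tau> x" if "K \<in> \<T>" for K
    using w[OF that] by eventually_elim simp
  note c = integrable_cong_AE_lebesgue_on[OF sets_T i ae]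
  have "l2_inner \<Omega> w (weak_div \<Omega> \<tau>) = (\<Sum>K\<in>\<T>. integral\<^sup>L (lebesgue_on K) (\<lambda>x. w x \<bullet> weak_div \<Omega> \<tau> x))"
    unfolding l2_inner_def by (rule integral_dom) (rule c(1))
  also have "\<dots> = (\<Sum>K\<in>\<T>. integral\<^sup>L (lebesgue_on K) (\<lambda>x. w' K * weak_div \<Omega> \<tau> x))"
    by (rule sum.cong[OF refl]) (rule c(2)[symmetric])
  also have "\<dots> = (\<Sum>K\<in>\<T>. w' K * integral\<^sup>L (lebesgue_on K) (\<lambda>x. real CARD('n) * c K))"
  proof (rule sum.cong)
    fix K assume K: "K \<in> \<T>"
    show "integral\<^sup>L (lebesgue_on K) (\<lambda>x. w' K * weak_div \<Omega> \<tau> x) = w' K * integral\<^sup>L (lebesgue_on K) (\<lambda>x. real CARD('n) * c K)"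
      using integral_weak_div[OF \<tau>(2) d K] by simp
  qed simp
  finally show ?thesis .
qed

section \<open>Comparison of the two discretisations\<close>

lemma continuous_nonneg_integral_0:
  fixes g :: "real^'n \<Rightarrow> real"
  assumes K: "K \<in> \<T>" and g: "continuous_on K g" "\<And>x. 0 \<le> g x" and z: "integral\<^sup>L (lebesgue_on K) g = 0"
    and x: "x \<in> K"
  shows "g x = 0"
proof -
  have "AE x in lebesgue_on K. g x = 0"
    using integral_nonneg_eq_0_iff_AE[OF integral_lebesgue_on_compact(2)[OF compact_T[OF K] g(1)]] g(2) z by auto
  from continuous_AE_unique[OF K g(1) continuous_on_const this x] show ?thesis .
qed

definition vol :: "(real^'n) set \<Rightarrow> real" where
  "vol K = integral\<^sup>L (lebesgue_on K) (\<lambda>x. 1)"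

lemma integral_const_vol: "integral\<^sup>L (lebesgue_on K) (\<lambda>x. c) = c * vol K"
  unfolding vol_def using integral_mult_right_zero[of "lebesgue_on K" c "\<lambda>x. 1"] by simp

lemma vol_pos: "K \<in> \<T> \<Longrightarrow> vol K > 0"
proof -
  assume K: "K \<in> \<T>"
  obtain x where "x \<in> K" using interior_T[OF K] interior_subset by blast
  then have "vol K \<noteq> 0"
    using continuous_nonneg_integral_0[OF K, of "\<lambda>x. 1" x] by (auto simp: vol_def)
  moreover have "vol K \<ge> 0" unfolding vol_def by (rule Bochner_Integration.integral_nonneg) simp
  ultimately show ?thesis by simp
qed

lemma affine_field_unique:
  assumes K: "K \<in> \<T>" and eq: "\<And>x. x \<in> K \<Longrightarrow> a + c *\<^sub>R x = a' + c' *\<^sub>R (x :: real^'n)"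
  shows "a = a' \<and> c = c'"
proof -
  obtain x where x: "x \<in> interior K" using interior_T[OF K] by blast
  then obtain r where r: "r > 0" "ball x r \<subseteq> K" by (auto simp: mem_interior)
  define v :: "real^'n" where "v = (r/2) *\<^sub>R (\<chi> i. 1) /\<^sub>R norm ((\<chi> i. 1) :: real^'n)"
  have one: "((\<chi> i. 1) :: real^'n) \<noteq> 0" by (simp add: vec_eq_iff)
  have v: "v \<noteq> 0" "norm v < r" using r one by (auto simp: v_def)
  have "x \<in> K" "x + v \<in> K" using r v by (auto simp: subset_iff dist_norm)
  have "(a + c *\<^sub>R (x + v)) - (a + c *\<^sub>R x) = (a' + c' *\<^sub>R (x + v)) - (a' + c' *\<^sub>R x)"
    by (simp only: eq[OF \<open>x \<in> K\<close>] eq[OF \<open>x + v \<in> K\<close>])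
  then have "c *\<^sub>R v = c' *\<^sub>R v" by (simp add: scaleR_add_right)
  then have "c = c'" using v(1) by simp
  then show ?thesis using eq[OF \<open>x \<in> K\<close>] by simp
qed

lemma face_integral_diff_facet:
  assumes "K \<in> \<T>" "E \<in> facets K" "continuous_on E f" "continuous_on E g"
  shows "face_integral E (\<lambda>x. f x - g x) = face_integral E f - face_integral E g"
proof -
  obtain b where "pyramid E (apex K E) (outward_normal K E) b (height K E)"
    by (rule facet_pyramid[OF simplex_T[OF assms(1)] assms(2)])
  from pyramid.face_integral_diff[OF this assms(3,4)] show ?thesis .
qed

lemma face_area_pos_facet:
  assumes "K \<in> \<T>" "E \<in> facets K"
  shows "0 < face_integral E (\<lambda>x. 1)"
proof -
  obtain b where "pyramid E (apex K E) (outward_normal K E) b (height K E)"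
    by (rule facet_pyramid[OF simplex_T[OF assms(1)] assms(2)])
  then show ?thesis by (rule pyramid.face_area_pos)
qed

lemma facets_iff: "E \<in> facets K \<longleftrightarrow> E facet_of K"
  by (simp add: facets_def)

text \<open>The face conditions in the definition of \<open>V_ECR\<close>, for polynomials given on the elements.\<close>

definition same_traces :: "((real^'n) set \<Rightarrow> real^'n \<Rightarrow> real) \<Rightarrow> bool" where
  "same_traces p \<longleftrightarrow>
     (\<forall>E\<in>interior_faces \<Omega> \<T>. \<forall>K\<in>\<T>. \<forall>K'\<in>\<T>. K \<noteq> K' \<and> E \<in> facets K \<and> E \<in> facets K' \<longrightarrow>
        face_integral E (p K) = face_integral E (p K')) \<and>
     (\<forall>E\<in>boundary_faces \<Omega> \<T>. \<forall>K\<in>\<T>. E \<in> facets K \<longrightarrow> face_integral E (p K) = 0)"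

lemma same_tracesD:
  assumes p: "same_traces p"
  shows "E \<in> interior_faces \<Omega> \<T> \<Longrightarrow> K \<in> \<T> \<Longrightarrow> K' \<in> \<T> \<Longrightarrow> K \<noteq> K' \<Longrightarrow> E \<in> facets K \<Longrightarrow> E \<in> facets K'
      \<Longrightarrow> face_integral E (p K) = face_integral E (p K')"
    and "E \<in> boundary_faces \<Omega> \<T> \<Longrightarrow> K \<in> \<T> \<Longrightarrow> E \<in> facets K \<Longrightarrow> face_integral E (p K) = 0"
proof -
  note p = p[unfolded same_traces_def]
  show "face_integral E (p K) = face_integral E (p K')"
    if "E \<in> interior_faces \<Omega> \<T>" "K \<in> \<T>" "K' \<in> \<T>" "K \<noteq> K'" "E \<in> facets K" "E \<in> facets K'"
    by (rule mp[OF bspec[OF bspec[OF bspec[OF conjunct1[OF p] that(1)] that(2)] that(3)]]) (use that in simp)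
  show "face_integral E (p K) = 0" if "E \<in> boundary_faces \<Omega> \<T>" "K \<in> \<T>" "E \<in> facets K"
    by (rule mp[OF bspec[OF bspec[OF conjunct2[OF p] that(1)] that(2)] that(3)])
qed

lemma elem_rep_face_integrals:
  assumes v: "\<And>K. K \<in> \<T> \<Longrightarrow> AE x in lebesgue_on K. v x = p K x" and p: "\<And>K. K \<in> \<T> \<Longrightarrow> continuous_on K (p K)"
  shows "(\<forall>E\<in>interior_faces \<Omega> \<T>. \<forall>K\<^sub>1\<in>\<T>. \<forall>K\<^sub>2\<in>\<T>. K\<^sub>1 \<noteq> K\<^sub>2 \<and> E facet_of K\<^sub>1 \<and> E facet_of K\<^sub>2 \<longrightarrow>
           face_integral E (\<lambda>x. elem_rep v K\<^sub>1 x - elem_rep v K\<^sub>2 x) = 0) \<and>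
        (\<forall>E\<in>boundary_faces \<Omega> \<T>. \<forall>K\<in>\<T>. E facet_of K \<longrightarrow>
           face_integral E (elem_rep v K) = 0) \<longleftrightarrow> same_traces p"
proof -
  have rep: "elem_rep v K x = p K x" if "K \<in> \<T>" "E \<in> facets K" "x \<in> E" for E K x
    using elem_rep_eq[OF that(1) p[OF that(1)] v[OF that(1)]] facet_subset[OF that(2)] that(3) by auto
  have 1: "face_integral E (elem_rep v K) = face_integral E (p K)" if "K \<in> \<T>" "E \<in> facets K" for E K
    using rep[OF that] by (rule face_integral_cong)
  have 2: "face_integral E (\<lambda>x. elem_rep v K x - elem_rep v K' x) = face_integral E (p K) - face_integral E (p K')"
    if "K \<in> \<T>" "E \<in> facets K" "K' \<in> \<T>" "E \<in> facets K'" for E K K'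
  proof -
    have "face_integral E (\<lambda>x. elem_rep v K x - elem_rep v K' x) = face_integral E (\<lambda>x. p K x - p K' x)"
      using rep that by (intro face_integral_cong) auto
    also have "\<dots> = face_integral E (p K) - face_integral E (p K')"
      by (rule face_integral_diff_facet[OF that(1,2)])
         (rule continuous_on_subset[OF p facet_subset]; rule that)+
    finally show ?thesis .
  qed
  show ?thesis unfolding same_traces_def facets_iff[symmetric] using 1 2 by auto
qed

lemma V_ECR_E:
  assumes "v \<in> V_ECR \<Omega> \<T>"
  obtains \<alpha> \<beta> \<gamma> where "\<forall>K\<in>\<T>. AE x in lebesgue_on K. v x = quad (\<alpha> K) (\<beta> K) (\<gamma> K) x"
    "same_traces (\<lambda>K. quad (\<alpha> K) (\<beta> K) (\<gamma> K))"
proof -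
  have "\<forall>K\<in>\<T>. \<exists>\<alpha> \<beta> \<gamma>. AE x in lebesgue_on K. v x = quad \<alpha> \<beta> \<gamma> x"
    using assms by (auto simp: V_ECR_def restricts_to_ECR_iff)
  then obtain \<alpha> \<beta> \<gamma> where q: "\<forall>K\<in>\<T>. AE x in lebesgue_on K. v x = quad (\<alpha> K) (\<beta> K) (\<gamma> K) x"
    by metis
  moreover have "same_traces (\<lambda>K. quad (\<alpha> K) (\<beta> K) (\<gamma> K))"
    using elem_rep_face_integrals[of v "\<lambda>K. quad (\<alpha> K) (\<beta> K) (\<gamma> K)", OF bspec[OF q] continuous_on_quad] assms
    by (simp add: V_ECR_def)
  ultimately show thesis by (rule that)
qed

lemma V_ECR_I:
  assumes "same_traces (\<lambda>K. quad (\<alpha> K) (\<beta> K) (\<gamma> K))"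
  shows "glue (\<lambda>K. quad (\<alpha> K) (\<beta> K) (\<gamma> K)) \<in> V_ECR \<Omega> \<T>"
proof -
  let ?v = "glue (\<lambda>K. quad (\<alpha> K) (\<beta> K) (\<gamma> K))"
  have ae: "AE x in lebesgue_on K. ?v x = quad (\<alpha> K) (\<beta> K) (\<gamma> K) x" if "K \<in> \<T>" for K
    by (rule AE_glue[OF that])
  have "?v \<in> L2 \<Omega>" by (rule L2_pieces[OF ae continuous_on_quad])
  moreover have "restricts_to ?v K (ECR K)" if "K \<in> \<T>" for K
    unfolding restricts_to_ECR_iff using ae[OF that] by blast
  ultimately show ?thesis
    using assms elem_rep_face_integrals[of ?v "\<lambda>K. quad (\<alpha> K) (\<beta> K) (\<gamma> K)", OF ae continuous_on_quad]
    by (simp add: V_ECR_def)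
qed

lemma U_RT_I: "glue (\<lambda>K x. w K) \<in> U_RT \<Omega> \<T>"
proof -
  have "glue (\<lambda>K x. w K) \<in> L2 \<Omega>" by (rule L2_pieces[OF AE_glue]) auto
  then show ?thesis
    unfolding U_RT_def piecewise_constant_def restricts_to_P0_iff using AE_glue[of _ "\<lambda>K x. w K"] by blast
qed

lemma piecewise_constant_E:
  assumes "piecewise_constant \<T> v"
  obtains w where "\<forall>K\<in>\<T>. AE x in lebesgue_on K. v x = w K"
  using assms unfolding piecewise_constant_def restricts_to_P0_iff by metis

lemma RT_E:
  assumes "\<tau> \<in> RT \<Omega> \<T>"
  obtains a c where "\<forall>K\<in>\<T>. AE x in lebesgue_on K. \<tau> x = a K + c K *\<^sub>R x" "normal_continuous a c"
proof -
  have "\<forall>K\<in>\<T>. \<exists>a c. AE x in lebesgue_on K. \<tau> x = a + c *\<^sub>R x"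
    using assms by (auto simp: RT_def restricts_to_RT_iff)
  then obtain a c where ac: "\<forall>K\<in>\<T>. AE x in lebesgue_on K. \<tau> x = a K + c K *\<^sub>R x"
    by metis
  moreover have "normal_continuous a c"
    by (rule RT_normal_continuous[OF bspec[OF ac] weak_div_RT[OF assms]])
  ultimately show thesis by (rule that)
qed

text \<open>The field \<open>(s K / height K E) (x - apex K E)\<close> on the elements with facet \<open>E\<close>, and 0 elsewhere, has no normal component on
  any face other than \<open>E\<close>.\<close>

lemma single_face_field:
  assumes E: "E \<in> mesh_faces \<T>"
  obtains a c where "\<forall>K\<in>\<T>. \<forall>E'\<in>facets K. flux a c E' K = (if E' = E then s K else 0)"
proof -
  define c where "c K = (if E \<in> facets K then s K / height K E else 0)" for K
  define a where "a K = - c K *\<^sub>R apex K E" for K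
  have "flux a c E' K = (if E' = E then s K else 0)" if K: "K \<in> \<T>" "E' \<in> facets K" for K E'
  proof -
    obtain x where x: "x \<in> E'" using convex_facet[OF K] by blast
    have "flux a c E' K = (a K + c K *\<^sub>R x) \<bullet> outward_normal K E'" using flux_eq[OF K x] by simp
    also have "a K + c K *\<^sub>R x = c K *\<^sub>R (x - apex K E)" by (simp add: a_def scaleR_diff_right)
    finally have fl: "flux a c E' K = c K * ((x - apex K E) \<bullet> outward_normal K E')" by simp
    show ?thesis
    proof (cases "E \<in> facets K")
      case True
      obtain b where "pyramid E (apex K E) (outward_normal K E) b (height K E)"
        by (rule facet_pyramid[OF simplex_T[OF K(1)] True])
      then have "height K E > 0" by (rule pyramid.h)
      then show ?thesis unfolding fl simplex_flux[OF simplex_T[OF K(1)] K(2) True x] using True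
        by (auto simp: c_def)
    next
      case False
      then show ?thesis using K(2) unfolding fl by (auto simp: c_def)
    qed
  qed
  then show thesis by (intro that) blast
qed

text \<open>The polynomials \<open>?y K\<close> of the proof are the lifting of the mixed solution described at the beginning; \<open>\<rho>\<close> stands for the
  scalar part of that solution.\<close>

theorem RT_solution_is_ECR_gradient:
  fixes f u \<rho> :: "real^'n \<Rightarrow> real" and \<sigma> :: "real^'n \<Rightarrow> real^'n"
  assumes f: "piecewise_constant \<T> f"
    and u: "u \<in> V_ECR \<Omega> \<T>"
    and u_eq: "\<And>v. v \<in> V_ECR \<Omega> \<T> \<Longrightarrow> l2_inner \<Omega> (nabla_NC \<T> u) (nabla_NC \<T> v) = l2_inner \<Omega> f v"
    and \<sigma>: "\<sigma> \<in> RT \<Omega> \<T>"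
    and \<rho>: "\<rho> \<in> U_RT \<Omega> \<T>"
    and eq1: "\<And>\<tau>. \<tau> \<in> RT \<Omega> \<T> \<Longrightarrow> l2_inner \<Omega> \<sigma> \<tau> + l2_inner \<Omega> \<rho> (weak_div \<Omega> \<tau>) = 0"
    and eq2: "\<And>v. v \<in> U_RT \<Omega> \<T> \<Longrightarrow> l2_inner \<Omega> (weak_div \<Omega> \<sigma>) v = - l2_inner \<Omega> f v"
  shows "AE x in lebesgue_on \<Omega>. \<sigma> x = nabla_NC \<T> u x"
    and "AE x in lebesgue_on \<Omega>. \<rho> x = Pi0 \<Omega> \<T> u x"
proof -
  let ?I = "\<lambda>K g. integral\<^sup>L (lebesgue_on K) g"
  let ?n = "real CARD('n)"
  obtain fc where "\<forall>K\<in>\<T>. AE x in lebesgue_on K. f x = fc K"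
    by (rule piecewise_constant_E[OF f])
  note fc = bspec[OF this]
  have "piecewise_constant \<T> \<rho>" using \<rho> by (simp add: U_RT_def)
  then obtain w where "\<forall>K\<in>\<T>. AE x in lebesgue_on K. \<rho> x = w K"
    by (rule piecewise_constant_E)
  note w = bspec[OF this]
  obtain a c where ac': "\<forall>K\<in>\<T>. AE x in lebesgue_on K. \<sigma> x = a K + c K *\<^sub>R x" and nc: "normal_continuous a c"
    by (rule RT_E[OF \<sigma>])
  note ac = bspec[OF ac']
  obtain u\<alpha> u\<beta> u\<gamma> where uq': "\<forall>K\<in>\<T>. AE x in lebesgue_on K. u x = quad (u\<alpha> K) (u\<beta> K) (u\<gamma> K) x"
    and ut: "same_traces (\<lambda>K. quad (u\<alpha> K) (u\<beta> K) (u\<gamma> K))"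
    by (rule V_ECR_E[OF u])
  note uq = bspec[OF uq']
  let ?u = "\<lambda>K. quad (u\<alpha> K) (u\<beta> K) (u\<gamma> K)"
  have int: "integrable (lebesgue_on K) g" if "K \<in> \<T>" "continuous_on K g" for K and g :: "real^'n \<Rightarrow> real"
    by (rule integral_lebesgue_on_compact(2)[OF compact_T[OF that(1)] that(2)])
  have l2_const: "l2_inner \<Omega> p q = (\<Sum>K\<in>\<T>. p' K * ?I K (q' K))"
    if "\<And>K. K \<in> \<T> \<Longrightarrow> AE x in lebesgue_on K. p x = p' K" "\<And>K. K \<in> \<T> \<Longrightarrow> AE x in lebesgue_on K. q x = q' K x"
      "\<And>K. K \<in> \<T> \<Longrightarrow> continuous_on K (q' K)" for p q p' q'
    using l2_inner_pieces(2)[of p "\<lambda>K x. p' K" q q', OF that(1) _ that(2,3)] by simp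
  have pick: "(\<Sum>L\<in>\<T>. (if L = K then 1 else 0) * X L) = (X K :: real)" if "K \<in> \<T>" for K X
  proof -
    have "(\<Sum>L\<in>\<T>. (if L = K then 1 else 0) * X L) = (\<Sum>L\<in>\<T>. if L = K then X L else 0)"
      by (intro sum.cong) auto
    then show ?thesis using finite_T that by simp
  qed

  \<comment> \<open>Testing with the indicator of one element: \<open>div \<sigma> = - f\<close> elementwise.\<close>
  have div: "?n * c K = - fc K" if K: "K \<in> \<T>" for K
  proof -
    let ?z = "\<lambda>L. if L = K then 1 else 0 :: real"
    let ?v = "glue (\<lambda>L x. ?z L)"
    have "l2_inner \<Omega> ?v (weak_div \<Omega> \<sigma>) = (\<Sum>L\<in>\<T>. ?z L * ?I L (\<lambda>x. ?n * c L))"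
      by (rule l2_inner_weak_div[OF \<sigma> ac AE_glue])
    then have "l2_inner \<Omega> ?v (weak_div \<Omega> \<sigma>) = ?n * c K * vol K"
      unfolding pick[OF K] integral_const_vol .
    moreover have "l2_inner \<Omega> ?v f = (\<Sum>L\<in>\<T>. ?z L * ?I L (\<lambda>x. fc L))"
      by (rule l2_const[OF AE_glue fc]) auto
    then have "l2_inner \<Omega> ?v f = fc K * vol K"
      unfolding pick[OF K] integral_const_vol .
    moreover have "l2_inner \<Omega> ?v (weak_div \<Omega> \<sigma>) = - l2_inner \<Omega> ?v f"
      using eq2[OF U_RT_I[of ?z]] by (simp add: l2_inner_def mult.commute)
    ultimately have "(?n * c K) * vol K = (- fc K) * vol K" by simp
    then show ?thesis using vol_pos[OF K] by (metis mult_right_cancel less_irrefl)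
  qed

  \<comment> \<open>The constant term that gives \<open>?y K\<close> the mean \<open>w K\<close>.\<close>
  define y\<alpha> where "y\<alpha> K = w K - ?I K (quad 0 (a K) (c K / 2)) / vol K" for K
  let ?y = "\<lambda>K. quad (y\<alpha> K) (a K) (c K / 2)"
  have yG: "GDERIV (?y K) x :> a K + c K *\<^sub>R x" for K x using GDERIV_quad[of _ _ "c K / 2"] by simp
  have mean: "?I K (?y K) = w K * vol K" if K: "K \<in> \<T>" for K
  proof -
    have "?y K = (\<lambda>x. y\<alpha> K + quad 0 (a K) (c K / 2) x)" by (auto simp: quad_def)
    then have "?I K (?y K) = ?I K (\<lambda>x. y\<alpha> K) + ?I K (quad 0 (a K) (c K / 2))"
      using Bochner_Integration.integral_add[OF int[OF K continuous_on_const] int[OF K continuous_on_quad]] by simp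
    then have "?I K (?y K) = y\<alpha> K * vol K + ?I K (quad 0 (a K) (c K / 2))"
      by (simp only: integral_const_vol)
    then show ?thesis using vol_pos[OF K] by (simp add: y\<alpha>_def field_simps)
  qed

  \<comment> \<open>The first mixed equation for the field with flux \<open>s K\<close> through the face \<open>E\<close> of \<open>K\<close>. The condition
    on \<open>s\<close> expresses the continuity of its normal component.\<close>
  have face: "(\<Sum>K\<in>{K\<in>\<T>. E \<in> facets K}. s K * face_integral E (?y K)) = 0"
    if E: "E \<in> mesh_faces \<T>" and s: "E \<in> interior_faces \<Omega> \<T> \<Longrightarrow> (\<Sum>K\<in>{K\<in>\<T>. E \<in> facets K}. s K) = 0" for E s
  proof -
    obtain a' c' where fl: "\<forall>K\<in>\<T>. \<forall>E'\<in>facets K. flux a' c' E' K = (if E' = E then s K else 0)"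
      by (rule single_face_field[OF E])
    have "normal_continuous a' c'" unfolding normal_continuous_def
    proof
      fix E' assume E': "E' \<in> interior_faces \<Omega> \<T>"
      have "(\<Sum>K\<in>{K\<in>\<T>. E' \<in> facets K}. flux a' c' E' K) = (\<Sum>K\<in>{K\<in>\<T>. E' \<in> facets K}. if E' = E then s K else 0)"
        by (intro sum.cong) (auto simp: fl)
      also have "\<dots> = 0" using s E' by (cases "E' = E") auto
      finally show "(\<Sum>K\<in>{K\<in>\<T>. E' \<in> facets K}. flux a' c' E' K) = 0" .
    qed
    then have \<tau>: "glue (\<lambda>K x. a' K + c' K *\<^sub>R x) \<in> RT \<Omega> \<T>" (is "?\<tau> \<in> _") by (rule glue_RT)
    have "l2_inner \<Omega> \<sigma> ?\<tau> = (\<Sum>K\<in>\<T>. ?I K (\<lambda>x. (a K + c K *\<^sub>R x) \<bullet> (a' K + c' K *\<^sub>R x)))"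
      by (rule l2_inner_pieces(2)[OF ac _ AE_glue]) (auto intro!: continuous_intros)
    moreover have "l2_inner \<Omega> \<rho> (weak_div \<Omega> ?\<tau>) = (\<Sum>K\<in>\<T>. w K * (?n * c' K * vol K))"
      using l2_inner_weak_div[OF \<tau> AE_glue w] by (simp only: integral_const_vol)
    ultimately have "0 = (\<Sum>K\<in>\<T>. ?I K (\<lambda>x. (a' K + c' K *\<^sub>R x) \<bullet> (a K + c K *\<^sub>R x)) + ?n * c' K * ?I K (?y K))"
      using eq1[OF \<tau>] by (simp add: sum.distrib mean inner_commute mult.assoc mult.left_commute)
    also have "\<dots> = (\<Sum>K\<in>\<T>. ?I K (\<lambda>x. (a' K + c' K *\<^sub>R x) \<bullet> (a K + c K *\<^sub>R x) + ?n * c' K * ?y K x))"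
    proof (rule sum.cong)
      fix K assume K: "K \<in> \<T>"
      have "integrable (lebesgue_on K) (\<lambda>x. (a' K + c' K *\<^sub>R x) \<bullet> (a K + c K *\<^sub>R x))"
        by (rule int[OF K]) (intro continuous_intros)
      then show "?I K (\<lambda>x. (a' K + c' K *\<^sub>R x) \<bullet> (a K + c K *\<^sub>R x)) + ?n * c' K * ?I K (?y K) =
        ?I K (\<lambda>x. (a' K + c' K *\<^sub>R x) \<bullet> (a K + c K *\<^sub>R x) + ?n * c' K * ?y K x)"
        using int[OF K continuous_on_quad] by simp
    qed simp
    also have "\<dots> = (\<Sum>E'\<in>mesh_faces \<T>. \<Sum>K\<in>{K\<in>\<T>. E' \<in> facets K}. flux a' c' E' K * face_integral E' (?y K))"
      by (rule green_mesh[OF yG]) (intro continuous_intros)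
    also have "\<dots> = (\<Sum>E'\<in>mesh_faces \<T>. if E' = E then (\<Sum>K\<in>{K\<in>\<T>. E \<in> facets K}. s K * face_integral E (?y K)) else 0)"
      by (intro sum.cong) (auto simp: fl)
    also have "\<dots> = (\<Sum>K\<in>{K\<in>\<T>. E \<in> facets K}. s K * face_integral E (?y K))"
      using E finite_mesh_faces by simp
    finally show ?thesis ..
  qed

  have yt: "same_traces ?y"
    unfolding same_traces_def
  proof (intro conjI ballI impI)
    fix E K K' assume E: "E \<in> interior_faces \<Omega> \<T>" and K: "K \<in> \<T>" "K' \<in> \<T>" "K \<noteq> K' \<and> E \<in> facets K \<and> E \<in> facets K'"
    obtain L L' where L: "L \<in> \<T>" "L' \<in> \<T>" "L \<noteq> L'" "E \<in> facets L" "E \<in> facets L'" "{K \<in> \<T>. E \<in> facets K} = {L, L'}"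
      by (rule interior_face_elements[OF E])
    have "K \<in> {K \<in> \<T>. E \<in> facets K}" "K' \<in> {K \<in> \<T>. E \<in> facets K}" using K by auto
    then have KK: "{K \<in> \<T>. E \<in> facets K} = {K, K'}" using K(3) unfolding L(6) by auto
    \<comment> \<open>Unit flux from one neighbour into the other compares the two face integrals.\<close>
    define s where "s J = (if J = K then 1 else - 1 :: real)" for J
    have sK: "s K = 1" "s K' = - 1" using K(3) by (auto simp: s_def)
    have "(\<Sum>J\<in>{K, K'}. s J * face_integral E (?y J)) = 0"
      using face[of E s] E K(3) unfolding KK by (simp add: sK interior_faces_def)
    then show "face_integral E (?y K) = face_integral E (?y K')" using K(3) by (simp add: sK)
  next
    fix E K assume E: "E \<in> boundary_faces \<Omega> \<T>" and K: "K \<in> \<T>" "E \<in> facets K"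
    \<comment> \<open>A boundary face may have elements on both sides, so the flux is prescribed on \<open>K\<close> alone.\<close>
    have "(\<Sum>J\<in>{J\<in>\<T>. E \<in> facets J}. (if J = K then 1 else 0) * face_integral E (?y J)) = 0"
      using E by (intro face) (auto simp: interior_faces_def boundary_faces_def)
    moreover have "(\<Sum>J\<in>{J\<in>\<T>. E \<in> facets J}. (if J = K then 1 else 0) * face_integral E (?y J))
       = (\<Sum>J\<in>{J\<in>\<T>. E \<in> facets J}. if J = K then face_integral E (?y J) else 0)"
      by (intro sum.cong) auto
    ultimately show "face_integral E (?y K) = 0" using finite_T K by simp
  qed

  define F where "F p = (\<Sum>K\<in>\<T>. fc K * ?I K (p K))" for p :: "(real^'n) set \<Rightarrow> real^'n \<Rightarrow> real"
  \<comment> \<open>The lifting solves the discrete problem of \<open>u\<close>: the divergence term is \<open>- (f, v)\<close>.\<close>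
  have y_test: "(\<Sum>K\<in>\<T>. ?I K (\<lambda>x. (a K + c K *\<^sub>R x) \<bullet> (\<beta> K + (2 * \<gamma> K) *\<^sub>R x))) = F (\<lambda>K. quad (\<alpha> K) (\<beta> K) (\<gamma> K))"
    if t: "same_traces (\<lambda>K. quad (\<alpha> K) (\<beta> K) (\<gamma> K))" for \<alpha> \<beta> \<gamma>
  proof -
    have "0 = (\<Sum>K\<in>\<T>. ?I K (\<lambda>x. (a K + c K *\<^sub>R x) \<bullet> (\<beta> K + (2 * \<gamma> K) *\<^sub>R x) + ?n * c K * quad (\<alpha> K) (\<beta> K) (\<gamma> K) x))"
    proof (rule integration_by_parts[OF GDERIV_quad _ nc, symmetric])
      show "continuous_on UNIV (\<lambda>x. \<beta> K + (2 * \<gamma> K) *\<^sub>R x)" for K by (intro continuous_intros)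
      show "face_integral E (quad (\<alpha> K) (\<beta> K) (\<gamma> K)) = face_integral E (quad (\<alpha> K') (\<beta> K') (\<gamma> K'))"
        if "E \<in> interior_faces \<Omega> \<T>" "K \<in> \<T>" "K' \<in> \<T>" "K \<noteq> K'" "E \<in> facets K" "E \<in> facets K'" for E K K'
        by (rule same_tracesD(1)[OF t that])
      show "face_integral E (quad (\<alpha> K) (\<beta> K) (\<gamma> K)) = 0"
        if "E \<in> boundary_faces \<Omega> \<T>" "K \<in> \<T>" "E \<in> facets K" for E K
        by (rule same_tracesD(2)[OF t that])
    qed
    also have "\<dots> = (\<Sum>K\<in>\<T>. ?I K (\<lambda>x. (a K + c K *\<^sub>R x) \<bullet> (\<beta> K + (2 * \<gamma> K) *\<^sub>R x)) - fc K * ?I K (quad (\<alpha> K) (\<beta> K) (\<gamma> K)))"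
    proof (rule sum.cong)
      fix K assume K: "K \<in> \<T>"
      have "integrable (lebesgue_on K) (\<lambda>x. (a K + c K *\<^sub>R x) \<bullet> (\<beta> K + (2 * \<gamma> K) *\<^sub>R x))"
        by (rule int[OF K]) (intro continuous_intros)
      then show "?I K (\<lambda>x. (a K + c K *\<^sub>R x) \<bullet> (\<beta> K + (2 * \<gamma> K) *\<^sub>R x) + ?n * c K * quad (\<alpha> K) (\<beta> K) (\<gamma> K) x) =
        ?I K (\<lambda>x. (a K + c K *\<^sub>R x) \<bullet> (\<beta> K + (2 * \<gamma> K) *\<^sub>R x)) - fc K * ?I K (quad (\<alpha> K) (\<beta> K) (\<gamma> K))"
        using int[OF K continuous_on_quad] div[OF K] by simp
    qed simp
    finally show ?thesis by (simp add: sum_subtractf F_def)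
  qed
  have u_test: "(\<Sum>K\<in>\<T>. ?I K (\<lambda>x. (u\<beta> K + (2 * u\<gamma> K) *\<^sub>R x) \<bullet> (\<beta> K + (2 * \<gamma> K) *\<^sub>R x))) = F (\<lambda>K. quad (\<alpha> K) (\<beta> K) (\<gamma> K))"
    if t: "same_traces (\<lambda>K. quad (\<alpha> K) (\<beta> K) (\<gamma> K))" for \<alpha> \<beta> \<gamma>
  proof -
    let ?v = "glue (\<lambda>K. quad (\<alpha> K) (\<beta> K) (\<gamma> K))"
    have v: "?v \<in> V_ECR \<Omega> \<T>" by (rule V_ECR_I[OF t])
    have nab: "AE x in lebesgue_on K. nabla_NC \<T> q x = \<beta>' + (2 * \<gamma>') *\<^sub>R x"
      if "K \<in> \<T>" "AE x in lebesgue_on K. q x = quad \<alpha>' \<beta>' \<gamma>' x" for K q \<alpha>' \<beta>' \<gamma>'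
      using AE_interior[OF that(1)] by (rule eventually_mono) (rule nabla_NC_eq[OF that])
    have "l2_inner \<Omega> (nabla_NC \<T> u) (nabla_NC \<T> ?v) =
        (\<Sum>K\<in>\<T>. ?I K (\<lambda>x. (u\<beta> K + (2 * u\<gamma> K) *\<^sub>R x) \<bullet> (\<beta> K + (2 * \<gamma> K) *\<^sub>R x)))"
      by (rule l2_inner_pieces(2)[OF nab[OF _ uq] _ nab[OF _ AE_glue]]) (auto intro!: continuous_intros)
    moreover have "l2_inner \<Omega> f ?v = F (\<lambda>K. quad (\<alpha> K) (\<beta> K) (\<gamma> K))"
      unfolding F_def by (rule l2_const[OF fc AE_glue continuous_on_quad])
    ultimately show ?thesis using u_eq[OF v] by simp
  qed

  have grads: "a K = u\<beta> K \<and> c K = 2 * u\<gamma> K" if K: "K \<in> \<T>" for K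
  proof -
    \<comment> \<open>Testing both problems with both functions gives all terms of the squared norm of the gradient difference.\<close>
    let ?gy = "\<lambda>K x. a K + c K *\<^sub>R x" and ?gu = "\<lambda>K x. u\<beta> K + (2 * u\<gamma> K) *\<^sub>R x"
    have yy: "(\<Sum>K\<in>\<T>. ?I K (\<lambda>x. ?gy K x \<bullet> ?gy K x)) = F ?y" using y_test[OF yt] by simp
    have yu: "(\<Sum>K\<in>\<T>. ?I K (\<lambda>x. ?gy K x \<bullet> ?gu K x)) = F ?u" by (rule y_test[OF ut])
    have uy: "(\<Sum>K\<in>\<T>. ?I K (\<lambda>x. ?gu K x \<bullet> ?gy K x)) = F ?y" using u_test[OF yt] by simp
    have uu: "(\<Sum>K\<in>\<T>. ?I K (\<lambda>x. ?gu K x \<bullet> ?gu K x)) = F ?u" by (rule u_test[OF ut])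
    let ?d = "\<lambda>K x. (?gy K x - ?gu K x) \<bullet> (?gy K x - ?gu K x)"
    have expand: "?I L (?d L) = ?I L (\<lambda>x. ?gy L x \<bullet> ?gy L x) - ?I L (\<lambda>x. ?gy L x \<bullet> ?gu L x)
        - ?I L (\<lambda>x. ?gu L x \<bullet> ?gy L x) + ?I L (\<lambda>x. ?gu L x \<bullet> ?gu L x)" if L: "L \<in> \<T>" for L
    proof -
      have i: "integrable (lebesgue_on L) (\<lambda>x. ?gy L x \<bullet> ?gy L x)" "integrable (lebesgue_on L) (\<lambda>x. ?gy L x \<bullet> ?gu L x)"
        "integrable (lebesgue_on L) (\<lambda>x. ?gu L x \<bullet> ?gy L x)" "integrable (lebesgue_on L) (\<lambda>x. ?gu L x \<bullet> ?gu L x)"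
        by (rule int[OF L]; intro continuous_intros)+
      have "?d L = (\<lambda>x. ?gy L x \<bullet> ?gy L x - ?gy L x \<bullet> ?gu L x - ?gu L x \<bullet> ?gy L x + ?gu L x \<bullet> ?gu L x)"
        by (simp only: inner_diff_left inner_diff_right) (simp add: algebra_simps)
      then have "?I L (?d L) = ?I L (\<lambda>x. ?gy L x \<bullet> ?gy L x - ?gy L x \<bullet> ?gu L x - ?gu L x \<bullet> ?gy L x + ?gu L x \<bullet> ?gu L x)"
        by (rule arg_cong)
      also have "\<dots> = ?I L (\<lambda>x. ?gy L x \<bullet> ?gy L x) - ?I L (\<lambda>x. ?gy L x \<bullet> ?gu L x)
        - ?I L (\<lambda>x. ?gu L x \<bullet> ?gy L x) + ?I L (\<lambda>x. ?gu L x \<bullet> ?gu L x)"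
        using i by (simp only: Bochner_Integration.integral_add Bochner_Integration.integral_diff
            Bochner_Integration.integrable_diff)
      finally show ?thesis .
    qed
    have "(\<Sum>L\<in>\<T>. ?I L (?d L)) = (\<Sum>K\<in>\<T>. ?I K (\<lambda>x. ?gy K x \<bullet> ?gy K x)) - (\<Sum>K\<in>\<T>. ?I K (\<lambda>x. ?gy K x \<bullet> ?gu K x))
      - (\<Sum>K\<in>\<T>. ?I K (\<lambda>x. ?gu K x \<bullet> ?gy K x)) + (\<Sum>K\<in>\<T>. ?I K (\<lambda>x. ?gu K x \<bullet> ?gu K x))"
      by (simp only: sum.cong[OF refl expand] sum.distrib sum_subtractf)
    also have "\<dots> = 0" unfolding yy yu uy uu by simp
    finally have "(\<Sum>L\<in>\<T>. ?I L (?d L)) = 0" .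
    moreover have "0 \<le> ?I L (?d L)" for L by (rule Bochner_Integration.integral_nonneg) simp
    ultimately have z: "?I K (?d K) = 0" using finite_T K by (simp add: sum_nonneg_eq_0_iff)
    have "?gy K x = ?gu K x" if x: "x \<in> K" for x
    proof -
      have "?d K x = 0" by (rule continuous_nonneg_integral_0[OF K _ _ z x]) (auto intro!: continuous_intros)
      then show ?thesis by simp
    qed
    then show ?thesis by (rule affine_field_unique[OF K])
  qed

  \<comment> \<open>The difference of the two functions, a constant on each element.\<close>
  define W where "W K = y\<alpha> K - u\<alpha> K" for K
  have Wd: "(\<lambda>x. ?y K x - ?u K x) = (\<lambda>x. W K * 1)" if "K \<in> \<T>" for K
    using grads[OF that] by (auto simp: quad_def W_def)
  have Wf: "W K * face_integral E (\<lambda>x. 1) = face_integral E (?y K) - face_integral E (?u K)"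
    if "K \<in> \<T>" "E \<in> facets K" for K E
    unfolding face_integral_cmult[symmetric] Wd[OF that(1), symmetric]
    by (rule face_integral_diff_facet[OF that continuous_on_quad continuous_on_quad])
  have Weq: "W K = W K'" if "E \<in> interior_faces \<Omega> \<T>" "K \<in> \<T>" "K' \<in> \<T>" "K \<noteq> K'" "E \<in> facets K" "E \<in> facets K'" for E K K'
  proof -
    have "W K * face_integral E (\<lambda>x. 1) = W K' * face_integral E (\<lambda>x. 1)"
      using Wf[OF that(2,5)] Wf[OF that(3,6)] same_tracesD(1)[OF yt that] same_tracesD(1)[OF ut that]
      by linarith
    then show ?thesis using face_area_pos_facet[OF that(2,5)] by simp
  qed
  have W0: "W K = 0" if "E \<in> boundary_faces \<Omega> \<T>" "K \<in> \<T>" "E \<in> facets K" for E K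
  proof -
    have "W K * face_integral E (\<lambda>x. 1) = 0"
      using Wf[OF that(2,3)] same_tracesD(2)[OF yt that] same_tracesD(2)[OF ut that] by linarith
    then show ?thesis using face_area_pos_facet[OF that(2,3)] by simp
  qed
  \<comment> \<open>The field \<open>W x\<close> is conforming, and integrating it by parts against \<open>W\<close> yields \<open>n \<parallel>W\<parallel>\<^sup>2 = 0\<close>.\<close>
  have ncW: "normal_continuous (\<lambda>K. 0) W" unfolding normal_continuous_def
  proof
    fix E assume E: "E \<in> interior_faces \<Omega> \<T>"
    obtain K K' where K: "K \<in> \<T>" "K' \<in> \<T>" "K \<noteq> K'" "E \<in> facets K" "E \<in> facets K'" "{K \<in> \<T>. E \<in> facets K} = {K, K'}"
      by (rule interior_face_elements[OF E])
    show "(\<Sum>K\<in>{K\<in>\<T>. E \<in> facets K}. flux (\<lambda>K. 0) W E K) = 0"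
      unfolding K(6) using K(3) Weq[OF E K(1-5)] opposite_normals[OF K(1-5)]
      by (simp add: flux_def)
  qed
  have "(\<Sum>K\<in>\<T>. ?I K (\<lambda>x. (0 + W K *\<^sub>R x) \<bullet> 0 + ?n * W K * W K)) = 0"
  proof (rule integration_by_parts[OF _ _ ncW])
    show "GDERIV (\<lambda>x. W K) x :> 0" for K x by (rule GDERIV_const)
    show "face_integral E (\<lambda>x. W K) = face_integral E (\<lambda>x. W K')"
      if "E \<in> interior_faces \<Omega> \<T>" "K \<in> \<T>" "K' \<in> \<T>" "K \<noteq> K'" "E \<in> facets K" "E \<in> facets K'" for E K K'
      using Weq[OF that] by simp
    show "face_integral E (\<lambda>x. W K) = 0" if "E \<in> boundary_faces \<Omega> \<T>" "K \<in> \<T>" "E \<in> facets K" for E K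
      using W0[OF that] by (simp add: face_integral_def)
  qed simp
  then have "(\<Sum>K\<in>\<T>. (?n * W K * W K) * vol K) = 0"
    by (simp only: inner_zero_right add_0_left integral_const_vol)
  moreover have "0 \<le> (?n * W K * W K) * vol K" if "K \<in> \<T>" for K
  proof -
    have "0 \<le> ?n * (W K * W K)" by simp
    then show ?thesis using vol_pos[OF that] by (simp only: mult.assoc mult_nonneg_nonneg less_imp_le flip: mult.assoc)
  qed
  ultimately have "\<forall>K\<in>\<T>. (?n * W K * W K) * vol K = 0"
    using finite_T by (subst (asm) sum_nonneg_eq_0_iff) auto
  then have W: "W K = 0" if "K \<in> \<T>" for K using vol_pos[OF that] that by fastforce
  have mean_u: "?I K (?u K) = w K * vol K" if K: "K \<in> \<T>" for K
    using mean[OF K] grads[OF K] W[OF K] by (simp add: W_def)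

  show "AE x in lebesgue_on \<Omega>. \<sigma> x = nabla_NC \<T> u x"
    unfolding AE_dom_iff
  proof
    fix K assume K: "K \<in> \<T>"
    show "AE x in lebesgue_on K. \<sigma> x = nabla_NC \<T> u x"
      using ac[OF K] AE_interior[OF K]
      by eventually_elim (simp add: nabla_NC_eq[OF K uq[OF K]] grads[OF K])
  qed

  \<comment> \<open>Orthogonality to piecewise constants only sees the means of \<open>u\<close>, which are those of \<open>\<rho>\<close>.\<close>
  have proj: "l2_inner \<Omega> (\<lambda>x. u x - q x) z = (\<Sum>K\<in>\<T>. z' K * ((w K - q' K) * vol K))"
    if q: "\<And>K. K \<in> \<T> \<Longrightarrow> AE x in lebesgue_on K. q x = q' K" and z: "\<And>K. K \<in> \<T> \<Longrightarrow> AE x in lebesgue_on K. z x = z' K"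
    for q z q' z'
  proof -
    have ae: "AE x in lebesgue_on K. u x - q x = ?u K x - q' K" if "K \<in> \<T>" for K
      using uq[OF that] q[OF that] by eventually_elim simp
    have "l2_inner \<Omega> (\<lambda>x. u x - q x) z = l2_inner \<Omega> z (\<lambda>x. u x - q x)" by (simp add: l2_inner_def mult.commute)
    also have "\<dots> = (\<Sum>K\<in>\<T>. z' K * ?I K (\<lambda>x. ?u K x - q' K))"
      by (rule l2_const[OF z ae]) (auto intro!: continuous_intros continuous_on_quad)
    also have "\<dots> = (\<Sum>K\<in>\<T>. z' K * ((w K - q' K) * vol K))"
    proof (rule sum.cong)
      fix K assume K: "K \<in> \<T>"
      have "?I K (\<lambda>x. ?u K x - q' K) = ?I K (?u K) - ?I K (\<lambda>x. q' K)"
        by (rule Bochner_Integration.integral_diff[OF int[OF K continuous_on_quad] int[OF K continuous_on_const]])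
      then show "z' K * ?I K (\<lambda>x. ?u K x - q' K) = z' K * ((w K - q' K) * vol K)"
        unfolding mean_u[OF K] integral_const_vol by (simp add: left_diff_distrib)
    qed simp
    finally show ?thesis .
  qed
  have "\<rho> \<in> U_RT \<Omega> \<T> \<and> (\<forall>z\<in>U_RT \<Omega> \<T>. l2_inner \<Omega> (\<lambda>x. u x - \<rho> x) z = 0)"
  proof (intro conjI ballI \<rho>)
    fix z assume "z \<in> U_RT \<Omega> \<T>"
    then have "piecewise_constant \<T> z" by (simp add: U_RT_def)
    then obtain z' where "\<forall>K\<in>\<T>. AE x in lebesgue_on K. z x = z' K" by (rule piecewise_constant_E)
    from proj[OF w bspec[OF this]] show "l2_inner \<Omega> (\<lambda>x. u x - \<rho> x) z = 0" by simp
  qed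
  then have P: "Pi0 \<Omega> \<T> u \<in> U_RT \<Omega> \<T> \<and> (\<forall>z\<in>U_RT \<Omega> \<T>. l2_inner \<Omega> (\<lambda>x. u x - Pi0 \<Omega> \<T> u x) z = 0)"
    by (rule someI[of "\<lambda>w. w \<in> U_RT \<Omega> \<T> \<and> (\<forall>z\<in>U_RT \<Omega> \<T>. l2_inner \<Omega> (\<lambda>x. u x - w x) z = 0)" \<rho>,
          folded Pi0_def])
  then have "piecewise_constant \<T> (Pi0 \<Omega> \<T> u)" by (simp add: U_RT_def)
  then obtain q where "\<forall>K\<in>\<T>. AE x in lebesgue_on K. Pi0 \<Omega> \<T> u x = q K" by (rule piecewise_constant_E)
  note q = bspec[OF this]
  have qw: "q K = w K" if K: "K \<in> \<T>" for K
  proof -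
    let ?z = "\<lambda>L. if L = K then 1 else 0 :: real"
    have "0 = (\<Sum>L\<in>\<T>. ?z L * ((w L - q L) * vol L))"
      using proj[OF q AE_glue[of _ "\<lambda>L x. ?z L"]] P U_RT_I[of ?z] by simp
    also have "\<dots> = (w K - q K) * vol K" by (rule pick[OF K])
    finally show ?thesis using vol_pos[OF K] by simp
  qed
  show "AE x in lebesgue_on \<Omega>. \<rho> x = Pi0 \<Omega> \<T> u x"
    unfolding AE_dom_iff
  proof
    fix K assume K: "K \<in> \<T>"
    show "AE x in lebesgue_on K. \<rho> x = Pi0 \<Omega> \<T> u x"
      using w[OF K] q[OF K] by eventually_elim (simp add: qw[OF K])
  qed
qed

end

theorem theorem3p3:
  fixes \<Omega> :: "(real^'n) set" and \<T> :: "(real^'n) set set" and \<kappa> :: real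
    and f u_ECR u_RT :: "real^'n \<Rightarrow> real" and \<sigma>_RT :: "real^'n \<Rightarrow> real^'n"
  assumes "polytopal_domain \<Omega>"
    and "triangulation_of \<Omega> \<T>"
    and "shape_regular \<kappa> \<T>"
    and "piecewise_constant \<T> f"
    and "u_ECR \<in> V_ECR \<Omega> \<T>"
    and "\<And>v. v \<in> V_ECR \<Omega> \<T> \<Longrightarrow>
           l2_inner \<Omega> (nabla_NC \<T> u_ECR) (nabla_NC \<T> v) = l2_inner \<Omega> f v"
    and "\<sigma>_RT \<in> RT \<Omega> \<T>"
    and "u_RT \<in> U_RT \<Omega> \<T>"
    and "\<And>\<tau>. \<tau> \<in> RT \<Omega> \<T> \<Longrightarrow>
           l2_inner \<Omega> \<sigma>_RT \<tau> + l2_inner \<Omega> u_RT (weak_div \<Omega> \<tau>) = 0"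
    and "\<And>v. v \<in> U_RT \<Omega> \<T> \<Longrightarrow>
           l2_inner \<Omega> (weak_div \<Omega> \<sigma>_RT) v = - l2_inner \<Omega> f v"
  shows "(AE x in lebesgue_on \<Omega>. \<sigma>_RT x = nabla_NC \<T> u_ECR x) \<and>
         (AE x in lebesgue_on \<Omega>. u_RT x = Pi0 \<Omega> \<T> u_ECR x)"
proof -
  interpret mesh \<Omega> \<T> using assms(1,2) by unfold_locales
  show ?thesis
    using RT_solution_is_ECR_gradient[OF assms(4-10)] by blast
qed

end
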